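(* Let $G$ be a finitely generated torsion-free nilpotent group, and let $\phi:H\to G$ be a surjective virtual endomorphism of $G$ with trivial $\phi$-core. Let $\widehat{\phi}$ be the induced automorphism of the Lie algebra of the Mal'cev completion of $G$. Then every self-similar action of $(G,\phi)$ is finite-state (that is, for every set $D$ of coset representatives of $H$ in $G$ the self-similar action of $G$ associated to the triple $(G,\phi,D)$ is finite-state) if and only if the spectral radius of $\widehat{\phi}$ is less than $1$.
   Context: Self-similar actions. Let $X$ be a finite alphabet and $X^{*}$ the set of finite words over $X$. An action of a group $G$ on $X^{*}$ is self-similar if for every $x\in X$ and $g\in G$ there exist $y\in X$ and $h\in G$ such that $g(xv)=y\,h(v)$ for all $v\in X^{*}$. If the action is faithful, $h$ is unique; it is called the state of $g$ at $x$ and denoted $g|_x$. Iteratively $g|_{x_1x_2\ldots x_n}=g|_{x_1}|_{x_2}\ldots|_{x_n}$ (and $g|_\emptyset=g$). A faithful self-similar action is finite-state if for every $g\in G$ the set $\{g|_v: v\in X^{*}\}$ is finite. Virtual endomorphisms and associated actions. A virtual endomorphism of $G$ is a homomorphism $\phi:H\to G$ from a subgroup $H\le G$ of finite index. Let $D=\{q_x : x\in X\}$ be a set of representatives of the left cosets of $H$ in $G$ (a digit set), indexed by an alphabet $X$ with $|X|=[G:H]$. The self-similar action associated to $(G,\phi,D)$ fixes the empty word and is defined recursively by $g(xv)=y\,h(v)$ with $h=\phi(q_y^{-1}gq_x)$, where $y\in X$ is the unique letter with $q_y^{-1}gq_x\in H$. A self-similar action of $(G,\phi)$ means the action associated to $(G,\phi,D)$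 for some digit set $D$. The kernel of this action is the $\phi$-core: the maximal normal subgroup $N$ of $G$ with $N\le H$ and $\phi(N)\subseteq N$; so when the $\phi$-core is trivial all these actions are faithful. Mal'cev completion. For a finitely generated torsion-free nilpotent group $G$ there is a unique connected, simply connected real nilpotent Lie group $L$ (the Mal'cev completion of $G$) containing $G$ as a discrete subgroup with $L/G$ compact. A surjective virtual endomorphism $\phi:H\to G$ with trivial $\phi$-core is injective (a known fact), hence an isomorphism. Since $H$ has finite index in $G$, $L$ is also the Mal'cev completion of $H$, and $\phi$ extends uniquely to an automorphism of the Lie group $L$, also denoted $\phi$. Let $\mathscr{L}$ be the Lie algebra of $L$; $\widehat{\phi}:\mathscr{L}\to\mathscr{L}$ denotes the differential of $\phi:L\to L$ at the identity, an automorphism of $\mathscr{L}$. The spectrum of $\widehat{\phi}$ is taken over $\mathbb{C}$. *)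

theory Defs
  imports "HOL-Analysis.Analysis" "HOL-Algebra.Generated_Groups" "HOL-Algebra.Group_Action"
begin

section \<open>Finitely generated torsion-free nilpotent groups\<close>

definition finitely_generated_group :: "('g, 'm) monoid_scheme \<Rightarrow> bool" where
  "finitely_generated_group G \<longleftrightarrow>
     (\<exists>S. finite S \<and> S \<subseteq> carrier G \<and> generate G S = carrier G)"

definition torsion_free_group :: "('g, 'm) monoid_scheme \<Rightarrow> bool" where
  "torsion_free_group G \<longleftrightarrow>
     (\<forall>g\<in>carrier G. \<forall>n::nat. 0 < n \<longrightarrow> g [^]\<^bsub>G\<^esub> n = \<one>\<^bsub>G\<^esub> \<longrightarrow> g = \<one>\<^bsub>G\<^esub>)"

primrec lower_central_series :: "('g, 'm) monoid_scheme \<Rightarrow> nat \<Rightarrow> 'g set" where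
  "lower_central_series G 0 = carrier G"
| "lower_central_series G (Suc n) =
     generate G (\<Union>x\<in>lower_central_series G n. \<Union>y\<in>carrier G.
       {x \<otimes>\<^bsub>G\<^esub> y \<otimes>\<^bsub>G\<^esub> inv\<^bsub>G\<^esub> x \<otimes>\<^bsub>G\<^esub> inv\<^bsub>G\<^esub> y})"

definition nilpotent_group :: "('g, 'm) monoid_scheme \<Rightarrow> bool" where
  "nilpotent_group G \<longleftrightarrow> (\<exists>n. lower_central_series G n = {\<one>\<^bsub>G\<^esub>})"


section \<open>Self-similar actions\<close>

definition self_similar_action ::
    "('g, 'm) monoid_scheme \<Rightarrow> 'x set \<Rightarrow> ('g \<Rightarrow> 'x list \<Rightarrow> 'x list) \<Rightarrow> bool" where
  "self_similar_action G X act \<longleftrightarrow>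
     finite X \<and>
     group_action G (lists X) (\<lambda>g. restrict (act g) (lists X)) \<and>
     (\<forall>x\<in>X. \<forall>g\<in>carrier G. \<exists>y\<in>X. \<exists>h\<in>carrier G.
        \<forall>v\<in>lists X. act g (x # v) = y # act h v)"

definition faithful_self_similar_action ::
    "('g, 'm) monoid_scheme \<Rightarrow> 'x set \<Rightarrow> ('g \<Rightarrow> 'x list \<Rightarrow> 'x list) \<Rightarrow> bool" where
  "faithful_self_similar_action G X act \<longleftrightarrow>
     self_similar_action G X act \<and>
     faithful_action G (lists X) (\<lambda>g. restrict (act g) (lists X))"

definition letter_state ::
    "('g, 'm) monoid_scheme \<Rightarrow> 'x set \<Rightarrow> ('g \<Rightarrow> 'x list \<Rightarrow> 'x list) \<Rightarrow> 'g \<Rightarrow> 'x \<Rightarrow> 'g" where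
  "letter_state G X act g x =
     (THE h. h \<in> carrier G \<and> (\<exists>y\<in>X. \<forall>v\<in>lists X. act g (x # v) = y # act h v))"

fun word_state ::
    "('g, 'm) monoid_scheme \<Rightarrow> 'x set \<Rightarrow> ('g \<Rightarrow> 'x list \<Rightarrow> 'x list) \<Rightarrow> 'g \<Rightarrow> 'x list \<Rightarrow> 'g" where
  "word_state G X act g [] = g"
| "word_state G X act g (x # v) = word_state G X act (letter_state G X act g x) v"

definition finite_state_action ::
    "('g, 'm) monoid_scheme \<Rightarrow> 'x set \<Rightarrow> ('g \<Rightarrow> 'x list \<Rightarrow> 'x list) \<Rightarrow> bool" where
  "finite_state_action G X act \<longleftrightarrow>
     faithful_self_similar_action G X act \<and>
     (\<forall>g\<in>carrier G. finite (word_state G X act g ` lists X))"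


section \<open>Virtual endomorphisms and the associated actions\<close>

text \<open>The homomorphism is a total function; only its values on \<open>H\<close> matter.\<close>

definition virtual_endomorphism ::
    "('g, 'm) monoid_scheme \<Rightarrow> 'g set \<Rightarrow> ('g \<Rightarrow> 'g) \<Rightarrow> bool" where
  "virtual_endomorphism G H \<phi> \<longleftrightarrow>
     subgroup H G \<and> finite (rcosets\<^bsub>G\<^esub> H) \<and> \<phi> \<in> hom (G\<lparr>carrier := H\<rparr>) G"

definition is_virtual_core ::
    "('g, 'm) monoid_scheme \<Rightarrow> 'g set \<Rightarrow> ('g \<Rightarrow> 'g) \<Rightarrow> 'g set \<Rightarrow> bool" where
  "is_virtual_core G H \<phi> N \<longleftrightarrow>
     N \<lhd> G \<and> N \<subseteq> H \<and> \<phi> ` N \<subseteq> N \<and>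
     (\<forall>M. M \<lhd> G \<and> M \<subseteq> H \<and> \<phi> ` M \<subseteq> M \<longrightarrow> M \<subseteq> N)"

definition digit_set ::
    "('g, 'm) monoid_scheme \<Rightarrow> 'g set \<Rightarrow> 'x set \<Rightarrow> ('x \<Rightarrow> 'g) \<Rightarrow> bool" where
  "digit_set G H X q \<longleftrightarrow>
     q ` X \<subseteq> carrier G \<and>
     bij_betw (\<lambda>x. q x <#\<^bsub>G\<^esub> H) X ((\<lambda>g. g <#\<^bsub>G\<^esub> H) ` carrier G)"

fun associated_action ::
    "('g, 'm) monoid_scheme \<Rightarrow> 'g set \<Rightarrow> ('g \<Rightarrow> 'g) \<Rightarrow> 'x set \<Rightarrow> ('x \<Rightarrow> 'g) \<Rightarrow>
     'g \<Rightarrow> 'x list \<Rightarrow> 'x list" where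
  "associated_action G H \<phi> X q g [] = []"
| "associated_action G H \<phi> X q g (x # v) =
     (let y = (THE y. y \<in> X \<and> inv\<^bsub>G\<^esub> (q y) \<otimes>\<^bsub>G\<^esub> g \<otimes>\<^bsub>G\<^esub> q x \<in> H)
      in y # associated_action G H \<phi> X q (\<phi> (inv\<^bsub>G\<^esub> (q y) \<otimes>\<^bsub>G\<^esub> g \<otimes>\<^bsub>G\<^esub> q x)) v)"


section \<open>Smooth manifolds and Lie groups\<close>

text \<open>Smoothness is meant for open \<open>S\<close> in a finite-dimensional space, where \<open>C\<^sup>k\<close> amounts to
  existence and continuity of all iterated directional derivatives up to order \<open>k\<close>.\<close>

primrec Ck_on :: "nat \<Rightarrow> 'a::real_normed_vector set \<Rightarrow> ('a \<Rightarrow> 'b::real_normed_vector) \<Rightarrow> bool" where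
  "Ck_on 0 S f \<longleftrightarrow> continuous_on S f"
| "Ck_on (Suc k) S f \<longleftrightarrow>
     (\<forall>x\<in>S. f differentiable (at x)) \<and>
     (\<forall>v. Ck_on k S (\<lambda>x. frechet_derivative f (at x) v))"

definition smooth_on :: "'a::real_normed_vector set \<Rightarrow> ('a \<Rightarrow> 'b::real_normed_vector) \<Rightarrow> bool" where
  "smooth_on S f \<longleftrightarrow> (\<forall>k. Ck_on k S f)"

text \<open>A chart is a pair of an open domain and a coordinate map that is meaningful on it.
  The model space is an arbitrary finite-dimensional normed space rather than a
  \<open>euclidean_space\<close>, because the latter has positive dimension, whereas the Mal'cev
  completion of the trivial group has dimension 0.\<close>

type_synonym ('l, 'e) chart = "'l set \<times> ('l \<Rightarrow> 'e)"

definition is_chart :: "('l::topological_space, 'e::real_normed_vector) chart \<Rightarrow> bool" where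
  "is_chart = (\<lambda>(U, c). open U \<and> open (c ` U) \<and> homeomorphism U (c ` U) c (inv_into U c))"

definition smooth_atlas ::
    "('l::{t2_space,second_countable_topology}, 'e::real_normed_vector) chart set \<Rightarrow> bool" where
  "smooth_atlas A \<longleftrightarrow>
     (\<exists>B::'e set. finite B \<and> span B = UNIV) \<and>
     (\<forall>C\<in>A. is_chart C) \<and> (\<Union>C\<in>A. fst C) = UNIV \<and>
     (\<forall>(U, c)\<in>A. \<forall>(V, d)\<in>A. smooth_on (c ` (U \<inter> V)) (d \<circ> inv_into U c))"

definition smooth_map ::
    "('l::topological_space, 'e::real_normed_vector) chart set \<Rightarrow>
     ('k::topological_space, 'f::real_normed_vector) chart set \<Rightarrow> ('l \<Rightarrow> 'k) \<Rightarrow> bool" where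
  "smooth_map A B f \<longleftrightarrow>
     continuous_on UNIV f \<and>
     (\<forall>(U, c)\<in>A. \<forall>(V, d)\<in>B. smooth_on (c ` (U \<inter> f -` V)) (d \<circ> f \<circ> inv_into U c))"

definition prod_atlas :: "('l, 'e) chart set \<Rightarrow> ('k, 'f) chart set \<Rightarrow> ('l \<times> 'k, 'e \<times> 'f) chart set"
  where "prod_atlas A B = (\<lambda>((U, c), (V, d)). (U \<times> V, map_prod c d)) ` (A \<times> B)"

locale lie_group = group L
  for L :: "'l::{t2_space,second_countable_topology} monoid" (structure) +
  fixes A :: "('l, 'e::real_normed_vector) chart set"
  assumes carrier_UNIV: "carrier L = UNIV"
    and atlas: "smooth_atlas A"
    and smooth_mult: "smooth_map (prod_atlas A A) A (\<lambda>(x, y). x \<otimes> y)"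
    and smooth_inv: "smooth_map A A (\<lambda>x. inv x)"

definition lie_automorphism ::
    "'l::{t2_space,second_countable_topology} monoid \<Rightarrow>
     ('l, 'e::real_normed_vector) chart set \<Rightarrow> ('l \<Rightarrow> 'l) \<Rightarrow> bool" where
  "lie_automorphism L A \<Phi> \<longleftrightarrow>
     \<Phi> \<in> iso L L \<and> smooth_map A A \<Phi> \<and> smooth_map A A (inv_into UNIV \<Phi>)"

text \<open>A chart around the identity identifies the Lie algebra, i.e. the tangent space at the
  identity, with the model space. The following is the differential at the identity of a map
  fixing the identity, in this identification.\<close>

definition lie_differential ::
    "'l monoid \<Rightarrow> ('l, 'e::real_normed_vector) chart \<Rightarrow> ('l \<Rightarrow> 'l) \<Rightarrow> 'e \<Rightarrow> 'e" where
  "lie_differential L = (\<lambda>(U, c) \<Phi>.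
     frechet_derivative (c \<circ> \<Phi> \<circ> inv_into U c) (at (c \<one>\<^bsub>L\<^esub>)))"


section \<open>Mal'cev completions\<close>

text \<open>The topology \<open>Y\<close> is uniquely determined as the quotient topology on the set of left
  cosets.\<close>

definition cocompact_subgroup :: "'l::topological_space monoid \<Rightarrow> 'l set \<Rightarrow> bool" where
  "cocompact_subgroup L \<Gamma> \<longleftrightarrow>
     subgroup \<Gamma> L \<and>
     (\<exists>Y. quotient_map euclidean Y (\<lambda>x. x <#\<^bsub>L\<^esub> \<Gamma>) \<and> compact_space Y)"

text \<open>The inclusion of \<open>G\<close> in its completion is an injective homomorphism \<open>\<iota>\<close>.\<close>

definition malcev_completion ::
    "('g, 'm) monoid_scheme \<Rightarrow> 'l::{t2_space,second_countable_topology} monoid \<Rightarrow>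
     ('l, 'e::real_normed_vector) chart set \<Rightarrow> ('g \<Rightarrow> 'l) \<Rightarrow> bool" where
  "malcev_completion G L A \<iota> \<longleftrightarrow>
     lie_group L A \<and> nilpotent_group L \<and>
     connected (UNIV :: 'l set) \<and> simply_connected (UNIV :: 'l set) \<and>
     \<iota> \<in> hom G L \<and> inj_on \<iota> (carrier G) \<and>
     discrete (\<iota> ` carrier G) \<and> cocompact_subgroup L (\<iota> ` carrier G)"


section \<open>Complex spectrum of a real linear map\<close>

text \<open>The complexification of a real space is modelled by pairs, \<open>(u, v)\<close> standing for
  \<open>u + \<i> v\<close>.\<close>

definition cscale :: "complex \<Rightarrow> 'e::real_vector \<times> 'e \<Rightarrow> 'e \<times> 'e" where
  "cscale z = (\<lambda>(u, v). (Re z *\<^sub>R u - Im z *\<^sub>R v, Im z *\<^sub>R u + Re z *\<^sub>R v))"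

definition complex_spectrum :: "('e::real_vector \<Rightarrow> 'e) \<Rightarrow> complex set" where
  "complex_spectrum T = {z. \<exists>w. w \<noteq> 0 \<and> map_prod T T w = cscale z w}"

text \<open>On the zero space the spectrum is empty and the spectral radius is 0.\<close>

definition complex_spectral_radius :: "('e::real_vector \<Rightarrow> 'e) \<Rightarrow> real" where
  "complex_spectral_radius T = Sup (insert 0 (cmod ` complex_spectrum T))"

end

theory Submission
  imports Defs "HOL-Computational_Algebra.Fundamental_Theorem_Algebra"
begin

text \<open>
  Write \<open>T\<close> for the differential of \<open>\<Phi>\<close> at the identity. The state of \<open>g\<close> at a word of length \<open>n\<close> is
  \<open>a\<inverse> \<Phi>\<^sup>n(g) b\<close> with \<open>a, b\<close> of the form \<open>\<Phi>\<^sup>n(d\<^sub>1) \<cdots> \<Phi>(d\<^sub>n)\<close>, the \<open>d\<^sub>i\<close> being digits. If \<open>T\<close> has spectral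
  radius less than 1, then \<open>\<Phi>\<^sup>n(x)\<close> tends to the identity exponentially fast, first near the identity and then
  for all \<open>x\<close> by connectedness; so all states of \<open>g\<close> lie in one compact set, which meets the
  discrete group \<open>G\<close> in a finite set.

  Conversely, suppose that \<open>T\<close> has an eigenvalue of modulus at least 1. The vectors \<open>x\<close> with
  \<open>T\<^sup>n x \<longlonglongrightarrow> 0\<close> form a proper subalgebra of a nilpotent Lie algebra, hence do not span it
  together with the derived algebra, and there is a nonzero functional \<open>f\<close> vanishing on brackets with
  \<open>f \<circ> T = \<lambda> f\<close>, \<open>\<bar>\<lambda>\<bar> \<ge> 1\<close>. As \<open>L\<close> is simply connected, \<open>f\<close> integrates to a homomorphism \<open>l\<close> from \<open>L\<close> to the complex numbers
  with \<open>l \<circ> \<Phi> = \<lambda> l\<close>, and \<open>l\<close> does not vanish on the cocompact subgroup \<open>G\<close>. Choose digits on which \<open>l\<close> is injective and \<open>g\<close>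
  with \<open>l g \<noteq> 0\<close>. If \<open>g\<close> had finitely many states, a state \<open>s\<close> maximising \<open>\<bar>l s\<bar>\<close> would have to
  act trivially, so \<open>s = 1\<close> and \<open>l s = 0\<close>, a contradiction.
\<close>

section \<open>Finite-dimensional normed spaces\<close>

text \<open>The exponential map is avoided. What is known of the multiplication is its expansion x +
  y + \<beta>(x, y) + o(|x||y|) in one chart centred at the identity; the Lie bracket is the
  antisymmetric part of \<beta>, and rescaled commutators of short segments transfer nilpotency from
  the group to this bracket. The functional f is complex-valued because its eigenvalue may be
  non-real. It must vanish on brackets because only then is f(\<beta>(x, y)) symmetric, so that a
  quadratic correction makes f additive up to o(|x||y|). Integration means summing corrected values
  over finer and finer subdivisions; a grid with n^2 cells plays the role of Stokes' theorem. A
  maximal state s acts trivially for a reason of convexity: s permutes the letters, so the digits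
  cancel when l is summed over the states of s at letters, and the mean of these values is \<lambda>
  l(s), of modulus at least the maximum. Hence all of them equal the mean, and as l separates
  digits, s fixes every letter; its states are again maximal.\<close>

lemma finite_dim_coordinates:
  assumes "\<exists>B::'e::real_normed_vector set. finite B \<and> span B = UNIV"
  shows "\<exists>(B::'e::real_normed_vector set) r K. finite B \<and> K > 0 \<and> (\<forall>x. (\<Sum>b\<in>B. r b x *\<^sub>R b) = x) \<and>
    (\<forall>b\<in>B. bounded_linear (r b)) \<and> (\<forall>b\<in>B. \<forall>x. \<bar>r b x\<bar> \<le> K * norm x)"
proof -
  obtain B0 :: "'e set" where B0: "finite B0" "span B0 = UNIV" using assms by blast
  obtain B where B: "B \<subseteq> B0" "independent B" "B0 \<subseteq> span B"
    using maximal_independent_subset by blast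
  have fB: "finite B" using B B0 finite_subset by blast
  have sB: "span B = UNIV"
    using B B0 by (metis span_eq top.extremum_uniqueI span_superset span_minimal subspace_span)
  define r where "r b x = representation B x b" for b x
  have x_eq: "x = (\<Sum>b\<in>B. r b x *\<^sub>R b)" for x
    unfolding r_def using sum_representation_eq[OF B(2) _ fB subset_refl, of x] sB by simp
  have lin: "linear (r b)" for b
    unfolding r_def by (rule linearI) (simp_all add: representation_add representation_scale B sB)
  define P where "P a = (\<Sum>b\<in>B. a b *\<^sub>R b)" for a :: "'e \<Rightarrow> real"
  \<comment> \<open>Coefficients are functions on the whole type, pinned to 0 off \<open>B\<close>,
    so that the box is compact by Tychonoff. On \<open>F b\<close>, where coordinate
    \<open>b\<close> has modulus 1, independence of \<open>B\<close> keeps \<open>P\<close> away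
    from 0.\<close>
  define bx where "bx = Pi\<^sub>E UNIV (\<lambda>b. if b \<in> B then {-1..1::real} else {0})"
  have cbx: "compact bx"
  proof -
    have "compactin (product_topology (\<lambda>i. euclidean) UNIV) bx"
      unfolding bx_def by (subst compactin_PiE) auto
    then show ?thesis by (simp add: euclidean_product_topology)
  qed
  have contc: "continuous_on UNIV (\<lambda>a::'e \<Rightarrow> real. a b)" for b
    by (rule continuous_on_product_coordinates)
  have contP: "continuous_on UNIV P"
    unfolding P_def by (intro continuous_intros contc)
  define F where "F b = bx \<inter> {a. \<bar>a b\<bar> = 1}" for b
  have cF: "compact (F b)" for b
  proof -
    have "closed {a::'e\<Rightarrow>real. \<bar>a b\<bar> = 1}"
      by (intro closed_Collect_eq continuous_intros contc)
    then show ?thesis unfolding F_def using cbx by (rule compact_Int_closed[rotated])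
  qed
  have indep0: "P a \<noteq> 0" if "a \<in> F b" "b \<in> B" for a b
  proof
    assume "P a = 0"
    then have "a b = 0"
      using independentD[OF B(2) fB subset_refl _ that(2), of a] unfolding P_def by blast
    with that show False unfolding F_def by simp
  qed
  have "\<exists>d>0. \<forall>a\<in>F b. d \<le> norm (P a)" if "b \<in> B" for b
  proof (cases "F b = {}")
    case False
    have "continuous_on (F b) (\<lambda>a. norm (P a))"
      using contP continuous_on_subset continuous_on_norm by blast
    then obtain a where "a \<in> F b" "\<forall>a'\<in>F b. norm (P a) \<le> norm (P a')"
      using continuous_attains_inf[OF cF False] by blast
    then show ?thesis using indep0[OF _ that] by (metis zero_less_norm_iff)
  qed (auto intro: exI[of _ 1])
  then obtain d where d: "\<And>b. b \<in> B \<Longrightarrow> d b > 0" "\<And>b a. b \<in> B \<Longrightarrow> a \<in> F b \<Longrightarrow> d b \<le> norm (P a)"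
    by metis
  define d0 where "d0 = Min (insert 1 (d ` B))"
  have d0: "d0 > 0" unfolding d0_def using fB d by auto
  have d0_le: "d0 \<le> d b" if "b \<in> B" for b unfolding d0_def using fB that by simp
  have bound: "\<bar>r b x\<bar> \<le> (1/d0) * norm x" if b: "b \<in> B" for b x
  proof -
    define M where "M = Max ((\<lambda>b. \<bar>r b x\<bar>) ` B)"
    have le: "\<bar>r b' x\<bar> \<le> M" if "b' \<in> B" for b' unfolding M_def using fB that by simp
    have "M \<in> (\<lambda>b. \<bar>r b x\<bar>) ` B" unfolding M_def using fB b by (intro Max_in) auto
    then obtain b1 where b1: "b1 \<in> B" "M = \<bar>r b1 x\<bar>" by blast
    show ?thesis
    proof (cases "M = 0")
      case True then show ?thesis using le[OF b] d0 by simp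
    next
      case False
      then have M: "M > 0" using b1 by simp
      \<comment> \<open>Dividing by the largest coordinate moves the coefficients of
        \<open>x\<close> into \<open>F b1\<close>.\<close>
      define a where "a b = (if b \<in> B then r b x / M else 0)" for b
      have aF: "a \<in> F b1"
        unfolding F_def bx_def a_def using le M b1 by (auto simp: abs_le_iff divide_le_eq minus_le_iff le_divide_eq field_simps)
      have "P a = (1/M) *\<^sub>R x"
        unfolding P_def by (subst (2) x_eq) (auto simp: a_def scaleR_sum_right intro!: sum.cong)
      then have "norm (P a) = norm x / M" using M by simp
      moreover have "d0 \<le> norm (P a)" using d(2)[OF b1(1) aF] d0_le[OF b1(1)] by simp
      ultimately have "M * d0 \<le> norm x"
        using M mult_left_mono[of d0 "norm (P a)" M] by (simp add: field_simps)
      then have "M \<le> 1/d0 * norm x" using d0 by (simp add: field_simps)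
      then show ?thesis using le[OF b] by simp
    qed
  qed
  have "bounded_linear (r b)" if "b \<in> B" for b
    using lin[of b] bound[OF that]
    by (intro bounded_linear_intro[where K="1/d0"]) (auto simp: linear_add linear_scale mult.commute)
  then show ?thesis using fB x_eq[symmetric] bound d0 by (intro exI[of _ B] exI[of _ r] exI[of _ "1/d0"]) simp
qed

lemma finite_dim_linear_bounded:
  fixes T :: "'e::real_normed_vector \<Rightarrow> 'f::real_normed_vector"
  assumes fd: "\<exists>B::'e set. finite B \<and> span B = UNIV" and T: "linear T"
  shows "bounded_linear T"
proof -
  obtain B r K where B: "finite B" "K > 0" "\<forall>x::'e. (\<Sum>b\<in>B. r b x *\<^sub>R b) = x"
    "\<forall>b\<in>B. bounded_linear (r b)" "\<forall>b\<in>B. \<forall>x. \<bar>r b x\<bar> \<le> K * norm x"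
    using finite_dim_coordinates[OF fd] by (elim exE conjE) (rule that)
  have eq: "T x = (\<Sum>b\<in>B. r b x *\<^sub>R T b)" for x
    using arg_cong[OF B(3)[rule_format, of x], of T] by (simp add: linear_sum[OF T] linear_scale[OF T])
  show ?thesis
    by (subst ext[of T, OF eq])
      (intro bounded_linear_sum bounded_linear_scaleR_const B(4)[rule_format])
qed

text \<open>The ball is a closed subset of the image of a compact box of coefficients, because
  coordinates are bounded by \<open>K\<close> times the norm.\<close>

lemma finite_dim_cball_compact:
  fixes R :: real
  assumes fd: "\<exists>B::'e::real_normed_vector set. finite B \<and> span B = UNIV"
  shows "compact (cball (0::'e) R)"
proof -
  obtain B r K where B: "finite B" "K > 0" "\<forall>x::'e. (\<Sum>b\<in>B. r b x *\<^sub>R b) = x"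
    "\<forall>b\<in>B. bounded_linear (r b)" "\<forall>b\<in>B. \<forall>x. \<bar>r b x\<bar> \<le> K * norm x"
    using finite_dim_coordinates[OF fd] by (elim exE conjE) (rule that)
  define P where "P a = (\<Sum>b\<in>B. a b *\<^sub>R b)" for a :: "'e \<Rightarrow> real"
  define bx where "bx = Pi\<^sub>E UNIV (\<lambda>b. if b \<in> B then {-K*R..K*R} else {0})"
  have "compactin (product_topology (\<lambda>i. euclidean) UNIV) bx"
    unfolding bx_def by (subst compactin_PiE) auto
  then have cbx: "compact bx" by (simp add: euclidean_product_topology)
  have "continuous_on UNIV P"
    unfolding P_def by (intro continuous_intros continuous_on_product_coordinates)
  then have cP: "compact (P ` bx)"
    using cbx compact_continuous_image continuous_on_subset by blast
  have "cball 0 R \<subseteq> P ` bx"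
  proof
    fix x :: 'e assume "x \<in> cball 0 R"
    then have x: "norm x \<le> R" by simp
    define a where "a b = (if b \<in> B then r b x else 0)" for b
    have "\<bar>r b x\<bar> \<le> K * R" if "b \<in> B" for b
      using B(5)[rule_format, OF that, of x] mult_left_mono[OF x, of K] B(2) by linarith
    then have "a \<in> bx" unfolding bx_def a_def by (auto simp: abs_le_iff minus_le_iff)
    moreover have "x = P a" unfolding P_def a_def using B(3)[rule_format, of x] by simp
    ultimately show "x \<in> P ` bx" by blast
  qed
  then have "cball 0 R = P ` bx \<inter> cball 0 R" by blast
  then show ?thesis using compact_Int_closed[OF cP closed_cball] by metis
qed

section \<open>Second-order expansion of a local multiplication\<close>

text \<open>Turns smallness on finitely many pairs of basis vectors into an operator bound;
  continuity of second derivatives is known only for one pair of directions at a time.\<close>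

lemma bilinear_bound_on_coordinates:
  fixes Q :: "'e::real_normed_vector \<Rightarrow> 'f::real_normed_vector \<Rightarrow> 'g::real_normed_vector"
  assumes Q: "bilinear Q"
    and B: "finite B" "K \<ge> 0" "\<forall>x::'e. (\<Sum>b\<in>B. r b x *\<^sub>R b) = x"
      "\<forall>b\<in>B. \<forall>x. \<bar>r b x\<bar> \<le> K * norm x"
    and B': "finite B'" "K' \<ge> 0" "\<forall>x::'f. (\<Sum>b\<in>B'. r' b x *\<^sub>R b) = x"
      "\<forall>b\<in>B'. \<forall>x. \<bar>r' b x\<bar> \<le> K' * norm x"
    and e: "\<And>b c. b \<in> B \<Longrightarrow> c \<in> B' \<Longrightarrow> norm (Q b c) \<le> e"
  shows "norm (Q u v) \<le> real (card B) * K * (real (card B') * K') * e * norm u * norm v"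
proof -
  have "Q u v = Q (\<Sum>b\<in>B. r b u *\<^sub>R b) (\<Sum>c\<in>B'. r' c v *\<^sub>R c)" using B(3) B'(3) by simp
  also have "\<dots> = (\<Sum>(b,c)\<in>B \<times> B'. Q (r b u *\<^sub>R b) (r' c v *\<^sub>R c))"
    by (rule bilinear_sum[OF Q])
  also have "\<dots> = (\<Sum>(b,c)\<in>B \<times> B'. (r b u * r' c v) *\<^sub>R Q b c)"
    by (intro sum.cong) (auto simp: bilinear_lmul[OF Q] bilinear_rmul[OF Q])
  finally have "norm (Q u v) \<le> (\<Sum>(b,c)\<in>B \<times> B'. norm ((r b u * r' c v) *\<^sub>R Q b c))"
    by (metis (no_types, lifting) norm_sum sum.cong case_prod_unfold)
  also have "\<dots> \<le> (\<Sum>(b,c)\<in>B \<times> B'. (K * norm u) * (K' * norm v) * e)"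
  proof (intro sum_mono, clarsimp simp: abs_mult)
    fix b c assume bc: "b \<in> B" "c \<in> B'"
    then have "\<bar>r b u\<bar> \<le> K * norm u" "\<bar>r' c v\<bar> \<le> K' * norm v" "norm (Q b c) \<le> e"
      using B(4) B'(4) e by auto
    then show "\<bar>r b u\<bar> * \<bar>r' c v\<bar> * norm (Q b c) \<le> K * norm u * (K' * norm v) * e"
      using B(2) B'(2) by (intro mult_mono) auto
  qed
  also have "\<dots> = real (card B) * K * (real (card B') * K') * e * norm u * norm v"
    by (simp add: card_cartesian_product)
  finally show ?thesis .
qed

text \<open>\<open>\<beta>\<close> is the mixed second derivative at the origin. Since
  \<open>m\<close> is the identity on both axes, pure second derivatives contribute nothing and the
  error is small against \<open>norm x * norm y\<close>, not merely against the sum of squares. This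
  takes two mean value estimates: one in \<open>x\<close> for the derivative in the second variable,
  and one in \<open>y\<close> for \<open>m\<close> itself.\<close>

lemma second_order_expansion:
  fixes m :: "'e::real_normed_vector \<times> 'e \<Rightarrow> 'e"
  assumes fd: "\<exists>B::'e set. finite B \<and> span B = UNIV"
    and S: "open S" "(0, 0) \<in> S" and C2: "Ck_on (Suc (Suc 0)) S m"
    and m0: "\<And>x. (x, 0) \<in> S \<Longrightarrow> m (x, 0) = x" "\<And>y. (0, y) \<in> S \<Longrightarrow> m (0, y) = y"
  shows "\<exists>\<beta>. bounded_bilinear \<beta> \<and> (\<forall>\<epsilon>>0. \<exists>\<delta>>0. \<forall>x y. norm x < \<delta> \<longrightarrow> norm y < \<delta> \<longrightarrow>
    (x, y) \<in> S \<and> norm (m (x, y) - x - y - \<beta> x y) \<le> \<epsilon> * norm x * norm y)"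
proof -
  obtain B r K where B: "finite B" "K > 0" "\<forall>x::'e. (\<Sum>b\<in>B. r b x *\<^sub>R b) = x"
    "\<forall>b\<in>B. bounded_linear (r b)" "\<forall>b\<in>B. \<forall>x. \<bar>r b x\<bar> \<le> K * norm x"
    using finite_dim_coordinates[OF fd] by (elim exE conjE) (rule that)
  define h where "h v p = frechet_derivative m (at p) (0, v)" for v p
  define H where "H p u v = frechet_derivative (h v) (at p) (u, 0)" for p u v
  have dm: "(m has_derivative frechet_derivative m (at p)) (at p)" if "p \<in> S" for p
    using C2 that by (simp add: frechet_derivative_works)
  have dh: "(h v has_derivative frechet_derivative (h v) (at p)) (at p)" if "p \<in> S" for p v
    using C2 that unfolding h_def by (simp add: frechet_derivative_works)
  have cH: "continuous_on S (\<lambda>p. H p u v)" for u v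
    using C2 unfolding H_def h_def by simp
  note lin = has_derivative_linear[OF dm] has_derivative_linear[OF dh]
  have h_add: "h (v + v') p = h v p + h v' p" if "p \<in> S" for v v' p
    unfolding h_def using linear_add[OF lin(1)[OF that], of "(0,v)" "(0,v')"] by simp
  have h_scale: "h (c *\<^sub>R v) p = c *\<^sub>R h v p" if "p \<in> S" for v c p
    unfolding h_def using linear_scale[OF lin(1)[OF that], of c "(0,v)"] by simp
  have H_add: "H p u (v + v') = H p u v + H p u v'" if "p \<in> S" for u v v' p
  proof -
    have "((\<lambda>q. h v q + h v' q) has_derivative
        (\<lambda>w. frechet_derivative (h v) (at p) w + frechet_derivative (h v') (at p) w)) (at p)"
      by (intro has_derivative_add dh that)
    then have "(h (v + v') has_derivative
        (\<lambda>w. frechet_derivative (h v) (at p) w + frechet_derivative (h v') (at p) w)) (at p)"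
      by (rule has_derivative_transform_within_open[OF _ S(1) that]) (simp add: h_add)
    from has_derivative_unique[OF dh[OF that] this] show ?thesis unfolding H_def by metis
  qed
  have H_scale: "H p u (c *\<^sub>R v) = c *\<^sub>R H p u v" if "p \<in> S" for u v c p
  proof -
    have "((\<lambda>q. c *\<^sub>R h v q) has_derivative
        (\<lambda>w. c *\<^sub>R frechet_derivative (h v) (at p) w)) (at p)"
      by (intro has_derivative_scaleR_right dh that)
    then have "(h (c *\<^sub>R v) has_derivative (\<lambda>w. c *\<^sub>R frechet_derivative (h v) (at p) w)) (at p)"
      by (rule has_derivative_transform_within_open[OF _ S(1) that]) (simp add: h_scale)
    from has_derivative_unique[OF dh[OF that] this] show ?thesis unfolding H_def by metis
  qed
  have bilH: "bilinear (H p)" if "p \<in> S" for p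
    unfolding bilinear_def
  proof (intro conjI allI)
    show "linear (H p x)" for x
      by (rule linearI) (simp_all add: H_add H_scale that)
    show "linear (\<lambda>x. H p x y)" for y
    proof (rule linearI)
      show "H p (a + b) y = H p a y + H p b y" for a b
        unfolding H_def using linear_add[OF lin(2)[OF that], of y "(a,0)" "(b,0)"] by simp
      show "H p (c *\<^sub>R a) y = c *\<^sub>R H p a y" for a c
        unfolding H_def using linear_scale[OF lin(2)[OF that], of y c "(a,0)"] by simp
    qed
  qed
  define \<beta> where "\<beta> = H (0, 0)"
  have bil: "bilinear \<beta>" unfolding \<beta>_def using bilH S(2) .
  define N where "N = real (card B) * K * (real (card B) * K)"
  have N: "N \<ge> 0" unfolding N_def using B(2) by simp
  have K0: "K \<ge> 0" using B(2) by simp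
  note bb = bilinear_bound_on_coordinates[OF _ B(1) K0 B(3,5) B(1) K0 B(3,5), folded N_def]
  have bbil: "bounded_bilinear \<beta>"
  proof
    define M where "M = Max (insert 0 ((\<lambda>(b,c). norm (\<beta> b c)) ` (B \<times> B)))"
    have "norm (\<beta> b c) \<le> M" if "b \<in> B" "c \<in> B" for b c
      unfolding M_def using B(1) that by (intro Max_ge) auto
    from bb[OF bil this] have "norm (\<beta> a b) \<le> norm a * norm b * (N * M)" for a b
      by (simp add: mult_ac)
    then show "\<exists>K. \<forall>a b. norm (\<beta> a b) \<le> norm a * norm b * K" by blast
  qed (use bil in \<open>auto simp: bilinear_ladd bilinear_radd bilinear_lmul bilinear_rmul\<close>)
  \<comment> \<open>Differentiating \<open>m (0, z) = z\<close> gives the starting value on the axis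
    for the mean value estimate in \<open>x\<close>.\<close>
  have hy: "h v (0, y) = v" if "(0, y) \<in> S" for v y
  proof -
    have "(m has_derivative frechet_derivative m (at (0, y))) (at (0, y))" by (rule dm[OF that])
    moreover have "((\<lambda>z. (0::'e, z)) has_derivative (\<lambda>v. (0, v))) (at y)"
      by (auto intro!: derivative_eq_intros)
    ultimately have "((\<lambda>z. m (0, z)) has_derivative (\<lambda>v. frechet_derivative m (at (0, y)) (0, v))) (at y)"
      using has_derivative_compose[of "\<lambda>z. (0::'e, z)" "\<lambda>v. (0,v)" y UNIV m] by simp
    moreover have "((\<lambda>z. m (0, z)) has_derivative (\<lambda>v. v)) (at y)"
    proof (rule has_derivative_transform_within_open[of "\<lambda>z. z"])
      show "open ((\<lambda>z. (0::'e, z)) -` S)"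
        using S(1) by (intro open_vimage continuous_intros)
    qed (use that m0(2) in auto)
    ultimately show ?thesis unfolding h_def using has_derivative_unique by metis
  qed
  have "\<exists>\<delta>>0. \<forall>x y. norm x < \<delta> \<longrightarrow> norm y < \<delta> \<longrightarrow>
      (x, y) \<in> S \<and> norm (m (x, y) - x - y - \<beta> x y) \<le> \<epsilon> * norm x * norm y" if e: "\<epsilon> > 0" for \<epsilon>
  proof -
    \<comment> \<open>Passing from basis pairs to arbitrary vectors costs the factor
      \<open>N\<close>; adding 1 keeps the denominator positive.\<close>
    define e1 where "e1 = \<epsilon> / (N + 1)"
    have e1: "e1 > 0" "N * e1 \<le> \<epsilon>" unfolding e1_def using N e by (auto simp: field_simps)
    have "\<forall>\<^sub>F p in at (0,0). p \<in> S \<and> (\<forall>(b,c)\<in>B\<times>B. norm (H p b c - \<beta> b c) < e1)"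
    proof (intro eventually_conj)
      show "\<forall>\<^sub>F p in at (0,0). p \<in> S" using S by (rule eventually_at_in_open')
      show "\<forall>\<^sub>F p in at (0, 0). \<forall>(b,c)\<in>B\<times>B. norm (H p b c - \<beta> b c) < e1"
        using B(1)
      proof (intro eventually_ball_finite ballI, simp, clarify)
        fix b c
        have "isCont (\<lambda>p. H p b c) (0,0)" using cH S continuous_on_eq_continuous_at by blast
        then have "((\<lambda>p. H p b c) \<longlongrightarrow> \<beta> b c) (at (0,0))" unfolding \<beta>_def isCont_def .
        then show "\<forall>\<^sub>F p in at (0, 0). norm (H p b c - \<beta> b c) < e1"
          using e1(1) by (simp add: tendsto_iff dist_norm)
      qed
    qed
    then obtain d where d: "d > 0"
      "\<And>p. p \<noteq> (0,0) \<Longrightarrow> dist p (0,0) < d \<Longrightarrow> p \<in> S \<and> (\<forall>b\<in>B. \<forall>c\<in>B. norm (H p b c - \<beta> b c) < e1)"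
      unfolding eventually_at by auto
    have dS: "p \<in> S" "\<And>b c. b \<in> B \<Longrightarrow> c \<in> B \<Longrightarrow> norm (H p b c - \<beta> b c) \<le> e1"
      if "dist p (0,0) < d" for p
      using d(2)[OF _ that] S(2) e1(1) by (cases "p = (0,0)"; force simp: \<beta>_def less_imp_le)+
    \<comment> \<open>The norm of a pair is at most the sum of the two norms.\<close>
    define \<delta> where "\<delta> = d / 2"
    have \<delta>: "\<delta> > 0" unfolding \<delta>_def using d by simp
    have dist: "dist (x, y) (0, 0) < d" if "norm x < \<delta>" "norm y < \<delta>" for x y :: 'e
    proof -
      have "dist (x, y) (0, 0) \<le> norm x + norm y"
        by (simp add: dist_norm norm_Pair sqrt_sum_squares_le_sum)
      then show ?thesis using that unfolding \<delta>_def by simp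
    qed
    have Hb: "norm (H (x,y) u v - \<beta> u v) \<le> \<epsilon> * norm u * norm v"
      if "norm x < \<delta>" "norm y < \<delta>" for x y u v
    proof -
      have "bilinear (\<lambda>u v. H (x,y) u v - \<beta> u v)"
        using bilH[OF dS(1)[OF dist[OF that]]] bil unfolding bilinear_def
        by (auto intro!: linear_compose_sub)
      from bb[OF this dS(2)[OF dist[OF that]], of u v]
      have "norm (H (x,y) u v - \<beta> u v) \<le> N * e1 * norm u * norm v" .
      also have "\<dots> \<le> \<epsilon> * norm u * norm v" using e1(2) by (intro mult_right_mono) auto
      finally show ?thesis .
    qed
    have step1: "norm (h v (x,y) - v - \<beta> x v) \<le> \<epsilon> * norm v * norm x"
      if "norm x < \<delta>" "norm y < \<delta>" for x y v
    proof -
      have der: "((\<lambda>x. h v (x,y) - \<beta> x v) has_derivative (\<lambda>u. H (z,y) u v - \<beta> u v)) (at z within ball 0 \<delta>)"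
        if z: "z \<in> ball 0 \<delta>" for z
      proof -
        have zS: "(z,y) \<in> S" using z \<open>norm y < \<delta>\<close> by (intro dS(1) dist) auto
        have "((\<lambda>x. (x, y)) has_derivative (\<lambda>u. (u, 0))) (at z)"
          by (auto intro!: derivative_eq_intros)
        from has_derivative_compose[OF this, of "h v", OF dh[OF zS]]
        have 1: "((\<lambda>x. h v (x,y)) has_derivative (\<lambda>u. H (z,y) u v)) (at z)" unfolding H_def .
        have 2: "((\<lambda>x. \<beta> x v) has_derivative (\<lambda>u. \<beta> u v)) (at z)"
          using bounded_bilinear.bounded_linear_left[OF bbil] bounded_linear_imp_has_derivative by blast
        show ?thesis using has_derivative_diff[OF 1 2] has_derivative_at_withinI by blast
      qed
      have "norm ((h v (x,y) - \<beta> x v) - (h v (0,y) - \<beta> 0 v)) \<le> \<epsilon> * norm v * norm (x - 0)"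
      proof (rule differentiable_bound[OF convex_ball der])
        show "onorm (\<lambda>u. H (z, y) u v - \<beta> u v) \<le> \<epsilon> * norm v" if "z \<in> ball 0 \<delta>" for z
          using Hb[of z y _ v] that \<open>norm y < \<delta>\<close> e by (intro onorm_bound) (auto simp: mult_ac)
      qed (use that \<delta> in auto)
      moreover have "h v (0,y) = v" using hy dS(1) dist that(2) \<delta> by simp
      ultimately show ?thesis
        using bilinear_lzero[OF bil, of v] by (simp add: algebra_simps)
    qed
    have "(x, y) \<in> S \<and> norm (m (x, y) - x - y - \<beta> x y) \<le> \<epsilon> * norm x * norm y"
      if xy: "norm x < \<delta>" "norm y < \<delta>" for x y
    proof
      show "(x,y) \<in> S" using dS(1) dist xy by blast
      have der: "((\<lambda>y. m (x,y) - y - \<beta> x y) has_derivative (\<lambda>v. h v (x,z) - v - \<beta> x v)) (at z within ball 0 \<delta>)"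
        if z: "z \<in> ball 0 \<delta>" for z
      proof -
        have zS: "(x,z) \<in> S" using z xy by (intro dS(1) dist) auto
        have "((\<lambda>y. (x, y)) has_derivative (\<lambda>v. (0, v))) (at z)"
          by (auto intro!: derivative_eq_intros)
        from has_derivative_compose[OF this, of m, OF dm[OF zS]]
        have 1: "((\<lambda>y. m (x,y)) has_derivative (\<lambda>v. h v (x,z))) (at z)" unfolding h_def .
        have 2: "(\<beta> x has_derivative \<beta> x) (at z)"
          using bounded_bilinear.bounded_linear_right[OF bbil] bounded_linear_imp_has_derivative by blast
        show ?thesis
          using has_derivative_diff[OF has_derivative_diff[OF 1 has_derivative_ident] 2]
            has_derivative_at_withinI by blast
      qed
      have "norm ((m (x,y) - y - \<beta> x y) - (m (x,0) - 0 - \<beta> x 0)) \<le> \<epsilon> * norm x * norm (y - 0)"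
      proof (rule differentiable_bound[OF convex_ball der])
        show "onorm (\<lambda>v. h v (x, z) - v - \<beta> x v) \<le> \<epsilon> * norm x" if "z \<in> ball 0 \<delta>" for z
          using step1[of x z] that xy e by (intro onorm_bound) (auto simp: mult_ac)
      qed (use xy \<delta> in auto)
      moreover have "m (x,0) = x" using m0(1) dS(1) dist xy \<delta> by simp
      ultimately show "norm (m (x, y) - x - y - \<beta> x y) \<le> \<epsilon> * norm x * norm y"
        using bilinear_rzero[OF bil, of x] by (simp add: algebra_simps)
    qed
    with \<delta> show ?thesis by blast
  qed
  with bbil show ?thesis by blast
qed

section \<open>Powers and spectrum of an endomorphism\<close>

lemma cscale_simps:
  "cscale z (w + w') = cscale z w + cscale z w'" "cscale (z + z') w = cscale z w + cscale z' w"
  "cscale z (cscale z' w) = cscale (z * z') w" "cscale 1 w = w"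
  by (auto simp: cscale_def case_prod_beta algebra_simps scaleR_add_left
      plus_prod_def intro!: prod_eqI)

interpretation cplx: vector_space "cscale :: complex \<Rightarrow> 'e::real_vector \<times> 'e \<Rightarrow> 'e \<times> 'e"
  by unfold_locales (simp_all add: cscale_simps)

lemma cscale_of_real: "cscale (of_real r) w = r *\<^sub>R w"
  by (simp add: cscale_def case_prod_beta scaleR_prod_def)

text \<open>For a general norm on \<open>'e\<close> the product norm need not be
  complex-homogeneous, so scalars are controlled only up to the factor 2.\<close>

lemma norm_cscale_le: "norm (cscale z w) \<le> 2 * cmod z * norm w" for w :: "'e::real_normed_vector \<times> 'e"
proof -
  have "cscale z w = Re z *\<^sub>R w + Im z *\<^sub>R (- snd w, fst w)"
    by (simp add: cscale_def case_prod_beta prod_eq_iff)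
  then have "norm (cscale z w) \<le> \<bar>Re z\<bar> * norm w + \<bar>Im z\<bar> * norm (- snd w, fst w)"
    by (metis norm_triangle_ineq norm_scaleR)
  also have "norm (- snd w, fst w) = norm w"
    by (simp add: norm_Pair norm_prod_def add.commute)
  finally have "norm (cscale z w) \<le> \<bar>Re z\<bar> * norm w + \<bar>Im z\<bar> * norm w" .
  moreover have "\<bar>Re z\<bar> * norm w \<le> cmod z * norm w" "\<bar>Im z\<bar> * norm w \<le> cmod z * norm w"
    by (intro mult_right_mono abs_Re_le_cmod abs_Im_le_cmod norm_ge_zero)+
  ultimately show ?thesis by linarith
qed

lemma norm_cscale_ge: "norm (cscale z w) \<ge> cmod z * norm w / 2" for w :: "'e::real_normed_vector \<times> 'e"
proof (cases "z = 0")
  case False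
  have "norm w = norm (cscale (inverse z) (cscale z w))" using False by simp
  also have "\<dots> \<le> 2 * cmod (inverse z) * norm (cscale z w)" by (rule norm_cscale_le)
  finally have "norm w \<le> 2 * norm (cscale z w) / cmod z"
    by (simp add: norm_inverse divide_inverse mult_ac)
  then show ?thesis using False by (simp add: field_simps)
qed simp

lemma perturbed_contraction_tendsto_0:
  fixes c d :: "nat \<Rightarrow> complex"
  assumes rec: "\<And>n. c (Suc n) = l * c n + d n" and l: "cmod l < 1" and d: "d \<longlonglongrightarrow> 0"
  shows "c \<longlonglongrightarrow> 0"
proof (rule LIMSEQ_I)
  fix e :: real assume e: "e > 0"
  \<comment> \<open>Chosen so that \<open>e / 2\<close> is the fixed point of
    \<open>t \<mapsto> cmod l * t + e1\<close>.\<close>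
  define e1 where "e1 = e / 2 * (1 - cmod l)"
  have e1: "e1 > 0" unfolding e1_def using e l by simp
  obtain n0 where n0: "\<forall>n\<ge>n0. norm (d n) < e1" using LIMSEQ_D[OF d e1] by auto
  have b: "cmod (c (n0 + k)) \<le> cmod l ^ k * cmod (c n0) + e / 2" for k
  proof (induction k)
    case (Suc k)
    have "cmod (c (n0 + Suc k)) \<le> cmod l * cmod (c (n0 + k)) + cmod (d (n0 + k))"
      using norm_triangle_ineq[of "l * c (n0+k)" "d (n0+k)"] by (simp add: rec norm_mult)
    also have "\<dots> \<le> cmod l * (cmod l ^ k * cmod (c n0) + e / 2) + e1"
      using Suc n0 by (intro add_mono mult_left_mono) (auto simp: less_imp_le)
    also have "\<dots> = cmod l ^ Suc k * cmod (c n0) + e / 2" unfolding e1_def by (simp add: field_simps)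
    finally show ?case .
  qed (use e in simp)
  have "(\<lambda>k. cmod l ^ k * cmod (c n0)) \<longlonglongrightarrow> 0"
    using l by (intro tendsto_mult_left_zero LIMSEQ_power_zero) simp
  then obtain k0 where k0: "\<forall>k\<ge>k0. cmod l ^ k * cmod (c n0) < e / 2"
    using LIMSEQ_D[of _ 0 "e/2"] e by fastforce
  show "\<exists>no. \<forall>n\<ge>no. norm (c n - 0) < e"
  proof (intro exI allI impI)
    fix n assume "n \<ge> n0 + k0"
    then obtain k where "n = n0 + k" "k \<ge> k0" by (metis add_le_imp_le_left le_Suc_ex add.assoc le_add1)
    then show "norm (c n - 0) < e" using b[of k] k0 by fastforce
  qed
qed

text \<open>Linear algebra on the complexification \<open>u + \<i>v\<close> is done through an annihilating product of
  factors \<open>shift T l\<close>, i.e. \<open>T - l\<close>, which replaces the Jordan decomposition.\<close>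

definition shift :: "('e::real_vector \<Rightarrow> 'e) \<Rightarrow> complex \<Rightarrow> 'e \<times> 'e \<Rightarrow> 'e \<times> 'e" where
  "shift T l w = map_prod T T w - cscale l w"

locale endo =
  fixes T :: "'e::real_normed_vector \<Rightarrow> 'e"
  assumes fd: "\<exists>B::'e set. finite B \<and> span B = UNIV" and T: "linear T"
begin

abbreviation "TC \<equiv> map_prod T T"
abbreviation "decays w \<equiv> (\<lambda>n. (TC ^^ n) w) \<longlonglongrightarrow> 0"

lemma TC_add: "TC (w + w') = TC w + TC w'"
  using linear_add[OF T] by (simp add: prod_eq_iff)
lemma TC_cscale: "TC (cscale z w) = cscale z (TC w)"
  using linear_add[OF T] linear_diff[OF T] linear_scale[OF T]
  by (simp add: cscale_def case_prod_beta)
lemma TC_zero: "TC 0 = 0"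
  using linear_0[OF T] by (simp add: zero_prod_def)
lemma TC_diff: "TC (w - w') = TC w - TC w'"
  using linear_diff[OF T] by (simp add: prod_eq_iff)

lemma TCn_diff: "(TC ^^ n) (w - w') = (TC ^^ n) w - (TC ^^ n) w'"
  by (induction n) (simp_all add: TC_diff)
lemma TCn_cscale: "(TC ^^ n) (cscale z w) = cscale z ((TC ^^ n) w)"
  by (induction n) (simp_all add: TC_cscale)

lemma TCn_Pair: "(TC ^^ n) (u, v) = ((T ^^ n) u, (T ^^ n) v)"
  by (induction n) simp_all

lemma decays_Pair: "decays (u, v) \<longleftrightarrow> (\<lambda>n. (T ^^ n) u) \<longlonglongrightarrow> 0 \<and> (\<lambda>n. (T ^^ n) v) \<longlonglongrightarrow> 0"
proof
  assume "decays (u, v)"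
  then show "(\<lambda>n. (T ^^ n) u) \<longlonglongrightarrow> 0 \<and> (\<lambda>n. (T ^^ n) v) \<longlonglongrightarrow> 0"
    using tendsto_fst[of _ 0] tendsto_snd[of _ 0] by (fastforce simp: TCn_Pair)
next
  assume "(\<lambda>n. (T ^^ n) u) \<longlonglongrightarrow> 0 \<and> (\<lambda>n. (T ^^ n) v) \<longlonglongrightarrow> 0"
  then show "decays (u, v)"
    unfolding TCn_Pair zero_prod_def by (intro tendsto_Pair) auto
qed

lemma shift_add: "shift T l (w + w') = shift T l w + shift T l w'"
  by (simp add: shift_def TC_add cplx.scale_right_distrib)
lemma shift_cscale: "shift T l (cscale z w) = cscale z (shift T l w)"
  by (simp add: shift_def TC_cscale cplx.scale_right_diff_distrib mult.commute)
lemma shift_zero: "shift T l 0 = 0"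
  by (simp add: shift_def TC_zero)
lemma shift_commute: "shift T l (shift T k w) = shift T k (shift T l w)"
  by (simp add: shift_def TC_diff TC_cscale cplx.scale_right_diff_distrib mult.commute)

section \<open>Annihilating products of linear factors\<close>

lemma fold_shift_add: "fold (shift T) ls (w + w') = fold (shift T) ls w + fold (shift T) ls w'"
  by (induction ls arbitrary: w w') (simp_all add: shift_add)
lemma fold_shift_cscale: "fold (shift T) ls (cscale z w) = cscale z (fold (shift T) ls w)"
  by (induction ls arbitrary: w) (simp_all add: shift_cscale)
lemma fold_shift_zero: "fold (shift T) ls 0 = 0"
  by (induction ls) (simp_all add: shift_zero)
lemma fold_shift_commute: "fold (shift T) ls (shift T l w) = shift T l (fold (shift T) ls w)"
  by (induction ls arbitrary: w) (simp_all add: shift_commute[of _ l])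

text \<open>A root \<open>l\<close> of \<open>p\<close> splits off one factor: if p = (X - l) q,
  then p(TC) w = q(TC) (shift T l w), and the induction continues with \<open>q\<close> and the
  shifted vector.\<close>

lemma poly_kernel_shifts:
  assumes "p \<noteq> 0" "degree p \<le> n" "(\<Sum>i\<le>n. cscale (coeff p i) ((TC ^^ i) w)) = 0"
  shows "\<exists>ls. fold (shift T) ls w = 0"
  using assms
proof (induction n arbitrary: p w)
  case 0
  then have "p = [:coeff p 0:]" using degree_0_id[of p] by simp
  then have "coeff p 0 \<noteq> 0" using 0(1) by (metis pCons_0_0)
  then have "w = 0" using 0(3) by simp
  then show ?case by (intro exI[of _ "[]"]) simp
next
  case (Suc n)
  show ?case
  proof (cases "degree p = 0")
    case True
    then have "coeff p i = 0" if "i > 0" for i using that by (simp add: coeff_eq_0)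
    then have "(\<Sum>i\<le>n. cscale (coeff p i) ((TC ^^ i) w)) = 0"
      using Suc(4) by simp
    then show ?thesis using Suc(1)[OF Suc(2)] True by simp
  next
    case False
    then obtain l where "poly p l = 0" using alg_closed_imp_poly_has_root by blast
    then obtain q where q: "p = [:-l, 1:] * q" by (metis poly_eq_0_iff_dvd dvd_def)
    have q0: "q \<noteq> 0" using Suc(2) q by auto
    have dq: "degree q \<le> n"
      using Suc(3) q0 unfolding q by (subst (asm) degree_mult_eq) auto
    have p: "p = smult (- l) q + pCons 0 q" unfolding q by simp
    have cq: "coeff q (Suc n) = 0" using dq by (simp add: coeff_eq_0)
    have "0 = (\<Sum>i\<le>Suc n. cscale (coeff p i) ((TC ^^ i) w))" using Suc(4) by simp
    also have "\<dots> = (\<Sum>i\<le>Suc n. cscale (- l * coeff q i) ((TC ^^ i) w)) +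
        (\<Sum>i\<le>Suc n. cscale (coeff (pCons 0 q) i) ((TC ^^ i) w))"
      unfolding p by (simp only: coeff_add coeff_smult cplx.scale_left_distrib sum.distrib)
    also have "(\<Sum>i\<le>Suc n. cscale (- l * coeff q i) ((TC ^^ i) w)) =
        (\<Sum>i\<le>n. cscale (- l * coeff q i) ((TC ^^ i) w))"
      using cq by simp
    also have "(\<Sum>i\<le>Suc n. cscale (coeff (pCons 0 q) i) ((TC ^^ i) w)) =
        (\<Sum>i\<le>n. cscale (coeff q i) ((TC ^^ Suc i) w))"
      by (subst sum.atMost_Suc_shift) simp
    also have "(\<Sum>i\<le>n. cscale (- l * coeff q i) ((TC ^^ i) w)) +
        (\<Sum>i\<le>n. cscale (coeff q i) ((TC ^^ Suc i) w)) =
        (\<Sum>i\<le>n. cscale (coeff q i) ((TC ^^ i) (shift T l w)))"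
      unfolding shift_def sum.distrib[symmetric]
      by (intro sum.cong) (simp_all add: TCn_diff TCn_cscale funpow_swap1 mult.commute
          cplx.scale_right_diff_distrib)
    finally have "(\<Sum>i\<le>n. cscale (coeff q i) ((TC ^^ i) (shift T l w))) = 0" by simp
    then obtain ls where "fold (shift T) ls (shift T l w) = 0"
      using Suc(1)[OF q0 dq] by blast
    then show ?thesis by (intro exI[of _ "l # ls"]) simp
  qed
qed

text \<open>With a complex spanning set of \<open>n\<close> elements, the \<open>n + 1\<close>
  vectors w, TC w, ..., TC^n w are dependent, and a relation between them is a polynomial in
  \<open>TC\<close> that kills \<open>w\<close>.\<close>

lemma vector_annihilated: "\<exists>ls. fold (shift T) ls w = 0"
proof -
  obtain B :: "'e set" where B: "finite B" "span B = UNIV" using fd by blast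
  define B' where "B' = (\<lambda>b. (b, 0::'e)) ` B"
  have real: "(u, 0) \<in> cplx.span B'" for u
  proof -
    have "u \<in> span B" using B by simp
    then show ?thesis
    proof (induction rule: span_induct_alt)
      case base then show ?case using cplx.span_zero by (simp add: zero_prod_def)
    next
      case (step c x y)
      have "cscale (of_real c) (x, 0) + (y, 0) \<in> cplx.span B'"
        using step cplx.span_base[of "(x, 0)" B'] by (intro cplx.span_add cplx.span_scale) (auto simp: B'_def)
      then show ?case by (simp add: cscale_of_real)
    qed
  qed
  have sp: "cplx.span B' = UNIV"
  proof -
    have "(u, v) \<in> cplx.span B'" for u v
    proof -
      have "(u, 0) + cscale \<i> (v, 0) \<in> cplx.span B'"
        by (intro cplx.span_add cplx.span_scale real)
      then show ?thesis by (simp add: cscale_def)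
    qed
    then show ?thesis by auto
  qed
  have fB': "finite B'" using B unfolding B'_def by simp
  define n where "n = card B'"
  define a where "a i = (TC ^^ i) w" for i
  show ?thesis
  proof (cases "inj_on a {..n}")
    \<comment> \<open>Linear dependence of a set does not see repetitions, so coinciding powers are
      treated apart: they give the relation X^j - X^i.\<close>
    case False
    then obtain i j where ij: "i < j" "j \<le> n" "a i = a j"
      unfolding inj_on_def by (metis atMost_iff linorder_neqE_nat)
    define p :: "complex poly" where "p = monom 1 j - monom 1 i"
    have "coeff p j = 1" using ij by (simp add: p_def)
    then have "p \<noteq> 0" by auto
    moreover have "degree p \<le> n" unfolding p_def using ij
      by (intro degree_diff_le) (auto simp: degree_monom_eq)
    moreover have "(\<Sum>k\<le>n. cscale (coeff p k) ((TC ^^ k) w)) = 0"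
    proof -
      have "(\<Sum>k\<le>n. cscale (coeff p k) ((TC ^^ k) w)) =
          (\<Sum>k\<le>n. (if k = j then a k else 0) - (if k = i then a k else 0))"
        unfolding p_def by (intro sum.cong) (auto simp: cplx.scale_left_diff_distrib a_def)
      then show ?thesis using ij by (simp add: sum_subtractf)
    qed
    ultimately show ?thesis by (rule poly_kernel_shifts)
  next
    case True
    then have c: "card (a ` {..n}) = Suc n" by (simp add: card_image)
    then have "cplx.dependent (a ` {..n})"
      using cplx.independent_span_bound[OF fB', of "a ` {..n}"] sp n_def by auto
    then obtain u where u: "\<exists>v\<in>a ` {..n}. u v \<noteq> 0" "(\<Sum>v\<in>a ` {..n}. cscale (u v) v) = 0"
      by (subst (asm) cplx.dependent_finite) auto
    define p where "p = (\<Sum>i\<le>n. monom (u (a i)) i)"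
    have cp: "coeff p i = (if i \<le> n then u (a i) else 0)" for i
      unfolding p_def by (simp add: coeff_sum)
    have "p \<noteq> 0" using u(1) cp by (metis atMost_iff coeff_0 imageE)
    moreover have "degree p \<le> n" using cp by (intro degree_le) simp
    moreover have "(\<Sum>i\<le>n. cscale (coeff p i) ((TC ^^ i) w)) = 0"
      using u(2) sum.reindex[OF True, of "\<lambda>v. cscale (u v) v"] by (simp add: cp a_def)
    ultimately show ?thesis by (rule poly_kernel_shifts)
  qed
qed

text \<open>Takes the place of the Cayley-Hamilton theorem. Lists for finitely many vectors are
  chained, each new one being chosen for the image of its vector under the product so far; complex
  linearity extends this from a spanning set to all vectors.\<close>

lemma annihilating_list: "\<exists>ls. \<forall>w. fold (shift T) ls w = 0"
proof -
  have fin: "\<exists>ls. \<forall>w\<in>W. fold (shift T) ls w = 0" if "finite W" for W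
    using that
  proof (induction W)
    case (insert w W)
    then obtain ls where ls: "\<forall>w\<in>W. fold (shift T) ls w = 0" by blast
    obtain ks where ks: "fold (shift T) ks (fold (shift T) ls w) = 0" using vector_annihilated by blast
    show ?case by (rule exI[of _ "ls @ ks"]) (use ls ks in \<open>auto simp: fold_shift_zero\<close>)
  qed simp
  obtain B :: "'e set" where B: "finite B" "span B = UNIV" using fd by blast
  then obtain ls where ls: "\<forall>b\<in>B. fold (shift T) ls (b, 0) = 0"
    using fin[of "(\<lambda>b. (b, 0)) ` B"] by auto
  have real: "fold (shift T) ls (u, 0) = 0" for u
  proof -
    have "u \<in> span B" using B by simp
    then show ?thesis
    proof (induction rule: span_induct_alt)
      case base then show ?case using fold_shift_zero by (simp add: zero_prod_def)
    next
      case (step c x y)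
      have "fold (shift T) ls (cscale (of_real c) (x, 0) + (y, 0)) = 0"
        unfolding fold_shift_add fold_shift_cscale using step ls by simp
      then show ?case by (simp add: cscale_of_real)
    qed
  qed
  have "fold (shift T) ls (u, v) = 0" for u v
  proof -
    have "fold (shift T) ls ((u, 0) + cscale \<i> (v, 0)) = 0"
      unfolding fold_shift_add fold_shift_cscale using real by simp
    then show ?thesis by (simp add: cscale_def)
  qed
  then show ?thesis by auto
qed

section \<open>Decay of iterates and the spectral radius\<close>

lemma decays_shift:
  assumes "decays (shift T l w)" "cmod l < 1"
  shows "decays w"
proof -
  obtain B r K where B: "finite B" "K > 0" "\<forall>x::'e. (\<Sum>b\<in>B. r b x *\<^sub>R b) = x"
    "\<forall>b\<in>B. bounded_linear (r b)" "\<forall>b\<in>B. \<forall>x. \<bar>r b x\<bar> \<le> K * norm x"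
    using finite_dim_coordinates[OF fd] by (elim exE conjE) (rule that)
  define F where "F b w = Complex (r b (fst w)) (r b (snd w))" for b w
  have F0: "(\<lambda>n. F b (v n)) \<longlonglongrightarrow> 0" if "v \<longlonglongrightarrow> 0" "b \<in> B" for v :: "nat \<Rightarrow> 'e \<times> 'e" and b
  proof -
    have bl: "bounded_linear (r b)" using B(4) that by blast
    have "(\<lambda>n. r b (fst (v n))) \<longlonglongrightarrow> r b (fst 0)" "(\<lambda>n. r b (snd (v n))) \<longlonglongrightarrow> r b (snd 0)"
      using bounded_linear.tendsto[OF bl tendsto_fst[OF that(1)]]
        bounded_linear.tendsto[OF bl tendsto_snd[OF that(1)]] by auto
    then show ?thesis
      unfolding F_def using tendsto_Complex[of _ 0 sequentially _ 0] linear_simps(3)[OF bl]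
      by (simp add: zero_complex.code)
  qed
  \<comment> \<open>As \<open>TC\<close> is the sum of multiplication by \<open>l\<close> and
    \<open>shift T l\<close>, each complex coordinate of the iterates obeys a recursion with ratio
    \<open>l\<close> and a perturbation tending to 0.\<close>
  have rec: "(TC ^^ Suc n) w = cscale l ((TC ^^ n) w) + (TC ^^ n) (shift T l w)" for n
    by (simp add: shift_def TCn_diff TCn_cscale funpow_swap1)
  have Fc: "(\<lambda>n. F b ((TC ^^ n) w)) \<longlonglongrightarrow> 0" if b: "b \<in> B" for b
  proof (rule perturbed_contraction_tendsto_0)
    have bl: "bounded_linear (r b)" using B(4) that by blast
    show "F b ((TC ^^ Suc n) w) = l * F b ((TC ^^ n) w) + F b ((TC ^^ n) (shift T l w))" for n
      unfolding rec
      by (simp add: F_def cscale_def case_prod_beta linear_simps[OF bl] complex_eq_iff)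
    show "cmod l < 1" by fact
    show "(\<lambda>n. F b ((TC ^^ n) (shift T l w))) \<longlonglongrightarrow> 0" using F0[OF assms(1) b] .
  qed
  have "(\<lambda>n. (\<Sum>b\<in>B. r b (fst ((TC ^^ n) w)) *\<^sub>R b)) \<longlonglongrightarrow> (\<Sum>b\<in>B. 0 *\<^sub>R b)"
  proof (intro tendsto_sum tendsto_scaleR tendsto_const)
    fix b assume "b \<in> B"
    from tendsto_Re[OF Fc[OF this]] show "(\<lambda>n. r b (fst ((TC ^^ n) w))) \<longlonglongrightarrow> 0" by (simp add: F_def)
  qed
  then have 1: "(\<lambda>n. fst ((TC ^^ n) w)) \<longlonglongrightarrow> 0" using B(3) by simp
  have "(\<lambda>n. (\<Sum>b\<in>B. r b (snd ((TC ^^ n) w)) *\<^sub>R b)) \<longlonglongrightarrow> (\<Sum>b\<in>B. 0 *\<^sub>R b)"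
  proof (intro tendsto_sum tendsto_scaleR tendsto_const)
    fix b assume "b \<in> B"
    from tendsto_Im[OF Fc[OF this]] show "(\<lambda>n. r b (snd ((TC ^^ n) w))) \<longlonglongrightarrow> 0" by (simp add: F_def)
  qed
  then have 2: "(\<lambda>n. snd ((TC ^^ n) w)) \<longlonglongrightarrow> 0" using B(3) by simp
  show ?thesis using tendsto_Pair[OF 1 2] by (simp add: zero_prod_def)
qed

lemma linear_Tn: "linear (T ^^ n)"
proof (induction n)
  case 0 then show ?case by (simp add: id_def[symmetric] linear_id)
next
  case (Suc n) then show ?case using linear_compose[OF Suc T] by (simp only: funpow.simps)
qed

lemma powers_uniformly_small:
  assumes "\<And>x. (\<lambda>n. (T ^^ n) x) \<longlonglongrightarrow> 0" "c > 0"
  shows "\<exists>n>0. \<forall>x. norm ((T ^^ n) x) \<le> c * norm x"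
proof -
  obtain B r K where B: "finite B" "K > 0" "\<forall>x::'e. (\<Sum>b\<in>B. r b x *\<^sub>R b) = x"
    "\<forall>b\<in>B. bounded_linear (r b)" "\<forall>b\<in>B. \<forall>x. \<bar>r b x\<bar> \<le> K * norm x"
    using finite_dim_coordinates[OF fd] by (elim exE conjE) (rule that)
  define e where "e = c / (K * (real (card B) + 1))"
  have e: "e > 0" unfolding e_def using assms(2) B(2) by simp
  have "\<forall>\<^sub>F n in sequentially. \<forall>b\<in>B. norm ((T ^^ n) b) < e"
    using B(1) assms(1) e by (intro eventually_ball_finite) (auto simp: tendsto_iff dist_norm)
  then obtain n0 where n0: "\<forall>n\<ge>n0. \<forall>b\<in>B. norm ((T ^^ n) b) < e"
    by (auto simp: eventually_sequentially)
  define n where "n = Suc n0"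
  have "norm ((T ^^ n) x) \<le> c * norm x" for x
  proof -
    have "(T ^^ n) x = (\<Sum>b\<in>B. r b x *\<^sub>R (T ^^ n) b)"
      using arg_cong[OF B(3)[rule_format, of x], of "T ^^ n"]
      by (simp add: linear_sum[OF linear_Tn] linear_scale[OF linear_Tn])
    also have "norm \<dots> \<le> (\<Sum>b\<in>B. norm (r b x *\<^sub>R (T ^^ n) b))" by (rule norm_sum)
    also have "\<dots> \<le> (\<Sum>b\<in>B. (K * norm x) * e)"
      using B(2,5) n0 n_def by (intro sum_mono) (auto intro!: mult_mono simp: less_imp_le simp del: funpow.simps)
    also have "\<dots> = (real (card B) * (K * e)) * norm x" by simp
    also have "\<dots> \<le> c * norm x"
    proof (rule mult_right_mono)
      define N where "N = real (card B) + 1"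
      have "N > 0" unfolding N_def by simp
      then have "K * e * N = c" unfolding e_def N_def[symmetric] using B(2) by simp
      then have "K * e * (real (card B) + 1) = c" unfolding N_def .
      then show "real (card B) * (K * e) \<le> c"
        using mult_pos_pos[OF B(2) e] by (simp add: algebra_simps)
    qed simp
    finally show ?thesis .
  qed
  then show ?thesis unfolding n_def by blast
qed

lemma eigenvector: "z \<in> complex_spectrum T \<Longrightarrow> \<exists>w. w \<noteq> 0 \<and> TC w = cscale z w"
  by (simp only: complex_spectrum_def mem_Collect_eq)

text \<open>Forward, the annihilating product is removed factor by factor: if
  \<open>cmod l < 1\<close>, decay of the shifted vector gives decay of the vector; if
  \<open>cmod l \<ge> 1\<close>, the factor is injective because \<open>l\<close> is no eigenvalue.
  Backward, a single power of \<open>T\<close> has small norm, which bounds all eigenvalues by one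
  number below 1.\<close>

lemma complex_spectral_radius_less_1_iff:
  "complex_spectral_radius T < 1 \<longleftrightarrow> (\<forall>x. (\<lambda>n. (T ^^ n) x) \<longlonglongrightarrow> 0)"
proof
  have bl: "bounded_linear T" using finite_dim_linear_bounded[OF fd T] .
  assume sr: "complex_spectral_radius T < 1"
  obtain K where K: "\<And>x. norm (T x) \<le> norm x * K" "K > 0"
    using bounded_linear.pos_bounded[OF bl] by blast
  \<comment> \<open>\<open>Sup\<close> bounds its members only once the set of moduli is known to be
    bounded above.\<close>
  have "cmod z \<le> 4 * K" if z: "z \<in> complex_spectrum T" for z
  proof -
    obtain w where w: "w \<noteq> 0" "TC w = cscale z w" using eigenvector[OF z] by (elim exE conjE)
    have "norm (TC w) \<le> norm (T (fst w)) + norm (T (snd w))"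
      by (simp add: norm_prod_def sqrt_sum_squares_le_sum)
    also have "\<dots> \<le> norm w * K + norm w * K"
      using K norm_fst_le[of "fst w" "snd w"] norm_snd_le[of "snd w" "fst w"]
      by (intro add_mono order_trans[OF K(1)] mult_right_mono) auto
    finally have "norm (cscale z w) \<le> norm w * K + norm w * K" unfolding w(2) .
    then have "cmod z * norm w \<le> 4 * K * norm w" using norm_cscale_ge[of z w] by (simp add: mult_ac)
    then show ?thesis using w(1) by (metis mult_le_cancel_right_pos zero_less_norm_iff)
  qed
  then have bdd: "bdd_above (insert 0 (cmod ` complex_spectrum T))"
    by (intro bdd_aboveI[of _ "4 * K"]) (use K(2) in auto)
  have ev: "cmod z < 1" if "z \<in> complex_spectrum T" for z
    using cSup_upper[OF _ bdd, of "cmod z"] that sr unfolding complex_spectral_radius_def by auto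
  have main: "decays w" if "fold (shift T) ls w = 0" for ls w
    using that
  proof (induction ls arbitrary: w)
    case (Cons l ls)
    show ?case
    proof (cases "cmod l < 1")
      case True
      then show ?thesis using Cons by (intro decays_shift[of l w]) simp_all
    next
      case False
      then have "l \<notin> complex_spectrum T" using ev by blast
      then have "\<And>v. TC v = cscale l v \<Longrightarrow> v = 0"
        unfolding complex_spectrum_def mem_Collect_eq by metis
      moreover have "shift T l (fold (shift T) ls w) = 0"
        using Cons(2) by (simp add: fold_shift_commute)
      then have "TC (fold (shift T) ls w) = cscale l (fold (shift T) ls w)"
        by (simp only: shift_def right_minus_eq)
      ultimately have "fold (shift T) ls w = 0" .
      then show ?thesis using Cons(1) by blast
    qed
  next
    case Nil
    have "(TC ^^ n) 0 = 0" for n by (induction n) (simp_all add: TC_zero)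
    then show ?case using Nil by simp
  qed
  obtain ls where "\<forall>w. fold (shift T) ls w = 0" using annihilating_list by blast
  then have "decays (x, 0)" for x using main by blast
  then show "\<forall>x. (\<lambda>n. (T ^^ n) x) \<longlonglongrightarrow> 0" using decays_Pair by blast
next
  assume dec: "\<forall>x. (\<lambda>n. (T ^^ n) x) \<longlonglongrightarrow> 0"
  \<comment> \<open>The constant 1/4 leaves 1/2 after the factor 2 lost in
    \<open>norm_cscale_ge\<close>.\<close>
  obtain n where n: "n > 0" "\<forall>x. norm ((T ^^ n) x) \<le> 1/4 * norm x"
    using powers_uniformly_small[of "1/4"] dec by auto
  have "cmod z \<le> root n (1/2)" if z: "z \<in> complex_spectrum T" for z
  proof -
    obtain w where w: "w \<noteq> 0" "TC w = cscale z w" using eigenvector[OF z] by (elim exE conjE)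
    have p: "(TC ^^ k) w = cscale (z ^ k) w" for k
      by (induction k) (simp_all add: TC_cscale w(2) mult.commute)
    obtain a b where ab: "w = (a, b)" by (cases w)
    have "norm ((TC ^^ n) w) \<le> sqrt ((1/4 * norm a)\<^sup>2 + (1/4 * norm b)\<^sup>2)"
      unfolding ab TCn_Pair norm_Pair using n(2)
      by (intro real_sqrt_le_mono add_mono power_mono) auto
    also have "\<dots> = sqrt ((1/4)\<^sup>2 * ((norm a)\<^sup>2 + (norm b)\<^sup>2))"
      by (simp only: power_mult_distrib distrib_left)
    also have "\<dots> = 1/4 * norm w"
      unfolding ab norm_Pair real_sqrt_mult by simp
    finally have "cmod (z ^ n) * norm w / 2 \<le> 1/4 * norm w"
      using norm_cscale_ge[of "z ^ n" w] unfolding p by linarith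
    then have "cmod z ^ n \<le> 1/2" using w(1) by (simp add: field_simps norm_power)
    also have "\<dots> = root n (1/2) ^ n" using n(1) by simp
    finally have "cmod z ^ n \<le> root n (1/2) ^ n" .
    then show ?thesis using power_mono_iff[of "cmod z" "root n (1/2)" n] n(1)
      by (simp only: norm_ge_zero real_root_ge_zero)
  qed
  then have "complex_spectral_radius T \<le> root n (1/2)"
    unfolding complex_spectral_radius_def by (intro cSup_least) (auto simp: real_root_ge_zero)
  also have "\<dots> < root n 1" using n(1) by (intro real_root_less_mono) auto
  finally show "complex_spectral_radius T < 1" using n(1) by simp
qed

text \<open>Any nonzero functional vanishing on \<open>M\<close> can be composed with the factors of
  the annihilating product; the last nonzero composition is an eigenfunctional, and invariance of
  \<open>M\<close> keeps it zero on \<open>M\<close>. Its eigenvalue is outside the open unit disc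
  because the decaying vectors lie in its kernel.\<close>

lemma eigenfunctional_modulus_ge_1:
  assumes M: "subspace M" "T ` M \<subseteq> M" "{x. (\<lambda>n. (T ^^ n) x) \<longlonglongrightarrow> 0} \<subseteq> M" "M \<noteq> UNIV"
  shows "\<exists>(f :: 'e \<Rightarrow> complex) l. linear f \<and> (\<exists>x. f x \<noteq> 0) \<and> (\<forall>x\<in>M. f x = 0) \<and>
    (\<forall>x. f (T x) = l * f x) \<and> cmod l \<ge> 1"
proof -
  define func where "func F \<longleftrightarrow> (\<forall>w w'. F (w + w') = F w + F w') \<and> (\<forall>z w. F (cscale z w) = z * F w) \<and>
    (\<forall>u\<in>M. \<forall>v\<in>M. F (u, v) = 0) \<and> (\<exists>w. F w \<noteq> 0)" for F :: "'e \<times> 'e \<Rightarrow> complex"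
  have func_diff: "F (w - w') = F w - F w'" if "func F" for F w w'
  proof -
    have "F (w - w') + F w' = F w" using that unfolding func_def by (metis diff_add_cancel)
    then show ?thesis by (simp add: algebra_simps)
  qed
  have func_add: "F (w + w') = F w + F w'" if "func F" for F w w'
    using that unfolding func_def by blast
  have func_scale: "F (cscale z w) = z * F w" if "func F" for F z w
    using that unfolding func_def by blast
  obtain ls where ls: "\<forall>w. fold (shift T) ls w = 0" using annihilating_list by blast
  obtain x0 where x0: "x0 \<notin> M" using M(4) by blast
  obtain g :: "'e \<Rightarrow> real" where g: "linear g" "\<forall>x\<in>M. g x = 0" "g x0 = 1"
  proof -
    obtain B where B: "B \<subseteq> M" "independent B" "M \<subseteq> span B"
      using maximal_independent_subset by blast
    have sB: "span B = M" using B M(1) by (metis span_minimal subset_antisym)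
    then have "independent (insert x0 B)" using B x0 by (simp add: independent_insert)
    then obtain g where g: "linear g" "\<forall>x\<in>insert x0 B. g x = (if x = x0 then 1 else (0::real))"
      using linear_independent_extend[of "insert x0 B" "\<lambda>x. if x = x0 then 1 else (0::real)"] by blast
    have "x0 \<notin> B" using B x0 by blast
    then have "g x = 0" if "x \<in> B" for x using g(2) that by auto
    then have "g x = 0" if "x \<in> M" for x
      using linear_eq_0_on_span[OF g(1), of B x] that sB by blast
    with g that show ?thesis by simp
  qed
  define F0 where "F0 w = Complex (g (fst w)) (g (snd w))" for w
  have "func F0"
    unfolding func_def F0_def using g
    by (auto simp: cscale_def case_prod_beta linear_add linear_diff linear_scale complex_eq_iff
        intro!: exI[of _ x0])
  have "\<exists>G l. func G \<and> (\<forall>w. G (TC w) = l * G w)"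
    if "func F" "\<forall>w. F (fold (shift T) ls w) = 0" for F ls
    using that
  proof (induction ls arbitrary: F)
    case Nil then show ?case unfolding func_def by simp
  next
    case (Cons l ls)
    have sh: "F (shift T l w) = F (TC w) - l * F w" for w
      using func_diff[OF Cons(2)] func_scale[OF Cons(2)] by (simp add: shift_def)
    show ?case
    proof (cases "\<forall>w. F (shift T l w) = 0")
      case True
      then show ?thesis using sh Cons(2) by (metis eq_iff_diff_eq_0)
    next
      case False
      have "func (\<lambda>w. F (shift T l w))"
        unfolding func_def
      proof (intro conjI allI ballI)
        fix u v assume "u \<in> M" "v \<in> M"
        then show "F (shift T l (u, v)) = 0"
          unfolding sh using Cons(2) image_subset_iff[THEN iffD1, OF M(2)] by (simp add: func_def)
      qed (use False in \<open>simp_all add: shift_add shift_cscale func_add[OF Cons(2)] func_scale[OF Cons(2)]\<close>)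
      moreover have "\<forall>w. F (shift T l (fold (shift T) ls w)) = 0"
        using Cons(3) by (simp add: fold_shift_commute)
      ultimately show ?thesis using Cons(1) by blast
    qed
  qed
  moreover have "F0 (fold (shift T) ls w) = 0" for w
    using g(1) by (simp add: F0_def ls[rule_format] linear_0 zero_complex.code)
  ultimately obtain G l where G: "func G" "\<And>w. G (TC w) = l * G w" using \<open>func F0\<close> by blast
  have Gsh: "G (shift T k w) = (l - k) * G w" for k w
    using func_diff[OF G(1)] func_scale[OF G(1)] G(2) by (simp add: shift_def left_diff_distrib)
  have l: "cmod l \<ge> 1"
  proof (rule ccontr)
    assume "\<not> cmod l \<ge> 1"
    then have l1: "cmod l < 1" by simp
    \<comment> \<open>Reduces the annihilating product to decay: factors with
      \<open>cmod k < 1\<close> are removed by \<open>decays_shift\<close>; for the others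
      \<open>k \<noteq> l\<close>, and \<open>Gsh\<close> allows division by
      \<open>l - k\<close>.\<close>
    have G0: "G w = 0" if "decays (fold (shift T) ks w)" for ks w
      using that
    proof (induction ks arbitrary: w)
      case Nil
      obtain u v where uv: "w = (u, v)" by (cases w)
      then have "u \<in> M" "v \<in> M" using Nil M(3) decays_Pair[of u v] by auto
      then show ?case using G(1) uv unfolding func_def by blast
    next
      case (Cons k ks)
      show ?case
      proof (cases "cmod k < 1")
        case True
        have "decays (shift T k (fold (shift T) ks w))"
          using Cons(2) by (simp add: fold_shift_commute)
        then show ?thesis using Cons(1) decays_shift True by blast
      next
        case False
        have "G (shift T k w) = 0" using Cons by simp
        then show ?thesis using Gsh l1 False by auto
      qed
    qed
    have d0: "decays 0"
    proof -
      have "(TC ^^ n) 0 = 0" for n by (induction n) (simp_all add: TC_zero)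
      then show ?thesis by simp
    qed
    have "G w = 0" for w by (rule G0[of ls]) (simp only: ls[rule_format] d0)
    then show False using G(1) unfolding func_def by blast
  qed
  define f where "f x = G (x, 0)" for x
  have Gf: "G (u, v) = f u + \<i> * f v" for u v
  proof -
    have "G ((u, 0) + cscale \<i> (v, 0)) = G (u, 0) + \<i> * G (v, 0)" using func_add[OF G(1)] func_scale[OF G(1)] by simp
    then show ?thesis by (simp add: cscale_def f_def)
  qed
  have "linear f"
  proof (rule linearI)
    have G1: "G (w + w') = G w + G w'" "G (cscale z w) = z * G w" for w w' z
      using func_add[OF G(1)] func_scale[OF G(1)] by blast+
    show "f (a + b) = f a + f b" for a b using G1(1)[of "(a,0)" "(b,0)"] by (simp add: f_def)
    show "f (r *\<^sub>R b) = r *\<^sub>R f b" for r b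
      using G1(2)[of "of_real r" "(b,0)"] by (simp add: f_def cscale_of_real scaleR_conv_of_real)
  qed
  moreover have "\<exists>x. f x \<noteq> 0"
  proof (rule ccontr)
    assume "\<not> ?thesis"
    then have "G w = 0" for w using Gf by (cases w) simp
    then show False using G(1) unfolding func_def by blast
  qed
  moreover have "\<forall>x\<in>M. f x = 0" using G(1) subspace_0[OF M(1)] unfolding f_def func_def by blast
  moreover have "\<forall>x. f (T x) = l * f x"
  proof
    show "f (T x) = l * f x" for x using G(2)[of "(x, 0)"] linear_0[OF T] by (simp add: f_def)
  qed
  ultimately show ?thesis using l by blast
qed

end

section \<open>Groups with a chart at the identity\<close>

text \<open>A Lie group seen through one chart \<open>\<kappa>\<close> at the identity with inverse \<open>\<eta>\<close>; all that is kept of the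
  smooth structure is the second-order expansion of the multiplication.\<close>

locale chart_group = group L
  for L :: "'l::t2_space monoid" (structure) +
  fixes U :: "'l set" and \<kappa> :: "'l \<Rightarrow> 'e::real_normed_vector" and \<eta> :: "'e \<Rightarrow> 'l"
    and \<beta> :: "'e \<Rightarrow> 'e \<Rightarrow> 'e" and C R :: real
  assumes carrier_UNIV: "carrier L = UNIV"
    and cont_mult: "continuous_on UNIV (\<lambda>(x, y). x \<otimes> y)"
    and cont_inv: "continuous_on UNIV (\<lambda>x. inv x)"
    and open_U: "open U" and one_U: "\<one> \<in> U" and \<kappa>_one: "\<kappa> \<one> = 0"
    and cont_\<kappa>: "continuous_on U \<kappa>" and cont_\<eta>: "continuous_on (\<kappa> ` U) \<eta>"
    and \<eta>_\<kappa>: "\<And>x. x \<in> U \<Longrightarrow> \<eta> (\<kappa> x) = x"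
    and bilinear_\<beta>: "bounded_bilinear \<beta>"
    and expansion: "\<And>\<epsilon>. \<epsilon> > 0 \<Longrightarrow> \<exists>\<delta>>0. \<forall>x\<in>U. \<forall>y\<in>U. norm (\<kappa> x) < \<delta> \<longrightarrow> norm (\<kappa> y) < \<delta> \<longrightarrow>
      norm (\<kappa> (x \<otimes> y) - \<kappa> x - \<kappa> y - \<beta> (\<kappa> x) (\<kappa> y)) \<le> \<epsilon> * norm (\<kappa> x) * norm (\<kappa> y)"
    and C_nonneg: "0 \<le> C" and R_pos: "0 < R" and CR: "C * R \<le> 1/4" and ball_R: "ball 0 R \<subseteq> \<kappa> ` U"
    and quasi_U: "\<And>x y. x \<in> U \<Longrightarrow> y \<in> U \<Longrightarrow> norm (\<kappa> x) < R \<Longrightarrow> norm (\<kappa> y) < R \<Longrightarrow> x \<otimes> y \<in> U"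
    and quasi: "\<And>x y. x \<in> U \<Longrightarrow> y \<in> U \<Longrightarrow> norm (\<kappa> x) < R \<Longrightarrow> norm (\<kappa> y) < R \<Longrightarrow>
      norm (\<kappa> (x \<otimes> y) - \<kappa> x - \<kappa> y) \<le> C * norm (\<kappa> x) * norm (\<kappa> y)"
begin

abbreviation size :: "'l \<Rightarrow> real" where "size x \<equiv> norm (\<kappa> x)"

text \<open>Membership in \<open>U\<close> is demanded because \<open>\<kappa>\<close> carries no
  information outside the chart domain.\<close>

definition nbhd :: "real \<Rightarrow> 'l set" where "nbhd \<delta> = {x \<in> U. size x < \<delta>}"

section \<open>Chart balls as a neighbourhood base of the identity\<close>

lemma car [simp]: "x \<in> carrier L" by (simp add: carrier_UNIV)

lemma mult_inv_cancel [simp]: "x \<otimes> (inv x \<otimes> y) = y" "inv x \<otimes> (x \<otimes> y) = y"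
  by (simp_all add: m_assoc[symmetric])

lemma open_nbhd: "open (nbhd \<delta>)"
proof -
  have "nbhd \<delta> = \<kappa> -` ball 0 \<delta> \<inter> U" by (auto simp: nbhd_def)
  then show ?thesis using cont_\<kappa> open_U continuous_on_open_vimage by (metis open_ball)
qed

lemma one_nbhd: "\<delta> > 0 \<Longrightarrow> \<one> \<in> nbhd \<delta>" by (simp add: nbhd_def one_U \<kappa>_one)

lemma nbhd_mono: "\<delta> \<le> \<delta>' \<Longrightarrow> nbhd \<delta> \<subseteq> nbhd \<delta>'" by (auto simp: nbhd_def)

lemma \<kappa>_\<eta>: "norm v < R \<Longrightarrow> \<kappa> (\<eta> v) = v" and \<eta>_U: "norm v < R \<Longrightarrow> \<eta> v \<in> U"
proof -
  assume "norm v < R"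
  then obtain x where "x \<in> U" "v = \<kappa> x" using ball_R by (auto simp: subset_iff)
  then show "\<kappa> (\<eta> v) = v" "\<eta> v \<in> U" using \<eta>_\<kappa> by auto
qed

lemma \<eta>_nbhd: "norm v < \<delta> \<Longrightarrow> norm v < R \<Longrightarrow> \<eta> v \<in> nbhd \<delta>"
  by (simp add: nbhd_def \<kappa>_\<eta> \<eta>_U)

lemma \<eta>_0: "\<eta> 0 = \<one>" using \<eta>_\<kappa>[OF one_U] \<kappa>_one by simp

lemma continuous_\<eta>: "continuous_on (ball 0 R) \<eta>"
  using cont_\<eta> ball_R continuous_on_subset by blast

lemma nbhd_base:
  assumes "open W" "\<one> \<in> W"
  shows "\<exists>\<delta>>0. \<delta> \<le> R \<and> nbhd \<delta> \<subseteq> W"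
proof -
  have "open (\<eta> -` W \<inter> ball 0 R)"
    using continuous_on_open_vimage[OF open_ball] continuous_\<eta> assms(1) by blast
  moreover have "0 \<in> \<eta> -` W \<inter> ball 0 R" using \<eta>_0 assms R_pos by simp
  ultimately obtain d where d: "d > 0" "ball 0 d \<subseteq> \<eta> -` W \<inter> ball 0 R"
    using open_contains_ball by blast
  show ?thesis
  proof (intro exI conjI)
    show "min d R > 0" "min d R \<le> R" using d R_pos by auto
    show "nbhd (min d R) \<subseteq> W"
    proof
      fix x assume x: "x \<in> nbhd (min d R)"
      then have "\<kappa> x \<in> ball 0 d" by (simp add: nbhd_def)
      then have "\<eta> (\<kappa> x) \<in> W" using d(2) by blast
      then show "x \<in> W" using \<eta>_\<kappa> x by (simp add: nbhd_def)
    qed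
  qed
qed

lemma continuous_on_mult:
  assumes "continuous_on S f" "continuous_on S g"
  shows "continuous_on S (\<lambda>s. f s \<otimes> g s)"
  using continuous_on_compose2[OF cont_mult continuous_on_Pair[OF assms]] by simp

lemma continuous_on_inv:
  assumes "continuous_on S f"
  shows "continuous_on S (\<lambda>s. inv (f s))"
  using continuous_on_compose2[OF cont_inv assms] by simp

lemma continuous_on_translate: "continuous_on UNIV (\<lambda>x. a \<otimes> x)"
  by (intro continuous_on_mult continuous_intros)

lemma nbhd_base2:
  assumes g: "continuous_on UNIV (\<lambda>(x, y). g x y :: 'l)" and g1: "g \<one> \<one> = \<one>" and "\<delta> > 0"
  shows "\<exists>\<delta>'>0. \<delta>' \<le> R \<and> (\<forall>x\<in>nbhd \<delta>'. \<forall>y\<in>nbhd \<delta>'. g x y \<in> nbhd \<delta>)"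
proof -
  have "open ((\<lambda>(x, y). g x y) -` nbhd \<delta>)"
    by (rule open_vimage[OF open_nbhd g])
  moreover have "(\<one>, \<one>) \<in> (\<lambda>(x, y). g x y) -` nbhd \<delta>" using one_nbhd assms by simp
  ultimately obtain A B where AB: "open A" "open B" "(\<one>, \<one>) \<in> A \<times> B" "A \<times> B \<subseteq> (\<lambda>(x, y). g x y) -` nbhd \<delta>"
    by (rule open_prod_elim)
  obtain d where d: "d > 0" "d \<le> R" "nbhd d \<subseteq> A \<inter> B"
    using nbhd_base[of "A \<inter> B"] AB by auto
  show ?thesis
  proof (intro exI conjI ballI)
    fix x y assume "x \<in> nbhd d" "y \<in> nbhd d"
    then have "(x, y) \<in> A \<times> B" using d(3) by auto
    then show "g x y \<in> nbhd \<delta>" using AB(4) by auto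
  qed (use d in auto)
qed

lemma rad_exists: "\<exists>r>0. r \<le> R \<and> (\<forall>x\<in>nbhd r. \<forall>y\<in>nbhd r. inv x \<otimes> y \<in> nbhd R)"
proof (rule nbhd_base2[OF _ _ R_pos])
  show "continuous_on UNIV (\<lambda>(x, y). inv x \<otimes> y)"
    unfolding case_prod_unfold by (intro continuous_on_mult continuous_on_inv continuous_intros)
qed simp

text \<open>Fixed once and for all so that left quotients of elements this close to the identity
  stay in the ball where the estimates hold.\<close>

definition rad :: real where
  "rad = (SOME r. r > 0 \<and> r \<le> R \<and> (\<forall>x\<in>nbhd r. \<forall>y\<in>nbhd r. inv x \<otimes> y \<in> nbhd R))"

lemma rad: "rad > 0" "rad \<le> R" "x \<in> nbhd rad \<Longrightarrow> y \<in> nbhd rad \<Longrightarrow> inv x \<otimes> y \<in> nbhd R"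
proof -
  have "rad > 0 \<and> rad \<le> R \<and> (\<forall>x\<in>nbhd rad. \<forall>y\<in>nbhd rad. inv x \<otimes> y \<in> nbhd R)"
    unfolding rad_def by (rule someI_ex[OF rad_exists])
  then show "rad > 0" "rad \<le> R" "x \<in> nbhd rad \<Longrightarrow> y \<in> nbhd rad \<Longrightarrow> inv x \<otimes> y \<in> nbhd R" by auto
qed

section \<open>Metric estimates in the chart\<close>

lemma size_one [simp]: "size \<one> = 0" by (simp add: \<kappa>_one)

text \<open>The bound \<open>C * R \<le> 1/4\<close> makes the defect of additivity small enough to
  be absorbed in the triangle inequalities of \<open>mult_diff\<close>.\<close>

lemma quasi_quarter:
  assumes "x \<in> nbhd R" "y \<in> nbhd R"
  shows "norm (\<kappa> (x \<otimes> y) - \<kappa> x - \<kappa> y) \<le> size y / 4" "norm (\<kappa> (x \<otimes> y) - \<kappa> x - \<kappa> y) \<le> size x / 4"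
proof -
  have q: "norm (\<kappa> (x \<otimes> y) - \<kappa> x - \<kappa> y) \<le> C * size x * size y"
    using quasi assms by (auto simp: nbhd_def)
  have "C * size x \<le> 1/4" "C * size y \<le> 1/4"
    using CR C_nonneg assms mult_left_mono[of "size x" R C] mult_left_mono[of "size y" R C]
    by (auto simp: nbhd_def)
  from mult_right_mono[OF this(1), of "size y"] mult_right_mono[OF this(2), of "size x"] q
  show "norm (\<kappa> (x \<otimes> y) - \<kappa> x - \<kappa> y) \<le> size y / 4" "norm (\<kappa> (x \<otimes> y) - \<kappa> x - \<kappa> y) \<le> size x / 4"
    by (auto simp: mult_ac)
qed

lemma mult_diff:
  assumes "x \<in> nbhd R" "y \<in> nbhd R"
  shows "norm (\<kappa> (x \<otimes> y) - \<kappa> x) \<le> 2 * size y" "norm (\<kappa> (x \<otimes> y) - \<kappa> y) \<le> 2 * size x"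
    "size (x \<otimes> y) \<le> size x + 2 * size y" "size (x \<otimes> y) \<le> size y + 2 * size x"
    "size y \<le> 2 * norm (\<kappa> (x \<otimes> y) - \<kappa> x)"
proof -
  note q = quasi_quarter[OF assms]
  show 1: "norm (\<kappa> (x \<otimes> y) - \<kappa> x) \<le> 2 * size y"
    using norm_triangle_sub[of "\<kappa> (x \<otimes> y) - \<kappa> x" "\<kappa> y"] q(1) norm_ge_zero[of "\<kappa> y"] by linarith
  show 2: "norm (\<kappa> (x \<otimes> y) - \<kappa> y) \<le> 2 * size x"
    using norm_triangle_sub[of "\<kappa> (x \<otimes> y) - \<kappa> y" "\<kappa> x"] norm_ge_zero[of "\<kappa> x"]
      q(2)[unfolded cancel_ab_semigroup_add_class.diff_right_commute[of "\<kappa> (x \<otimes> y)" "\<kappa> x"]] by linarith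
  show "size (x \<otimes> y) \<le> size x + 2 * size y" using 1 norm_triangle_sub[of "\<kappa> (x \<otimes> y)" "\<kappa> x"] by linarith
  show "size (x \<otimes> y) \<le> size y + 2 * size x" using 2 norm_triangle_sub[of "\<kappa> (x \<otimes> y)" "\<kappa> y"] by linarith
  show "size y \<le> 2 * norm (\<kappa> (x \<otimes> y) - \<kappa> x)"
    using norm_triangle_sub[of "\<kappa> y" "\<kappa> (x \<otimes> y) - \<kappa> x"] q(1) norm_ge_zero[of "\<kappa> y"]
      norm_minus_commute[of "\<kappa> y" "\<kappa> (x \<otimes> y) - \<kappa> x"] by linarith
qed

text \<open>The lower bound in \<open>mult_diff\<close>, applied to
  \<open>x \<otimes> (inv x \<otimes> y) = y\<close>. It converts distances of coordinates into
  sizes of left quotients, the quantities that path sums are made of.\<close>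

lemma size_diff:
  assumes "x \<in> nbhd rad" "y \<in> nbhd rad"
  shows "size (inv x \<otimes> y) \<le> 2 * norm (\<kappa> y - \<kappa> x)"
  using mult_diff(5)[of x "inv x \<otimes> y"] rad(3)[OF assms] nbhd_mono[OF rad(2)] assms by auto

lemma size_inv:
  assumes "x \<in> nbhd rad"
  shows "inv x \<in> nbhd R" "size (inv x) \<le> 2 * size x"
  using rad(3)[OF assms one_nbhd[OF rad(1)]] size_diff[OF assms one_nbhd[OF rad(1)]] by (auto simp: \<kappa>_one)

text \<open>A straight segment in the chart, in general not a one-parameter subgroup; what matters
  is that its increments are linear in the step.\<close>

definition ray :: "'l \<Rightarrow> real \<Rightarrow> 'l" where "ray x t = \<eta> (t *\<^sub>R \<kappa> x)"

lemma ray: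
  assumes "x \<in> nbhd \<delta>" "\<delta> \<le> R" "0 \<le> t" "t \<le> 1"
  shows "ray x t \<in> nbhd \<delta>" "\<kappa> (ray x t) = t *\<^sub>R \<kappa> x"
proof -
  have "norm (t *\<^sub>R \<kappa> x) \<le> size x" using assms by (simp add: mult_left_le_one_le)
  then have "norm (t *\<^sub>R \<kappa> x) < \<delta>" "norm (t *\<^sub>R \<kappa> x) < R" using assms by (auto simp: nbhd_def)
  then show "ray x t \<in> nbhd \<delta>" "\<kappa> (ray x t) = t *\<^sub>R \<kappa> x" by (auto simp: ray_def \<eta>_nbhd \<kappa>_\<eta>)
qed

lemma ray_0 [simp]: "ray x 0 = \<one>" by (simp add: ray_def \<eta>_0)
lemma ray_1: "x \<in> U \<Longrightarrow> ray x 1 = x" by (simp add: ray_def \<eta>_\<kappa>)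

lemma ray_diff:
  assumes "x \<in> nbhd rad" "0 \<le> t" "t \<le> 1" "0 \<le> s" "s \<le> 1"
  shows "inv (ray x s) \<otimes> ray x t \<in> nbhd R" "size (inv (ray x s) \<otimes> ray x t) \<le> 2 * \<bar>t - s\<bar> * size x"
proof -
  note r = ray[OF assms(1) rad(2) assms(2,3)] ray[OF assms(1) rad(2) assms(4,5)]
  show "inv (ray x s) \<otimes> ray x t \<in> nbhd R" using rad(3) r by blast
  have "\<kappa> (ray x t) - \<kappa> (ray x s) = (t - s) *\<^sub>R \<kappa> x" by (simp add: r algebra_simps)
  then show "size (inv (ray x s) \<otimes> ray x t) \<le> 2 * \<bar>t - s\<bar> * size x"
    using size_diff[OF r(3,1)] by simp
qed

lemma ray_continuous:
  assumes "x \<in> nbhd R"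
  shows "continuous_on {0..1} (ray x)"
proof -
  have "continuous_on {0..1} (\<eta> \<circ> (\<lambda>t. t *\<^sub>R \<kappa> x))"
  proof (rule continuous_on_compose)
    have "(\<lambda>t. t *\<^sub>R \<kappa> x) ` {0..1} \<subseteq> ball 0 R"
    proof (rule image_subsetI)
      fix t :: real assume "t \<in> {0..1}"
      then have "t * size x \<le> size x" "0 \<le> t" by (simp_all add: mult_left_le_one_le)
      then show "t *\<^sub>R \<kappa> x \<in> ball 0 R" using assms by (simp add: nbhd_def)
    qed
    then show "continuous_on ((\<lambda>t. t *\<^sub>R \<kappa> x) ` {0..1}) \<eta>"
      using continuous_\<eta> continuous_on_subset by blast
  qed (intro continuous_intros)
  then show ?thesis by (simp add: ray_def[abs_def] o_def)
qed

text \<open>Translates of the ball show that \<open>M\<close> is open, and so is its complement, a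
  union of cosets. Properties near the identity are spread over the whole group in this way.\<close>

lemma open_subgroup_UNIV:
  assumes conn: "connected (UNIV :: 'l set)"
    and M: "\<one> \<in> M" "\<And>x y. x \<in> M \<Longrightarrow> y \<in> M \<Longrightarrow> x \<otimes> y \<in> M" "\<And>x. x \<in> M \<Longrightarrow> inv x \<in> M"
    and \<delta>: "\<delta> > 0" "nbhd \<delta> \<subseteq> M"
  shows "M = UNIV"
proof -
  have tr: "open ((\<lambda>x. a \<otimes> x) -` nbhd \<delta>)" for a
    by (rule open_vimage[OF open_nbhd continuous_on_translate])
  have "open M"
  proof (rule Topological_Spaces.openI)
    fix x assume x: "x \<in> M"
    have "(\<lambda>y. inv x \<otimes> y) -` nbhd \<delta> \<subseteq> M"
    proof
      fix y assume "y \<in> (\<lambda>y. inv x \<otimes> y) -` nbhd \<delta>"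
      then have "inv x \<otimes> y \<in> M" using \<delta> by auto
      from M(2)[OF x this] show "y \<in> M" by simp
    qed
    then show "\<exists>T. open T \<and> x \<in> T \<and> T \<subseteq> M"
      using tr[of "inv x"] one_nbhd[OF \<delta>(1)] by (intro exI[of _ "(\<lambda>y. inv x \<otimes> y) -` nbhd \<delta>"]) simp
  qed
  moreover have "open (- M)"
  proof (rule Topological_Spaces.openI)
    fix x assume x: "x \<in> - M"
    have "(\<lambda>y. inv x \<otimes> y) -` nbhd \<delta> \<subseteq> - M"
    proof
      fix y assume "y \<in> (\<lambda>y. inv x \<otimes> y) -` nbhd \<delta>"
      then have z: "inv x \<otimes> y \<in> M" using \<delta> by auto
      show "y \<in> - M"
      proof
        assume "y \<in> M"
        from M(2)[OF this M(3)[OF z]] have "x \<in> M"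
          by (simp add: inv_mult_group)
        then show False using x by simp
      qed
    qed
    then show "\<exists>T. open T \<and> x \<in> T \<and> T \<subseteq> - M"
      using tr[of "inv x"] one_nbhd[OF \<delta>(1)] by (intro exI[of _ "(\<lambda>y. inv x \<otimes> y) -` nbhd \<delta>"]) simp
  qed
  then have "closed M" by (simp add: closed_def)
  ultimately have "M = {} \<or> M = UNIV"
    using conn[unfolded connected_clopen, rule_format, of M]
    by (simp add: open_openin[symmetric] closed_closedin[symmetric])
  then show ?thesis using M(1) by auto
qed

end

section \<open>Integrating a functional to a local homomorphism\<close>

text \<open>Discrete Green's theorem: the circulations around the cells add up to the circulation
  around the boundary, since interior edges are passed twice in opposite directions.\<close>

lemma grid_telescope:
  fixes h v :: "nat \<Rightarrow> nat \<Rightarrow> 'a::ab_group_add"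
  shows "(\<Sum>i<n. \<Sum>j<m. h i j + v (Suc i) j - v i j - h i (Suc j)) =
    (\<Sum>i<n. h i 0) - (\<Sum>i<n. h i m) + (\<Sum>j<m. v n j) - (\<Sum>j<m. v 0 j)"
proof -
  have "(\<Sum>i<n. \<Sum>j<m. h i j + v (Suc i) j - v i j - h i (Suc j)) =
      (\<Sum>i<n. \<Sum>j<m. h i j - h i (Suc j)) + (\<Sum>i<n. \<Sum>j<m. v (Suc i) j - v i j)"
    unfolding sum.distrib[symmetric] by (intro sum.cong refl) (simp add: algebra_simps)
  also have "(\<Sum>i<n. \<Sum>j<m. h i j - h i (Suc j)) = (\<Sum>i<n. h i 0 - h i m)"
    by (intro sum.cong refl sum_lessThan_telescope')
  also have "(\<Sum>i<n. \<Sum>j<m. v (Suc i) j - v i j) = (\<Sum>j<m. \<Sum>i<n. v (Suc i) j - v i j)"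
    by (rule sum.swap)
  also have "\<dots> = (\<Sum>j<m. v n j - v 0 j)"
    by (intro sum.cong refl) (rule sum_lessThan_telescope)
  finally show ?thesis by (simp add: sum_subtractf algebra_simps)
qed

lemma sum_lessThan_double:
  fixes g :: "nat \<Rightarrow> 'a::comm_monoid_add"
  shows "(\<Sum>i<2*n. g i) = (\<Sum>i<n. g (2*i) + g (2*i+1))"
  by (induction n) (simp_all add: add.assoc)

context chart_group
begin

text \<open>A Riemann sum for the integral along \<open>p\<close> of the left-invariant one-form
  that \<open>\<psi>\<close> approximates; it does not change when \<open>p\<close> is translated
  from the left.\<close>

definition path_sum :: "('l \<Rightarrow> complex) \<Rightarrow> (real \<Rightarrow> 'l) \<Rightarrow> nat \<Rightarrow> complex" where
  "path_sum \<psi> p n = (\<Sum>i<n. \<psi> (inv (p (real i / real n)) \<otimes> p (real (Suc i) / real n)))"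

text \<open>If \<open>f\<close> kills brackets, then \<open>f \<circ> \<beta>\<close> is symmetric and subtracting half of its diagonal removes
  the second-order defect of \<open>f \<circ> \<kappa>\<close>.\<close>

lemma quasi_additive_primitive:
  assumes f: "bounded_linear f" and sym: "\<And>u v. f (\<beta> u v) = f (\<beta> v u)"
  defines "\<psi> \<equiv> (\<lambda>x. f (\<kappa> x) - f (\<beta> (\<kappa> x) (\<kappa> x)) / 2 :: complex)"
  assumes e: "\<epsilon> > 0"
  shows "\<exists>\<delta>>0. \<forall>x\<in>nbhd \<delta>. \<forall>y\<in>nbhd \<delta>. cmod (\<psi> (x \<otimes> y) - \<psi> x - \<psi> y) \<le> \<epsilon> * size x * size y"
proof -
  define g where "g u v = f (\<beta> u v)" for u v
  interpret \<beta>: bounded_bilinear \<beta> by (rule bilinear_\<beta>)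
  interpret f: bounded_linear f by (rule f)
  obtain Kf where Kf: "Kf > 0" "\<And>x. norm (f x) \<le> norm x * Kf" using f.pos_bounded by blast
  obtain Kb where Kb: "Kb > 0" "\<And>u v. norm (\<beta> u v) \<le> norm u * norm v * Kb"
    using \<beta>.pos_bounded by blast
  interpret g: bounded_bilinear g
  proof
    have "norm (g a b) \<le> norm a * norm b * (Kb * Kf)" for a b
      using order_trans[OF Kf(2)[of "\<beta> a b"] mult_right_mono[OF Kb(2)[of a b], of Kf]] Kf(1)
      by (simp add: g_def mult.assoc)
    then show "\<exists>K. \<forall>a b. norm (g a b) \<le> norm a * norm b * K" by blast
  qed (simp_all add: g_def \<beta>.add_left \<beta>.add_right \<beta>.scaleR_left \<beta>.scaleR_right f.add f.scaleR)
  obtain Kg where Kg: "Kg > 0" "\<And>u v. norm (g u v) \<le> norm u * norm v * Kg" using g.pos_bounded by blast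
  define e1 where "e1 = \<epsilon> / (2 * Kf)"
  have e1: "e1 > 0" "e1 * Kf = \<epsilon> / 2" unfolding e1_def using e Kf by auto
  define M where "M = Kb + e1"
  have M: "M > 0" unfolding M_def using Kb e1 by simp
  obtain d where d: "d > 0" "\<forall>x\<in>U. \<forall>y\<in>U. size x < d \<longrightarrow> size y < d \<longrightarrow>
      norm (\<kappa> (x \<otimes> y) - \<kappa> x - \<kappa> y - \<beta> (\<kappa> x) (\<kappa> y)) \<le> e1 * size x * size y"
    using expansion[OF e1(1)] by blast
  \<comment> \<open>The last bound keeps the terms \<open>g (u + v) s\<close> and
    \<open>g s s\<close> within half of the permitted error.\<close>
  define \<delta> where "\<delta> = min (min d 1) (\<epsilon> / (2 * Kg * M * (2 + M)))"
  have \<delta>: "\<delta> > 0" "\<delta> \<le> d" "\<delta> \<le> 1" unfolding \<delta>_def using d e Kg M by auto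
  have \<delta>': "Kg * M * (\<delta> * (2 + M)) \<le> \<epsilon> / 2"
  proof -
    have "\<delta> \<le> \<epsilon> / (2 * Kg * M * (2 + M))" unfolding \<delta>_def by simp
    moreover have P: "0 < 2 * Kg * M * (2 + M)" using Kg M by simp
    ultimately have "\<delta> * (2 * Kg * M * (2 + M)) \<le> \<epsilon>" using pos_le_divide_eq[OF P] by blast
    then show ?thesis by (simp add: algebra_simps)
  qed
  have "cmod (\<psi> (x \<otimes> y) - \<psi> x - \<psi> y) \<le> \<epsilon> * size x * size y" if x: "x \<in> nbhd \<delta>" and y: "y \<in> nbhd \<delta>" for x y
  proof -
    define u v w where "u = \<kappa> x" and "v = \<kappa> y" and "w = \<kappa> (x \<otimes> y)"
    define r where "r = w - u - v - \<beta> u v"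
    define s where "s = \<beta> u v + r"
    have r: "norm r \<le> e1 * norm u * norm v"
      unfolding r_def w_def u_def v_def using d(2) x y \<delta>(2) by (auto simp: nbhd_def)
    have uv: "norm u < \<delta>" "norm v < \<delta>" using x y by (auto simp: nbhd_def u_def v_def)
    have s: "norm s \<le> M * (norm u * norm v)"
      using norm_triangle_ineq[of "\<beta> u v" r] r Kb(2)[of u v] unfolding s_def M_def by (simp add: algebra_simps)
    have w: "w = u + v + s" unfolding s_def r_def by simp
    have gs: "g a b = g b a" for a b unfolding g_def by (rule sym)
    have "g w w = g u u + 2 * g u v + g v v + 2 * g (u + v) s + g s s"
      unfolding w using gs[of u v] gs[of u s] gs[of v s]
      by (simp add: g.add_left g.add_right algebra_simps)
    moreover have "f w = f u + f v + g u v + f r"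
      unfolding w s_def g_def by (simp add: f.add)
    \<comment> \<open>Linear and quadratic terms cancel by symmetry of \<open>g\<close>. What is
      left is the Taylor remainder \<open>r\<close> and terms in which \<open>s\<close>, of order
      \<open>norm u * norm v\<close>, is paired with another small vector.\<close>
    ultimately have eq: "\<psi> (x \<otimes> y) - \<psi> x - \<psi> y = f r - g (u + v) s - g s s / 2"
      unfolding \<psi>_def u_def[symmetric] v_def[symmetric] w_def[symmetric] g_def[symmetric]
      by (simp add: field_simps)
    have n1: "cmod (f r) \<le> \<epsilon> / 2 * (norm u * norm v)"
    proof -
      have "cmod (f r) \<le> norm r * Kf" by (rule Kf(2))
      also have "\<dots> \<le> (e1 * norm u * norm v) * Kf" using r Kf(1) by (intro mult_right_mono) auto
      also have "\<dots> = (e1 * Kf) * (norm u * norm v)" by simp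
      finally show ?thesis by (simp only: e1(2))
    qed
    have n2: "cmod (g (u + v) s + g s s / 2) \<le> \<epsilon> / 2 * (norm u * norm v)"
    proof -
      have "norm u * norm v \<le> \<delta> * 1" using uv \<delta> by (intro mult_mono) auto
      then have "norm s \<le> M * \<delta>" using s M mult_left_mono[of "norm u * norm v" \<delta> M] by linarith
      then have a: "norm (u + v) + norm s \<le> \<delta> * (2 + M)"
        using norm_triangle_ineq[of u v] uv by (simp add: algebra_simps)
      have "cmod (g (u + v) s + g s s / 2) \<le> cmod (g (u + v) s) + cmod (g s s / 2)" by (rule norm_triangle_ineq)
      also have "\<dots> \<le> norm (u + v) * norm s * Kg + norm s * norm s * Kg"
        using Kg(2)[of "u + v" s] Kg(2)[of s s] norm_ge_zero[of "g s s"]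
          norm_divide[of "g s s" 2, unfolded norm_numeral] by linarith
      also have "\<dots> = Kg * norm s * (norm (u + v) + norm s)" by (simp add: algebra_simps)
      also have "\<dots> \<le> Kg * (M * (norm u * norm v)) * (\<delta> * (2 + M))"
        using a s Kg M by (intro mult_mono) auto
      also have "\<dots> = (Kg * M * (\<delta> * (2 + M))) * (norm u * norm v)" by simp
      also have "\<dots> \<le> \<epsilon> / 2 * (norm u * norm v)" by (intro mult_right_mono \<delta>') auto
      finally show ?thesis .
    qed
    have "cmod (f r - (g (u + v) s + g s s / 2)) \<le> \<epsilon> * (norm u * norm v)"
      using norm_triangle_ineq4[of "f r" "g (u + v) s + g s s / 2"] n1 n2 by simp
    then show ?thesis unfolding eq u_def v_def by (simp add: algebra_simps)
  qed
  then show ?thesis using \<delta>(1) by blast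
qed

text \<open>A discrete Poincare lemma: sums of \<open>\<psi>\<close> along finer and finer subdivisions of rays converge, and
  the limit is additive because each of the \<open>n\<^sup>2\<close> cells of a grid contributes only \<open>o(n\<^sup>-\<^sup>2)\<close>.\<close>

lemma local_homomorphism:
  assumes f: "bounded_linear (f :: 'e \<Rightarrow> complex)" and sym: "\<And>u v. f (\<beta> u v) = f (\<beta> v u)"
  shows "\<exists>\<phi> \<rho> K. \<rho> > 0 \<and> (\<forall>x\<in>nbhd \<rho>. \<forall>y\<in>nbhd \<rho>. \<phi> (x \<otimes> y) = \<phi> x + \<phi> y) \<and>
    (\<forall>x\<in>nbhd \<rho>. cmod (\<phi> x - f (\<kappa> x)) \<le> K * (size x)\<^sup>2)"
proof -
  define \<psi> where "\<psi> x = f (\<kappa> x) - f (\<beta> (\<kappa> x) (\<kappa> x)) / 2" for x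
  note qa = quasi_additive_primitive[OF f sym, folded \<psi>_def]
  interpret f: bounded_linear f by (rule f)
  have \<psi>1: "\<psi> \<one> = 0"
    unfolding \<psi>_def by (simp add: \<kappa>_one f.zero bounded_bilinear.zero_left[OF bilinear_\<beta>])
  obtain \<delta>1 where \<delta>1: "\<delta>1 > 0" "\<forall>x\<in>nbhd \<delta>1. \<forall>y\<in>nbhd \<delta>1. cmod (\<psi> (x \<otimes> y) - \<psi> x - \<psi> y) \<le> 1 * size x * size y"
    using qa[of 1] by auto
  define \<rho>1 where "\<rho>1 = min rad \<delta>1"
  have \<rho>1: "\<rho>1 > 0" "\<rho>1 \<le> rad" "\<rho>1 \<le> \<delta>1" "\<rho>1 \<le> R" unfolding \<rho>1_def using rad \<delta>1 by auto
  define a where "a x k = path_sum \<psi> (ray x) (2 ^ k)" for x and k :: nat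
  have a0: "a x 0 = \<psi> x" if "x \<in> U" for x
    unfolding a_def path_sum_def by (simp add: ray_1 that)
  \<comment> \<open>Halving the steps replaces each value at a product by the sum over its two
    factors, both of size at most \<open>size x / n\<close>; the \<open>n\<close> errors add up to
    \<open>(size x)\<^sup>2 / n\<close>.\<close>
  have step: "cmod (a x (Suc k) - a x k) \<le> (size x)\<^sup>2 * (1/2) ^ k" if x: "x \<in> nbhd \<rho>1" for x k
  proof -
    define n :: nat where "n = 2 ^ k"
    have n: "n > 0" unfolding n_def by simp
    have xr: "x \<in> nbhd rad" using x nbhd_mono[OF \<rho>1(2)] by blast
    define q where "q i = ray x (real i / real (2 * n))" for i
    define c where "c i = inv (q i) \<otimes> q (Suc i)" for i
    have c: "c i \<in> nbhd \<delta>1" "size (c i) \<le> size x / n" if "i < 2 * n" for i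
    proof -
      have d: "real (Suc i) / real (2 * n) - real i / real (2 * n) = 1 / real (2 * n)"
        by (simp add: diff_divide_distrib[symmetric])
      have "size (c i) \<le> 2 * \<bar>real (Suc i) / real (2 * n) - real i / real (2 * n)\<bar> * size x"
        unfolding c_def q_def using that n by (intro ray_diff[OF xr]) (auto simp: field_simps)
      also have "\<dots> = size x / n" unfolding d using n by simp
      finally show 1: "size (c i) \<le> size x / n" .
      have "size x / n \<le> size x" using n by (simp add: divide_le_eq mult_le_cancel_left1)
      moreover have "c i \<in> nbhd R"
        unfolding c_def q_def using that n by (intro ray_diff[OF xr]) (auto simp: field_simps)
      ultimately show "c i \<in> nbhd \<delta>1" using 1 x \<rho>1 by (auto simp: nbhd_def)
    qed
    have A: "a x (Suc k) = (\<Sum>i<n. \<psi> (c (2*i)) + \<psi> (c (2*i+1)))"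
      unfolding a_def path_sum_def power_Suc n_def[symmetric] sum_lessThan_double
      by (simp add: c_def q_def)
    have B: "a x k = (\<Sum>i<n. \<psi> (c (2*i) \<otimes> c (2*i+1)))"
      unfolding a_def path_sum_def n_def[symmetric]
    proof (rule sum.cong)
      fix i
      have "ray x (real i / real n) = q (2 * i)" "ray x (real (Suc i) / real n) = q (2 * i + 2)"
        unfolding q_def using n by (auto intro!: arg_cong[of _ _ "ray x"] simp: divide_simps) (simp add: algebra_simps)?
      then show "\<psi> (inv ray x (real i / real n) \<otimes> ray x (real (Suc i) / real n)) = \<psi> (c (2 * i) \<otimes> c (2 * i + 1))"
        by (simp add: c_def m_assoc)
    qed simp
    have "cmod (a x (Suc k) - a x k) = cmod (\<Sum>i<n. \<psi> (c (2*i)) + \<psi> (c (2*i+1)) - \<psi> (c (2*i) \<otimes> c (2*i+1)))"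
      unfolding A B by (simp add: sum_subtractf)
    also have "\<dots> \<le> (\<Sum>i<n. (size x / n) * (size x / n))"
    proof (rule sum_norm_le)
      fix i assume "i \<in> {..<n}"
      then have i: "2 * i < 2 * n" "2 * i + 1 < 2 * n" by auto
      have "cmod (\<psi> (c (2*i)) + \<psi> (c (2*i+1)) - \<psi> (c (2*i) \<otimes> c (2*i+1))) =
          cmod (\<psi> (c (2*i) \<otimes> c (2*i+1)) - \<psi> (c (2*i)) - \<psi> (c (2*i+1)))"
        by (metis diff_diff_eq norm_minus_commute)
      also have "\<dots> \<le> size (c (2*i)) * size (c (2*i+1))"
        using \<delta>1(2) c(1)[OF i(1)] c(1)[OF i(2)] by simp
      also have "\<dots> \<le> (size x / n) * (size x / n)"
        using c(2)[OF i(1)] c(2)[OF i(2)] by (intro mult_mono) auto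
      finally show "cmod (\<psi> (c (2*i)) + \<psi> (c (2*i+1)) - \<psi> (c (2*i) \<otimes> c (2*i+1))) \<le> (size x / n) * (size x / n)" .
    qed
    also have "\<dots> = (size x)\<^sup>2 / n" using n by (simp add: power2_eq_square)
    also have "\<dots> = (size x)\<^sup>2 * (1/2) ^ k" unfolding n_def by (simp add: power_divide)
    finally show ?thesis .
  qed
  define \<phi> where "\<phi> x = lim (a x)" for x
  have conv: "a x \<longlonglongrightarrow> \<phi> x" "cmod (\<phi> x - \<psi> x) \<le> 2 * (size x)\<^sup>2" if x: "x \<in> nbhd \<rho>1" for x
  proof -
    have geo: "(\<lambda>k. (size x)\<^sup>2 * (1/2) ^ k) sums ((size x)\<^sup>2 * 2)"
      using sums_mult[OF geometric_sums[of "1/2::real"]] by simp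
    have sm: "summable (\<lambda>k. norm (a x (Suc k) - a x k))"
      by (rule summable_comparison_test'[OF sums_summable[OF geo]]) (use step[OF x] in simp)
    have "(\<lambda>n. \<Sum>k<n. a x (Suc k) - a x k) \<longlonglongrightarrow> (\<Sum>k. a x (Suc k) - a x k)"
      using summable_LIMSEQ[OF summable_norm_cancel[OF sm]] .
    then have "(\<lambda>n. a x n - a x 0) \<longlonglongrightarrow> (\<Sum>k. a x (Suc k) - a x k)"
      by (simp add: sum_lessThan_telescope)
    then have lim: "a x \<longlonglongrightarrow> (\<Sum>k. a x (Suc k) - a x k) + a x 0"
      using tendsto_add[OF _ tendsto_const[of "a x 0"]] by fastforce
    then show "a x \<longlonglongrightarrow> \<phi> x" unfolding \<phi>_def by (simp add: limI)
    have "\<phi> x = (\<Sum>k. a x (Suc k) - a x k) + a x 0" unfolding \<phi>_def using lim by (rule limI)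
    then have "cmod (\<phi> x - \<psi> x) = cmod (\<Sum>k. a x (Suc k) - a x k)"
      using a0 x by (simp add: nbhd_def)
    also have "\<dots> \<le> (\<Sum>k. cmod (a x (Suc k) - a x k))" by (rule summable_norm[OF sm])
    also have "\<dots> \<le> (\<Sum>k. (size x)\<^sup>2 * (1/2) ^ k)"
      by (rule suminf_le[OF step[OF x] sm sums_summable[OF geo]])
    also have "\<dots> = 2 * (size x)\<^sup>2" using geo by (simp add: sums_iff)
    finally show "cmod (\<phi> x - \<psi> x) \<le> 2 * (size x)\<^sup>2" .
  qed
  \<comment> \<open>Leaves room for \<open>size x + 2 * size y < \<rho>1\<close>, which keeps the
    triangle below inside the ball of radius \<open>\<rho>1\<close>.\<close>
  define \<rho> where "\<rho> = \<rho>1 / 4"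
  have \<rho>: "\<rho> > 0" "\<rho> \<le> \<rho>1" "\<rho> \<le> R" "\<rho> \<le> rad" unfolding \<rho>_def using \<rho>1 by auto
  have hom: "\<phi> (x \<otimes> y) = \<phi> x + \<phi> y" if x: "x \<in> nbhd \<rho>" and y: "y \<in> nbhd \<rho>" for x y
  proof -
    define z where "z s = x \<otimes> ray y s" for s
    have sx: "x \<in> nbhd R" "y \<in> nbhd R" "y \<in> nbhd rad" "size x < \<rho>" "size y < \<rho>"
      using x y \<rho> by (auto simp: nbhd_def)
    have z: "z s \<in> nbhd \<rho>1" if s: "0 \<le> s" "s \<le> 1" for s
    proof -
      have r: "ray y s \<in> nbhd \<rho>" using ray(1)[OF y \<rho>(3) s] .
      then have "ray y s \<in> nbhd R" using nbhd_mono[OF \<rho>(3)] by blast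
      then have "size (z s) \<le> size x + 2 * size (ray y s)" "z s \<in> U"
        unfolding z_def using mult_diff(3) sx quasi_U by (auto simp: nbhd_def)
      then show ?thesis using x r \<rho>1(1) unfolding \<rho>_def nbhd_def by auto
    qed
    \<comment> \<open>The cone over the path from \<open>x\<close> to \<open>x \<otimes> y\<close>:
      a triangle bounded by the rays of \<open>x\<close> and of \<open>x \<otimes> y\<close> and by
      a translate of the ray of \<open>y\<close>.\<close>
    define \<sigma> where "\<sigma> s t = ray (z s) t" for s t
    have \<sigma>: "\<sigma> s t \<in> nbhd rad" "\<kappa> (\<sigma> s t) = t *\<^sub>R \<kappa> (z s)" if "0 \<le> s" "s \<le> 1" "0 \<le> t" "t \<le> 1" for s t
      using ray[OF z[OF that(1,2)] \<rho>1(4) that(3,4)] nbhd_mono[OF \<rho>1(2)] unfolding \<sigma>_def by auto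
    have z_lip: "norm (\<kappa> (z s') - \<kappa> (z s)) \<le> 4 * \<bar>s' - s\<bar> * size y" if s: "0 \<le> s" "s \<le> 1" "0 \<le> s'" "s' \<le> 1" for s s'
    proof -
      define b where "b = inv (ray y s) \<otimes> ray y s'"
      have b: "b \<in> nbhd R" "size b \<le> 2 * \<bar>s' - s\<bar> * size y"
        unfolding b_def using ray_diff[OF sx(3) s(3,4) s(1,2)] by auto
      have "z s' = z s \<otimes> b" unfolding z_def b_def by (simp add: m_assoc)
      then have "norm (\<kappa> (z s') - \<kappa> (z s)) \<le> 2 * size b"
        using mult_diff(1)[of "z s" b] z[OF s(1,2)] nbhd_mono[OF \<rho>1(4)] b(1) by auto
      then show ?thesis using b(2) by linarith
    qed
    \<comment> \<open>A Lipschitz constant in both directions: 2 from \<open>size_diff\<close>, 4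
      from \<open>z_lip\<close>, and \<open>size y < \<rho>1\<close>.\<close>
    define Q where "Q = 8 * \<rho>1"
    have Q: "Q > 0" unfolding Q_def using \<rho>1 by simp
    have edge: "size (inv (\<sigma> s t) \<otimes> \<sigma> s' t) \<le> Q * \<bar>s' - s\<bar>" "inv (\<sigma> s t) \<otimes> \<sigma> s' t \<in> nbhd R"
      if s: "0 \<le> s" "s \<le> 1" "0 \<le> s'" "s' \<le> 1" "0 \<le> t" "t \<le> 1" for s s' t
    proof -
      note \<sigma>1 = \<sigma>[OF s(1,2,5,6)] and \<sigma>2 = \<sigma>[OF s(3,4,5,6)]
      show "inv (\<sigma> s t) \<otimes> \<sigma> s' t \<in> nbhd R" using rad(3) \<sigma>1 \<sigma>2 by blast
      have "size (inv (\<sigma> s t) \<otimes> \<sigma> s' t) \<le> 2 * norm (t *\<^sub>R \<kappa> (z s') - t *\<^sub>R \<kappa> (z s))"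
        using size_diff[OF \<sigma>1(1) \<sigma>2(1)] \<sigma>1 \<sigma>2 by simp
      also have "\<dots> = 2 * (t * norm (\<kappa> (z s') - \<kappa> (z s)))"
        using s by (simp add: scaleR_diff_right[symmetric])
      also have "\<dots> \<le> 2 * (1 * (4 * \<bar>s' - s\<bar> * size y))"
        using z_lip[OF s(1-4)] s by (intro mult_left_mono mult_mono) auto
      also have "\<dots> \<le> Q * \<bar>s' - s\<bar>"
        unfolding Q_def using sx(5) \<rho>(2) mult_right_mono[of "size y" \<rho>1 "\<bar>s' - s\<bar>"] by (simp add: mult_ac)
      finally show "size (inv (\<sigma> s t) \<otimes> \<sigma> s' t) \<le> Q * \<bar>s' - s\<bar>" .
    qed
    have edge': "size (inv (\<sigma> s t) \<otimes> \<sigma> s t') \<le> Q * \<bar>t' - t\<bar>" "inv (\<sigma> s t) \<otimes> \<sigma> s t' \<in> nbhd R"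
      if s: "0 \<le> s" "s \<le> 1" "0 \<le> t" "t \<le> 1" "0 \<le> t'" "t' \<le> 1" for s t t'
    proof -
      note \<sigma>1 = \<sigma>[OF s(1,2,3,4)] and \<sigma>2 = \<sigma>[OF s(1,2,5,6)]
      show "inv (\<sigma> s t) \<otimes> \<sigma> s t' \<in> nbhd R" using rad(3) \<sigma>1 \<sigma>2 by blast
      have "size (inv (\<sigma> s t) \<otimes> \<sigma> s t') \<le> 2 * norm (t' *\<^sub>R \<kappa> (z s) - t *\<^sub>R \<kappa> (z s))"
        using size_diff[OF \<sigma>1(1) \<sigma>2(1)] \<sigma>1 \<sigma>2 by simp
      also have "\<dots> = 2 * (\<bar>t' - t\<bar> * size (z s))"
        by (simp add: scaleR_diff_left[symmetric])
      also have "\<dots> \<le> 2 * (\<bar>t' - t\<bar> * \<rho>1)"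
        using z[OF s(1,2)] by (intro mult_left_mono) (auto simp: nbhd_def)
      also have "\<dots> \<le> Q * \<bar>t' - t\<bar>" unfolding Q_def using \<rho>1(1) by (simp add: mult_left_mono mult.commute)
      finally show "size (inv (\<sigma> s t) \<otimes> \<sigma> s t') \<le> Q * \<bar>t' - t\<bar>" .
    qed
    \<comment> \<open>The boundary sum of the triangle; along powers of two it tends to the defect
      of additivity of \<open>\<phi>\<close>.\<close>
    define I where "I n = path_sum \<psi> (ray (x \<otimes> y)) n - path_sum \<psi> (ray x) n - path_sum \<psi> (ray y) n" for n
    have "I \<longlonglongrightarrow> 0"
    proof (rule LIMSEQ_I)
      fix r :: real assume r: "r > 0"
      \<comment> \<open>Each of the \<open>n * n\<close> cells contributes at most
        \<open>2 * \<epsilon> * (Q / n)\<^sup>2\<close>, which makes \<open>r / 2\<close> in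
        total.\<close>
      define \<epsilon> where "\<epsilon> = r / (4 * Q\<^sup>2)"
      have e: "\<epsilon> > 0" unfolding \<epsilon>_def using r Q by simp
      obtain \<delta> where \<delta>: "\<delta> > 0" "\<forall>x\<in>nbhd \<delta>. \<forall>y\<in>nbhd \<delta>. cmod (\<psi> (x \<otimes> y) - \<psi> x - \<psi> y) \<le> \<epsilon> * size x * size y"
        using qa[OF e] by auto
      obtain N :: nat where N: "Q / \<delta> < real N" using reals_Archimedean2 by blast
      have "cmod (I n) < r" if n: "n \<ge> Suc N" for n
      proof -
        have n0: "n > 0" using n by simp
        have small: "Q / n < \<delta>"
        proof -
          have "Q / \<delta> < n" using N n by simp
          then show ?thesis using \<delta>(1) n0 by (simp add: field_simps)
        qed
        define S where "S i j = \<sigma> (real i / n) (real j / n)" for i j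
        have fr: "real (Suc i) / real n - real i / real n = 1 / n" for i
          by (simp add: diff_divide_distrib[symmetric])
        have fr1: "0 \<le> real i / n" "real i / n \<le> 1" if "i \<le> n" for i
          using that n0 by (auto simp: field_simps)
        define h where "h i j = \<psi> (inv (S i j) \<otimes> S (Suc i) j)" for i j
        define v where "v i j = \<psi> (inv (S i j) \<otimes> S i (Suc j))" for i j
        have H: "inv (S i j) \<otimes> S (Suc i) j \<in> nbhd \<delta>" "size (inv (S i j) \<otimes> S (Suc i) j) \<le> Q / n" if "i < n" "j \<le> n" for i j
        proof -
          show 1: "size (inv (S i j) \<otimes> S (Suc i) j) \<le> Q / n"
            unfolding S_def using edge(1)[OF fr1[of i] fr1[of "Suc i"] fr1[of j]] that unfolding fr by simp
          show "inv (S i j) \<otimes> S (Suc i) j \<in> nbhd \<delta>"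
            using edge(2)[OF fr1[of i] fr1[of "Suc i"] fr1[of j]] that 1 small unfolding S_def nbhd_def by auto
        qed
        have V: "inv (S i j) \<otimes> S i (Suc j) \<in> nbhd \<delta>" "size (inv (S i j) \<otimes> S i (Suc j)) \<le> Q / n" if "i \<le> n" "j < n" for i j
        proof -
          show 1: "size (inv (S i j) \<otimes> S i (Suc j)) \<le> Q / n"
            unfolding S_def using edge'(1)[OF fr1[of i] fr1[of j] fr1[of "Suc j"]] that unfolding fr by simp
          show "inv (S i j) \<otimes> S i (Suc j) \<in> nbhd \<delta>"
            using edge'(2)[OF fr1[of i] fr1[of j] fr1[of "Suc j"]] that 1 small unfolding S_def nbhd_def by auto
        qed
        have sq: "cmod (h i j + v (Suc i) j - v i j - h i (Suc j)) \<le> 2 * \<epsilon> * (Q / n)\<^sup>2" if ij: "i < n" "j < n" for i j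
        proof -
          \<comment> \<open>The diagonal of the cell; each way around the cell factors it into two
            edges.\<close>
          define D where "D = \<psi> (inv (S i j) \<otimes> S (Suc i) (Suc j))"
          have bound: "cmod (\<psi> (c \<otimes> d) - \<psi> c - \<psi> d) \<le> \<epsilon> * (Q / n)\<^sup>2"
            if "c \<in> nbhd \<delta>" "d \<in> nbhd \<delta>" "size c \<le> Q / n" "size d \<le> Q / n" for c d
          proof -
            have "cmod (\<psi> (c \<otimes> d) - \<psi> c - \<psi> d) \<le> \<epsilon> * size c * size d" using \<delta>(2) that by blast
            also have "\<dots> \<le> \<epsilon> * (Q / n) * (Q / n)"
              using that e Q by (intro mult_mono) auto
            finally show ?thesis by (simp add: power2_eq_square)
          qed
          have 1: "cmod (D - h i j - v (Suc i) j) \<le> \<epsilon> * (Q / n)\<^sup>2"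
            using bound[of "inv (S i j) \<otimes> S (Suc i) j" "inv (S (Suc i) j) \<otimes> S (Suc i) (Suc j)"]
              H[of i j] V[of "Suc i" j] ij unfolding D_def h_def v_def by (simp add: m_assoc)
          have 2: "cmod (D - v i j - h i (Suc j)) \<le> \<epsilon> * (Q / n)\<^sup>2"
            using bound[of "inv (S i j) \<otimes> S i (Suc j)" "inv (S i (Suc j)) \<otimes> S (Suc i) (Suc j)"]
              H[of i "Suc j"] V[of i j] ij unfolding D_def h_def v_def by (simp add: m_assoc)
          have "h i j + v (Suc i) j - v i j - h i (Suc j) = (D - v i j - h i (Suc j)) - (D - h i j - v (Suc i) j)"
            by simp
          then have "cmod (h i j + v (Suc i) j - v i j - h i (Suc j)) \<le>
              cmod (D - v i j - h i (Suc j)) + cmod (D - h i j - v (Suc i) j)"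
            using norm_triangle_ineq4 by metis
          then show ?thesis using 1 2 by linarith
        qed
        have "(\<Sum>i<n. \<Sum>j<n. h i j + v (Suc i) j - v i j - h i (Suc j)) = I n"
        proof -
          \<comment> \<open>The sides of the square: \<open>t = 0\<close> collapses to the identity,
            \<open>s = 0\<close> and \<open>s = 1\<close> are the rays of \<open>x\<close> and
            \<open>x \<otimes> y\<close>, and \<open>t = 1\<close> is the ray of \<open>y\<close>
            translated by \<open>x\<close>.\<close>
          have e1: "(\<Sum>i<n. h i 0) = 0" unfolding h_def S_def \<sigma>_def by (simp add: \<psi>1)
          have e2: "(\<Sum>j<n. v n j) = path_sum \<psi> (ray (x \<otimes> y)) n"
            unfolding path_sum_def v_def S_def \<sigma>_def z_def using n0 y by (simp add: ray_1 nbhd_def)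
          have e3: "(\<Sum>j<n. v 0 j) = path_sum \<psi> (ray x) n"
            unfolding path_sum_def v_def S_def \<sigma>_def z_def by simp
          have S1: "S i n = x \<otimes> ray y (real i / n)" if "i \<le> n" for i
            unfolding S_def \<sigma>_def using n0 z[OF fr1[OF that]] by (simp add: ray_1 nbhd_def z_def)
          have e4: "(\<Sum>i<n. h i n) = path_sum \<psi> (ray y) n"
            unfolding path_sum_def h_def by (intro sum.cong refl) (simp add: S1 inv_mult_group m_assoc)
          show ?thesis unfolding grid_telescope e1 e2 e3 e4 I_def by simp
        qed
        then have "cmod (I n) \<le> (\<Sum>i<n. \<Sum>j<n. 2 * \<epsilon> * (Q / n)\<^sup>2)"
          using sq by (metis (no_types, lifting) lessThan_iff sum_norm_le)
        also have "\<dots> = 2 * \<epsilon> * Q\<^sup>2" using n0 by (simp add: power2_eq_square)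
        also have "\<dots> < r" unfolding \<epsilon>_def using Q r by (simp add: field_simps)
        finally show ?thesis .
      qed
      then show "\<exists>no. \<forall>n\<ge>no. norm (I n - 0) < r" by auto
    qed
    then have "(\<lambda>k. I (2 ^ k)) \<longlonglongrightarrow> 0"
      by (rule LIMSEQ_subseq_LIMSEQ[unfolded o_def]) (simp add: strict_mono_def)
    moreover have "(\<lambda>k. I (2 ^ k)) \<longlonglongrightarrow> \<phi> (x \<otimes> y) - \<phi> x - \<phi> y"
      unfolding I_def a_def[symmetric]
    proof (intro tendsto_diff conv(1))
      show "x \<otimes> y \<in> nbhd \<rho>1" using z[of 1] y by (simp add: z_def ray_1 nbhd_def)
    qed (use x y nbhd_mono[OF \<rho>(2)] in auto)
    ultimately have "\<phi> (x \<otimes> y) - \<phi> x - \<phi> y = 0" using LIMSEQ_unique by blast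
    then show ?thesis by (simp add: algebra_simps)
  qed
  obtain K where K: "K > 0" "\<And>u v. norm (\<beta> u v) \<le> norm u * norm v * K"
    using bounded_bilinear.pos_bounded[OF bilinear_\<beta>] by blast
  obtain Kf where Kf: "Kf > 0" "\<And>x. norm (f x) \<le> norm x * Kf" using f.pos_bounded by blast
  have "cmod (\<phi> x - f (\<kappa> x)) \<le> (2 + K * Kf) * (size x)\<^sup>2" if x: "x \<in> nbhd \<rho>" for x
  proof -
    have "cmod (f (\<beta> (\<kappa> x) (\<kappa> x))) \<le> norm (\<beta> (\<kappa> x) (\<kappa> x)) * Kf" by (rule Kf)
    also have "\<dots> \<le> (size x * size x * K) * Kf" using Kf K by (intro mult_right_mono) auto
    also have "\<dots> = K * Kf * (size x)\<^sup>2" by (simp add: power2_eq_square)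
    finally have "cmod (f (\<beta> (\<kappa> x) (\<kappa> x))) \<le> K * Kf * (size x)\<^sup>2" .
    moreover have "cmod (\<psi> x - f (\<kappa> x)) = cmod (f (\<beta> (\<kappa> x) (\<kappa> x))) / 2"
      unfolding \<psi>_def by (simp add: norm_divide)
    ultimately have "cmod (\<psi> x - f (\<kappa> x)) \<le> K * Kf * (size x)\<^sup>2"
      using norm_ge_zero[of "f (\<beta> (\<kappa> x) (\<kappa> x))"] by linarith
    moreover have "cmod (\<phi> x - \<psi> x) \<le> 2 * (size x)\<^sup>2" using conv(2) x nbhd_mono[OF \<rho>(2)] by blast
    ultimately show ?thesis
      using norm_triangle_ineq[of "\<phi> x - \<psi> x" "\<psi> x - f (\<kappa> x)"] by (simp add: algebra_simps)
  qed
  with hom \<rho>(1) show ?thesis by blast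
qed

end

section \<open>Extension of local homomorphisms\<close>

text \<open>Substitute for uniform continuity, as \<open>'b\<close> carries no metric: on the
  compact set of points that \<open>g\<close> sends outside \<open>V\<close>, the function
  \<open>d\<close> is positive and so bounded away from 0.\<close>

lemma compact_fiber_nbhd:
  fixes g :: "'a::t2_space \<Rightarrow> 'b::topological_space" and d :: "'a \<Rightarrow> real"
  assumes D: "compact D" and g: "continuous_on D g" and d: "continuous_on D d" "\<And>z. z \<in> D \<Longrightarrow> 0 \<le> d z"
    and V: "open V" "\<And>z. z \<in> D \<Longrightarrow> d z = 0 \<Longrightarrow> g z \<in> V"
  shows "\<exists>e>0. \<forall>z\<in>D. d z < e \<longrightarrow> g z \<in> V"
proof -
  define K where "K = g -` (- V) \<inter> D"
  have "closed K"
    unfolding K_def using continuous_on_closed_vimage[OF compact_imp_closed[OF D], of g] g V(1) by blast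
  then have K: "compact K" using compact_Int_closed[OF D \<open>closed K\<close>] by (simp add: K_def Int_absorb1)
  show ?thesis
  proof (cases "K = {}")
    case True then show ?thesis by (intro exI[of _ 1]) (auto simp: K_def)
  next
    case False
    have "continuous_on K d" using d(1) by (rule continuous_on_subset) (auto simp: K_def)
    then obtain z where z: "z \<in> K" "\<forall>y\<in>K. d z \<le> d y" using continuous_attains_inf[OF K False] by blast
    have "d z > 0" using z(1) d(2)[of z] V(2)[of z] by (force simp: K_def)
    then show ?thesis using z(2) by (intro exI[of _ "d z"]) (force simp: K_def)
  qed
qed

lemma sum_lessThan_plus:
  fixes g :: "nat \<Rightarrow> 'a::comm_monoid_add"
  shows "(\<Sum>i<n + m. g i) = (\<Sum>i<n. g i) + (\<Sum>i<m. g (n + i))"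
  by (induction m) (simp_all add: add.assoc)

context chart_group
begin

text \<open>\<open>chain \<phi> V x c\<close>: the value \<open>c\<close> is obtained by adding up the local homomorphism \<open>\<phi>\<close> over some way of writing \<open>x\<close> as
  a product of elements of \<open>V\<close> and their inverses. Simple connectedness makes \<open>c\<close> unique.\<close>

inductive chain :: "('l \<Rightarrow> complex) \<Rightarrow> 'l set \<Rightarrow> 'l \<Rightarrow> complex \<Rightarrow> bool" for \<phi> V where
  chain_one: "chain \<phi> V \<one> 0"
| chain_mult: "chain \<phi> V x c \<Longrightarrow> u \<in> V \<Longrightarrow> chain \<phi> V (x \<otimes> u) (c + \<phi> u)"
| chain_mult_inv: "chain \<phi> V x c \<Longrightarrow> u \<in> V \<Longrightarrow> chain \<phi> V (x \<otimes> inv u) (c - \<phi> u)"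

text \<open>Together with \<open>chain_inv\<close> this says that the pairs \<open>(x, c)\<close>
  form a subgroup of the product of \<open>L\<close> with the complex numbers.\<close>

lemma chain_append:
  assumes "chain \<phi> V y d" "chain \<phi> V x c"
  shows "chain \<phi> V (x \<otimes> y) (c + d)"
  using assms
proof (induction rule: chain.induct)
  case chain_one then show ?case by simp
next
  case (chain_mult y d u)
  then have "chain \<phi> V (x \<otimes> y \<otimes> u) (c + d + \<phi> u)" by (intro chain.chain_mult) auto
  then show ?case by (simp add: m_assoc add.assoc)
next
  case (chain_mult_inv y d u)
  then have "chain \<phi> V (x \<otimes> y \<otimes> inv u) (c + d - \<phi> u)" by (intro chain.chain_mult_inv) auto
  then show ?case by (simp add: m_assoc algebra_simps)
qed

lemma chain_inv:
  assumes "chain \<phi> V x c"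
  shows "chain \<phi> V (inv x) (- c)"
  using assms
proof (induction rule: chain.induct)
  case chain_one then show ?case using chain.chain_one by simp
next
  case (chain_mult x c u)
  have "chain \<phi> V (\<one> \<otimes> inv u) (0 - \<phi> u)" using chain_mult(2) by (intro chain.intros)
  from chain_append[OF chain_mult(3) this] show ?case by (simp add: inv_mult_group algebra_simps)
next
  case (chain_mult_inv x c u)
  have "chain \<phi> V (\<one> \<otimes> u) (0 + \<phi> u)" using chain_mult_inv(2) by (intro chain.intros)
  from chain_append[OF chain_mult_inv(3) this] show ?case by (simp add: inv_mult_group algebra_simps)
qed

text \<open>With an even number of steps the junction at 1/2 is a grid point, so no step straddles
  both paths. Dyadic subdivisions retain this under repeated joining once they are fine
  enough.\<close>

lemma path_sum_join:
  assumes "pathfinish p = pathstart q" "n > 0"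
  shows "path_sum \<phi> (p +++ q) (2 * n) = path_sum \<phi> p n + path_sum \<phi> q n"
proof -
  have A: "(p +++ q) (real i / real (2 * n)) = p (real i / real n)" if "i \<le> n" for i
    using that assms(2) by (auto simp: joinpaths_def field_simps)
  have B: "(p +++ q) (real (n + i) / real (2 * n)) = q (real i / real n)" for i
  proof (cases "i = 0")
    case True
    then show ?thesis using A[of n] assms by (simp add: pathfinish_def pathstart_def)
  next
    case False
    then have "2 * (real (n + i) / real (2 * n)) - 1 = real i / real n" "\<not> real (n + i) / real (2 * n) \<le> 1/2"
      using assms(2) by (auto simp: field_simps)
    then show ?thesis unfolding joinpaths_def by simp
  qed
  have "path_sum \<phi> (p +++ q) (2 * n) =
      (\<Sum>i<n. \<phi> (inv ((p +++ q) (real i / real (2 * n))) \<otimes> (p +++ q) (real (Suc i) / real (2 * n)))) +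
      (\<Sum>i<n. \<phi> (inv ((p +++ q) (real (n + i) / real (2 * n))) \<otimes> (p +++ q) (real (n + Suc i) / real (2 * n))))"
    unfolding path_sum_def mult_2 sum_lessThan_plus by simp
  also have "\<dots> = path_sum \<phi> p n + path_sum \<phi> q n"
    unfolding path_sum_def B by (intro arg_cong2[of _ _ _ _ "(+)"] sum.cong refl) (simp add: A del: of_nat_Suc of_nat_mult)
  finally show ?thesis .
qed

text \<open>Each factor becomes a translated ray, on which the path sum telescopes to the exact
  value because \<open>\<phi>\<close> turns left quotients into differences. Every joining halves
  the parameter interval and so raises \<open>k0\<close> by one.\<close>

lemma chain_path:
  assumes "chain \<phi> V x c" "V \<subseteq> nbhd \<delta>" "\<delta> \<le> R" "\<phi> \<one> = 0"
    and diff: "\<And>a b. a \<in> nbhd \<delta> \<Longrightarrow> b \<in> nbhd \<delta> \<Longrightarrow> \<phi> (inv a \<otimes> b) = \<phi> b - \<phi> a"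
  shows "\<exists>p. path p \<and> pathstart p = \<one> \<and> pathfinish p = x \<and> (\<exists>k0. \<forall>k\<ge>k0. path_sum \<phi> p (2 ^ k) = c)"
  using assms(1)
proof (induction rule: chain.induct)
  case chain_one
  have "path (\<lambda>t::real. \<one>)" by (simp add: path_def)
  then show ?case
    by (intro exI[of _ "\<lambda>t. \<one>"]) (auto simp: pathstart_def pathfinish_def path_sum_def assms(4))
next
  case (chain_mult x c u)
  then obtain p k0 where p: "path p" "pathstart p = \<one>" "pathfinish p = x" "\<forall>k\<ge>k0. path_sum \<phi> p (2 ^ k) = c" by blast
  have u: "u \<in> nbhd \<delta>" "u \<in> U" using chain_mult(2) assms(2) by (auto simp: nbhd_def)
  define q where "q t = x \<otimes> ray u t" for t
  have q: "path q" "pathstart q = x" "pathfinish q = x \<otimes> u"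
    using ray_continuous[of u] u nbhd_mono[OF assms(3)]
    by (auto simp: path_def q_def pathstart_def pathfinish_def ray_1 intro!: continuous_on_mult continuous_intros)
  have qs: "path_sum \<phi> q n = \<phi> u" if "n > 0" for n
  proof -
    have "path_sum \<phi> q n = (\<Sum>i<n. \<phi> (ray u (real (Suc i) / n)) - \<phi> (ray u (real i / n)))"
      unfolding path_sum_def q_def
    proof (rule sum.cong)
      fix i assume "i \<in> {..<n}"
      then have "ray u (real i / n) \<in> nbhd \<delta>" "ray u (real (Suc i) / n) \<in> nbhd \<delta>"
        by (auto intro!: ray(1)[OF u(1) assms(3)] simp: field_simps)
      from diff[OF this] show "\<phi> (inv (x \<otimes> ray u (real i / real n)) \<otimes> (x \<otimes> ray u (real (Suc i) / real n))) =
         \<phi> (ray u (real (Suc i) / real n)) - \<phi> (ray u (real i / real n))"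
        by (simp add: inv_mult_group m_assoc)
    qed simp
    also have "\<dots> = \<phi> u" using sum_lessThan_telescope[of "\<lambda>i. \<phi> (ray u (real i / n))" n] that u(2)
      by (simp add: ray_1 assms(4))
    finally show ?thesis .
  qed
  show ?case
  proof (intro exI conjI allI impI)
    show "path (p +++ q)" using p q by (intro path_join_imp) auto
    show "pathstart (p +++ q) = \<one>" "pathfinish (p +++ q) = x \<otimes> u" using p q by auto
    fix k assume "k \<ge> Suc k0"
    then obtain k' where k': "k = Suc k'" "k' \<ge> k0" by (metis Suc_le_D Suc_le_mono)
    show "path_sum \<phi> (p +++ q) (2 ^ k) = c + \<phi> u"
      unfolding k'(1) power_Suc using path_sum_join[of p q "2 ^ k'"] p q k' qs by simp
  qed
next
  case (chain_mult_inv x c u)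
  then obtain p k0 where p: "path p" "pathstart p = \<one>" "pathfinish p = x" "\<forall>k\<ge>k0. path_sum \<phi> p (2 ^ k) = c" by blast
  have u: "u \<in> nbhd \<delta>" "u \<in> U" using chain_mult_inv(2) assms(2) by (auto simp: nbhd_def)
  \<comment> \<open>For an inverse factor the ray is run backwards; the curve starts at
    \<open>x\<close> because \<open>ray u 1 = u\<close>.\<close>
  define q where "q t = x \<otimes> inv u \<otimes> ray u (1 - t)" for t
  have cr: "continuous_on {0..1} (\<lambda>t. ray u (1 - t))"
    by (rule continuous_on_compose2[OF ray_continuous[of u]])
      (use u nbhd_mono[OF assms(3)] in \<open>auto intro!: continuous_intros\<close>)
  have q: "path q" "pathstart q = x" "pathfinish q = x \<otimes> inv u"
    using u by (auto simp: path_def q_def pathstart_def pathfinish_def ray_1 m_assoc intro!: continuous_on_mult continuous_intros cr)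
  have qs: "path_sum \<phi> q n = - \<phi> u" if "n > 0" for n
  proof -
    have "path_sum \<phi> q n = (\<Sum>i<n. \<phi> (ray u (1 - real (Suc i) / n)) - \<phi> (ray u (1 - real i / n)))"
      unfolding path_sum_def q_def
    proof (rule sum.cong)
      fix i assume "i \<in> {..<n}"
      then have "ray u (1 - real i / n) \<in> nbhd \<delta>" "ray u (1 - real (Suc i) / n) \<in> nbhd \<delta>"
        by (auto intro!: ray(1)[OF u(1) assms(3)] simp: field_simps)
      from diff[OF this] show "\<phi> (inv (x \<otimes> inv u \<otimes> ray u (1 - real i / real n)) \<otimes> (x \<otimes> inv u \<otimes> ray u (1 - real (Suc i) / real n))) =
         \<phi> (ray u (1 - real (Suc i) / real n)) - \<phi> (ray u (1 - real i / real n))"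
        by (simp add: inv_mult_group m_assoc)
    qed simp
    also have "\<dots> = - \<phi> u" using sum_lessThan_telescope[of "\<lambda>i. \<phi> (ray u (1 - real i / n))" n] that u(2)
      by (simp add: ray_1 assms(4))
    finally show ?thesis .
  qed
  show ?case
  proof (intro exI conjI allI impI)
    show "path (p +++ q)" using p q by (intro path_join_imp) auto
    show "pathstart (p +++ q) = \<one>" "pathfinish (p +++ q) = x \<otimes> inv u" using p q by auto
    fix k assume "k \<ge> Suc k0"
    then obtain k' where k': "k = Suc k'" "k' \<ge> k0" by (metis Suc_le_D Suc_le_mono)
    show "path_sum \<phi> (p +++ q) (2 ^ k) = c - \<phi> u"
      unfolding k'(1) power_Suc using path_sum_join[of p q "2 ^ k'"] p q k' qs by simp
  qed
qed

text \<open>Monodromy: the path of the chain is a loop that a free homotopy contracts. For one fixed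
  fine subdivision the path sum stays constant along the homotopy, and it is 0 for the constant
  loop.\<close>

lemma closed_chain_zero:
  assumes sc: "simply_connected (UNIV :: 'l set)" and c: "chain \<phi> (nbhd \<delta>) \<one> c"
    and \<delta>: "0 < \<delta>" "\<delta> \<le> R"
    and diff: "\<And>a b. a \<in> nbhd \<delta> \<Longrightarrow> b \<in> nbhd \<delta> \<Longrightarrow> \<phi> (inv a \<otimes> b) = \<phi> b - \<phi> a"
    and tri: "\<And>a b d. a \<in> nbhd \<delta> \<Longrightarrow> b \<in> nbhd \<delta> \<Longrightarrow> d \<in> nbhd \<delta> \<Longrightarrow> \<phi> (inv a \<otimes> b \<otimes> d) = \<phi> b - \<phi> a + \<phi> d"
  shows "c = 0"
proof -
  have \<phi>1: "\<phi> \<one> = 0" using diff[of \<one> \<one>] one_nbhd[OF \<delta>(1)] by simp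
  obtain p k0 where p: "path p" "pathstart p = \<one>" "pathfinish p = \<one>" "\<forall>k\<ge>k0. path_sum \<phi> p (2 ^ k) = c"
    using chain_path[OF c subset_refl \<delta>(2) \<phi>1 diff] by blast
  have "path (\<lambda>t::real. \<one>)" "pathfinish (\<lambda>t::real. \<one>) = pathstart (\<lambda>t::real. \<one>)"
    by (simp_all add: path_def pathstart_def pathfinish_def)
  then have "homotopic_loops UNIV p (\<lambda>t. \<one>)"
    using sc p unfolding simply_connected_def by simp
  then obtain h where h: "continuous_on ({0..1::real} \<times> {0..1::real}) h"
      "\<forall>x\<in>{0..1}. h (0, x) = p x" "\<forall>x\<in>{0..1}. h (1, x) = \<one>"
      "\<forall>t\<in>{0..1}. pathfinish (h \<circ> Pair t) = pathstart (h \<circ> Pair t)"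
    unfolding homotopic_loops by blast
  have loop: "h (s, 1) = h (s, 0)" if "s \<in> {0..1}" for s
    using h(4) that by (simp add: pathfinish_def pathstart_def)
  \<comment> \<open>One cube serves both directions: its first coordinate is the common parameter,
    the other two are the nearby values to be compared.\<close>
  define D where "D = {0..1::real} \<times> {0..1::real} \<times> {0..1::real}"
  have D: "compact D" unfolding D_def by (intro compact_Times compact_Icc)
  have ch: "continuous_on D (\<lambda>z. h (a z, b z))" if "continuous_on D a" "continuous_on D b" "\<And>z. z \<in> D \<Longrightarrow> a z \<in> {0..1} \<and> b z \<in> {0..1}" for a b
    by (rule continuous_on_compose2[OF h(1)]) (use that in \<open>auto intro!: continuous_intros\<close>)
  have "\<exists>e>0. \<forall>z\<in>D. \<bar>fst (snd z) - snd (snd z)\<bar> < e \<longrightarrow> inv (h (fst z, fst (snd z))) \<otimes> h (fst z, snd (snd z)) \<in> nbhd \<delta>"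
  proof (rule compact_fiber_nbhd[OF D])
    show "continuous_on D (\<lambda>z. inv (h (fst z, fst (snd z))) \<otimes> h (fst z, snd (snd z)))"
      by (intro continuous_on_mult continuous_on_inv ch continuous_intros) (auto simp: D_def)
  qed (auto intro!: continuous_intros open_nbhd one_nbhd[OF \<delta>(1)])
  then obtain e1 where e1: "e1 > 0" "\<And>s t t'. s \<in> {0..1} \<Longrightarrow> t \<in> {0..1} \<Longrightarrow> t' \<in> {0..1} \<Longrightarrow> \<bar>t - t'\<bar> < e1 \<Longrightarrow>
      inv (h (s, t)) \<otimes> h (s, t') \<in> nbhd \<delta>"
    unfolding D_def by fastforce
  have "\<exists>e>0. \<forall>z\<in>D. \<bar>fst (snd z) - snd (snd z)\<bar> < e \<longrightarrow> inv (h (fst (snd z), fst z)) \<otimes> h (snd (snd z), fst z) \<in> nbhd \<delta>"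
  proof (rule compact_fiber_nbhd[OF D])
    show "continuous_on D (\<lambda>z. inv (h (fst (snd z), fst z)) \<otimes> h (snd (snd z), fst z))"
      by (intro continuous_on_mult continuous_on_inv ch continuous_intros) (auto simp: D_def)
  qed (auto intro!: continuous_intros open_nbhd one_nbhd[OF \<delta>(1)])
  then obtain e2 where e2: "e2 > 0" "\<And>s s' t. s \<in> {0..1} \<Longrightarrow> s' \<in> {0..1} \<Longrightarrow> t \<in> {0..1} \<Longrightarrow> \<bar>s - s'\<bar> < e2 \<Longrightarrow>
      inv (h (s, t)) \<otimes> h (s', t) \<in> nbhd \<delta>"
    unfolding D_def by fastforce
  have "(\<lambda>k. (1/2) ^ k :: real) \<longlonglongrightarrow> 0" by (intro LIMSEQ_power_zero) simp
  then obtain k1 where k1: "\<forall>k\<ge>k1. (1/2) ^ k < e1" using LIMSEQ_D[of _ 0 e1] e1(1) by fastforce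
  \<comment> \<open>Beyond \<open>k0\<close> the sum over \<open>p\<close> is exactly
    \<open>c\<close>; beyond \<open>k1\<close> consecutive grid points are closer than
    \<open>e1\<close>.\<close>
  define n :: nat where "n = 2 ^ max k0 k1"
  have n: "n > 0" "1 / real n < e1" "path_sum \<phi> p n = c"
    using k1[rule_format, of "max k0 k1"] p(4) unfolding n_def by (auto simp: power_divide)
  define I where "I s = path_sum \<phi> (\<lambda>t. h (s, t)) n" for s
  have fr: "real i / n \<in> {0..1}" if "i \<le> n" for i using that n by (auto simp: field_simps)
  have loc: "I s' = I s" if s: "s \<in> {0..1}" "s' \<in> {0..1}" "\<bar>s - s'\<bar> < e2" for s s'
  proof -
    \<comment> \<open>The steps at \<open>s'\<close> are
      \<open>inv (d i) \<otimes> w \<otimes> d (Suc i)\<close> with \<open>w\<close> the step at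
      \<open>s\<close>, so the change of the sum telescopes to
      \<open>\<phi> (d n) - \<phi> (d 0)\<close>, which is 0 as both curves are loops.\<close>
    define d where "d i = inv (h (s, real i / n)) \<otimes> h (s', real i / n)" for i
    have d: "d i \<in> nbhd \<delta>" if "i \<le> n" for i unfolding d_def by (rule e2(2)[OF s(1,2) fr[OF that] s(3)])
    have "I s' = (\<Sum>i<n. \<phi> (inv (h (s, real i / n)) \<otimes> h (s, real (Suc i) / n)) + (\<phi> (d (Suc i)) - \<phi> (d i)))"
      unfolding I_def path_sum_def
    proof (rule sum.cong)
      fix i assume "i \<in> {..<n}"
      then have i: "i \<le> n" "Suc i \<le> n" by auto
      define w where "w = inv (h (s, real i / n)) \<otimes> h (s, real (Suc i) / n)"
      have "real i / n - real (Suc i) / n = - (1 / n)" by (simp add: diff_divide_distrib[symmetric])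
      then have "\<bar>real i / n - real (Suc i) / n\<bar> < e1" using n by simp
      then have w: "w \<in> nbhd \<delta>" unfolding w_def by (intro e1(2) s fr i)
      have "inv (d i) \<otimes> w \<otimes> d (Suc i) = inv (h (s', real i / n)) \<otimes> h (s', real (Suc i) / n)"
        unfolding d_def w_def by (simp add: inv_mult_group m_assoc)
      then show "\<phi> (inv h (s', real i / real n) \<otimes> h (s', real (Suc i) / real n)) =
         \<phi> (inv h (s, real i / real n) \<otimes> h (s, real (Suc i) / real n)) + (\<phi> (d (Suc i)) - \<phi> (d i))"
        using tri[OF d[OF i(1)] w d[OF i(2)]] unfolding w_def by simp
    qed simp
    also have "\<dots> = I s + (\<phi> (d n) - \<phi> (d 0))"
      unfolding sum.distrib sum_lessThan_telescope[of "\<lambda>i. \<phi> (d i)"]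
      by (simp add: I_def path_sum_def)
    also have "d n = d 0" unfolding d_def using n(1) loop s by simp
    finally show ?thesis by simp
  qed
  obtain M :: nat where M: "1 / e2 < real M" using reals_Archimedean2 by blast
  then have M0: "M > 0" using e2(1) by (metis divide_pos_pos gr0I less_le_trans less_asym of_nat_0 zero_less_one)
  have M1: "1 / real M < e2" using M M0 e2(1) by (simp add: field_simps)
  have "I (real j / M) = I 0" if "j \<le> M" for j
    using that
  proof (induction j)
    case (Suc j)
    have "real j / M - real (Suc j) / M = - (1 / M)" by (simp add: diff_divide_distrib[symmetric])
    then have "I (real (Suc j) / M) = I (real j / M)"
      using Suc M0 M1 by (intro loc) (auto simp: field_simps)
    then show ?case using Suc by simp
  qed simp
  from this[of M] have "I 1 = I 0" using M0 by simp
  moreover have "I 0 = path_sum \<phi> p n"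
    unfolding I_def path_sum_def
  proof (rule sum.cong)
    fix i assume "i \<in> {..<n}"
    then show "\<phi> (inv h (0, real i / real n) \<otimes> h (0, real (Suc i) / real n)) =
         \<phi> (inv p (real i / real n) \<otimes> p (real (Suc i) / real n))"
      using h(2) fr[of i] fr[of "Suc i"] by simp
  qed simp
  moreover have "I 1 = 0"
    unfolding I_def path_sum_def
  proof (rule sum.neutral, rule ballI)
    fix i assume "i \<in> {..<n}"
    then show "\<phi> (inv h (1, real i / real n) \<otimes> h (1, real (Suc i) / real n)) = 0"
      using h(3) fr[of i] fr[of "Suc i"] \<phi>1 by simp
  qed
  ultimately show ?thesis using n(3) by simp
qed

text \<open>\<open>closed_chain_zero\<close> makes the value of a chain depend on its end only,
  connectedness provides a chain to every element, and appending chains gives additivity.\<close>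

lemma local_homomorphism_extends:
  assumes conn: "connected (UNIV :: 'l set)" and sc: "simply_connected (UNIV :: 'l set)"
    and \<rho>: "\<rho> > 0" and \<phi>: "\<And>x y. x \<in> nbhd \<rho> \<Longrightarrow> y \<in> nbhd \<rho> \<Longrightarrow> \<phi> (x \<otimes> y) = (\<phi> x + \<phi> y :: complex)"
  shows "\<exists>l \<delta>. \<delta> > 0 \<and> (\<forall>x y. l (x \<otimes> y) = l x + l y) \<and> (\<forall>x\<in>nbhd \<delta>. l x = \<phi> x)"
proof -
  have "continuous_on UNIV (\<lambda>(x, y). inv x \<otimes> y)"
    unfolding case_prod_unfold by (intro continuous_on_mult continuous_on_inv continuous_intros)
  then obtain \<delta>0 where \<delta>0: "\<delta>0 > 0" "\<delta>0 \<le> R" "\<forall>x\<in>nbhd \<delta>0. \<forall>y\<in>nbhd \<delta>0. inv x \<otimes> y \<in> nbhd \<rho>"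
    using nbhd_base2[of "\<lambda>x y. inv x \<otimes> y" \<rho>] \<rho> by auto
  define \<delta> where "\<delta> = min \<delta>0 \<rho>"
  have \<delta>: "\<delta> > 0" "\<delta> \<le> R" "\<delta> \<le> \<rho>" "\<delta> \<le> \<delta>0" unfolding \<delta>_def using \<delta>0 \<rho> by auto
  note sub = subsetD[OF nbhd_mono[OF \<delta>(3)]] subsetD[OF nbhd_mono[OF \<delta>(4)]]
  have diff: "\<phi> (inv a \<otimes> b) = \<phi> b - \<phi> a" if "a \<in> nbhd \<delta>" "b \<in> nbhd \<delta>" for a b
    using \<phi>[of a "inv a \<otimes> b"] \<delta>0(3) that sub by (simp add: algebra_simps)
  have tri: "\<phi> (inv a \<otimes> b \<otimes> d) = \<phi> b - \<phi> a + \<phi> d" if "a \<in> nbhd \<delta>" "b \<in> nbhd \<delta>" "d \<in> nbhd \<delta>" for a b d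
    using \<phi>[of "inv a \<otimes> b" d] diff[OF that(1,2)] \<delta>0(3) that sub by auto
  let ?ch = "chain \<phi> (nbhd \<delta>)"
  have uniq: "c = d" if "?ch x c" "?ch x d" for x c d
    using closed_chain_zero[OF sc _ \<delta>(1,2) diff tri, of "c + - d"] chain_append[OF chain_inv[OF that(2)] that(1)] by simp
  have single: "?ch u (\<phi> u)" if "u \<in> nbhd \<delta>" for u
    using chain_mult[OF chain_one that] by simp
  have "{x. \<exists>c. ?ch x c} = UNIV"
  proof (rule open_subgroup_UNIV[OF conn _ _ _ \<delta>(1)])
    show "\<one> \<in> {x. \<exists>c. ?ch x c}" using chain_one by blast
    show "nbhd \<delta> \<subseteq> {x. \<exists>c. ?ch x c}" using single by blast
  qed (auto intro: chain_append chain_inv)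
  then have ex: "\<exists>c. ?ch x c" for x by blast
  define l where "l x = (SOME c. ?ch x c)" for x
  have l: "?ch x (l x)" for x unfolding l_def using someI_ex[OF ex] .
  have "l (x \<otimes> y) = l x + l y" for x y using uniq[OF l chain_append[OF l l]] .
  moreover have "l x = \<phi> x" if "x \<in> nbhd \<delta>" for x using uniq[OF l single[OF that]] .
  ultimately show ?thesis using \<delta>(1) by blast
qed

end

section \<open>Brackets and characters\<close>

context chart_group
begin

text \<open>The Lie bracket of the tangent space at the identity, read off the chart; the symmetric
  part of \<open>\<beta>\<close> depends on the choice of chart.\<close>

definition bracket :: "'e \<Rightarrow> 'e \<Rightarrow> 'e" where "bracket u v = \<beta> u v - \<beta> v u"

lemma bounded_bilinear_bracket: "bounded_bilinear bracket"
proof -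
  interpret \<beta>: bounded_bilinear \<beta> by (rule bilinear_\<beta>)
  obtain K where K: "\<And>u v. norm (\<beta> u v) \<le> norm u * norm v * K" using \<beta>.bounded by blast
  show ?thesis
  proof
    have "norm (bracket a b) \<le> norm a * norm b * (2 * K)" for a b
      using norm_triangle_ineq4[of "\<beta> a b" "\<beta> b a"] K[of a b] K[of b a]
      unfolding bracket_def by (simp add: algebra_simps)
    then show "\<exists>K. \<forall>a b. norm (bracket a b) \<le> norm a * norm b * K" by blast
  qed (simp_all add: bracket_def \<beta>.add_left \<beta>.add_right \<beta>.scaleR_left \<beta>.scaleR_right algebra_simps)
qed

lemma bracket_swap: "bracket v u = - bracket u v" by (simp add: bracket_def)

definition comm :: "'l \<Rightarrow> 'l \<Rightarrow> 'l" where "comm x y = x \<otimes> y \<otimes> inv x \<otimes> inv y"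

text \<open>Inverses need no expansion: from
  \<open>comm x y \<otimes> (y \<otimes> x) = x \<otimes> y\<close> the coordinates of the
  commutator are \<open>\<kappa> (x \<otimes> y) - \<kappa> (y \<otimes> x)\<close> up to higher
  order, and there the symmetric part of \<open>\<beta>\<close> drops out.\<close>

lemma comm_expansion:
  assumes e: "\<epsilon> > 0"
  shows "\<exists>\<delta>>0. \<forall>x\<in>nbhd \<delta>. \<forall>y\<in>nbhd \<delta>. comm x y \<in> U \<and>
    norm (\<kappa> (comm x y) - bracket (\<kappa> x) (\<kappa> y)) \<le> \<epsilon> * size x * size y"
proof -
  obtain Kb where Kb: "Kb > 0" "\<And>u v. norm (bracket u v) \<le> norm u * norm v * Kb"
    using bounded_bilinear.pos_bounded[OF bounded_bilinear_bracket] by blast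
  define e1 where "e1 = \<epsilon> / 4"
  have e1: "e1 > 0" unfolding e1_def using e by simp
  obtain d1 where d1: "d1 > 0" "\<forall>x\<in>U. \<forall>y\<in>U. size x < d1 \<longrightarrow> size y < d1 \<longrightarrow>
      norm (\<kappa> (x \<otimes> y) - \<kappa> x - \<kappa> y - \<beta> (\<kappa> x) (\<kappa> y)) \<le> e1 * size x * size y"
    using expansion[OF e1(1)] by blast
  have "continuous_on UNIV (\<lambda>(x, y). comm x y)"
    unfolding case_prod_unfold comm_def by (intro continuous_on_mult continuous_on_inv continuous_intros)
  then obtain d2 where d2: "d2 > 0" "\<forall>x\<in>nbhd d2. \<forall>y\<in>nbhd d2. comm x y \<in> nbhd R"
    using nbhd_base2[of comm, OF _ _ R_pos] by (auto simp: comm_def)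
  have "continuous_on UNIV (\<lambda>(x, y). y \<otimes> x)"
    unfolding case_prod_unfold by (intro continuous_on_mult continuous_intros)
  then obtain d3 where d3: "d3 > 0" "d3 \<le> R" "\<forall>x\<in>nbhd d3. \<forall>y\<in>nbhd d3. y \<otimes> x \<in> nbhd R"
    using nbhd_base2[of "\<lambda>x y. y \<otimes> x", OF _ _ R_pos] by auto
  define M where "M = Kb + 2 * e1"
  have M: "M > 0" unfolding M_def using Kb e1 by simp
  \<comment> \<open>The last bound absorbs the error
    \<open>C * size c * size (y \<otimes> x)\<close>, where
    \<open>size c \<le> 2 * (M * (size x * size y))\<close> and
    \<open>size (y \<otimes> x) \<le> 3 * \<delta>\<close>.\<close>
  define \<delta> where "\<delta> = min (min d1 d2) (min d3 (\<epsilon> / (12 * (C + 1) * M)))"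
  have \<delta>: "\<delta> > 0" "\<delta> \<le> d1" "\<delta> \<le> d2" "\<delta> \<le> d3" "\<delta> \<le> R" unfolding \<delta>_def using d1 d2 d3 e M C_nonneg by auto
  have \<delta>': "C * (6 * M * \<delta>) \<le> \<epsilon> / 2"
  proof -
    have "\<delta> \<le> \<epsilon> / (12 * (C + 1) * M)" unfolding \<delta>_def by simp
    moreover have P: "0 < 12 * (C + 1) * M" using C_nonneg M by simp
    ultimately have "\<delta> * (12 * (C + 1) * M) \<le> \<epsilon>" using pos_le_divide_eq[OF P] by blast
    moreover have "0 \<le> \<delta> * M" using \<delta> M by simp
    ultimately show ?thesis by (simp add: algebra_simps)
  qed
  have "comm x y \<in> U \<and> norm (\<kappa> (comm x y) - bracket (\<kappa> x) (\<kappa> y)) \<le> \<epsilon> * size x * size y"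
    if x: "x \<in> nbhd \<delta>" and y: "y \<in> nbhd \<delta>" for x y
  proof
    define c where "c = comm x y"
    have c: "c \<in> nbhd R" using d2(2) x y \<delta> unfolding c_def by (auto simp: nbhd_def)
    then show "comm x y \<in> U" by (simp add: nbhd_def c_def)
    have yx: "y \<otimes> x \<in> nbhd R" using d3(3) x y \<delta> by (auto simp: nbhd_def)
    have cyx: "c \<otimes> (y \<otimes> x) = x \<otimes> y" unfolding c_def comm_def by (simp add: m_assoc)
    define D where "D = \<kappa> (x \<otimes> y) - \<kappa> (y \<otimes> x)"
    have "norm (\<kappa> (x \<otimes> y) - \<kappa> x - \<kappa> y - \<beta> (\<kappa> x) (\<kappa> y)) \<le> e1 * size x * size y"
      "norm (\<kappa> (y \<otimes> x) - \<kappa> y - \<kappa> x - \<beta> (\<kappa> y) (\<kappa> x)) \<le> e1 * size y * size x"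
      using d1(2) x y \<delta> by (auto simp: nbhd_def)
    moreover have "D - bracket (\<kappa> x) (\<kappa> y) = (\<kappa> (x \<otimes> y) - \<kappa> x - \<kappa> y - \<beta> (\<kappa> x) (\<kappa> y)) -
        (\<kappa> (y \<otimes> x) - \<kappa> y - \<kappa> x - \<beta> (\<kappa> y) (\<kappa> x))"
      unfolding D_def bracket_def by simp
    ultimately have D1: "norm (D - bracket (\<kappa> x) (\<kappa> y)) \<le> 2 * e1 * (size x * size y)"
      using norm_triangle_ineq4[of "\<kappa> (x \<otimes> y) - \<kappa> x - \<kappa> y - \<beta> (\<kappa> x) (\<kappa> y)" "\<kappa> (y \<otimes> x) - \<kappa> y - \<kappa> x - \<beta> (\<kappa> y) (\<kappa> x)"]
      by (simp add: mult_ac)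
    have D2: "norm D \<le> M * (size x * size y)"
      using norm_triangle_sub[of D "bracket (\<kappa> x) (\<kappa> y)"] D1 Kb(2)[of "\<kappa> x" "\<kappa> y"]
      unfolding M_def by (simp add: algebra_simps)
    have qc: "norm (D - \<kappa> c) \<le> size c / 4" "norm (D - \<kappa> c) \<le> C * size c * size (y \<otimes> x)"
      using quasi_quarter(2)[OF c yx] quasi[of c "y \<otimes> x"] c yx unfolding cyx D_def
      by (simp_all add: nbhd_def algebra_simps)
    have c2: "size c \<le> 2 * norm D"
      using qc(1) norm_triangle_sub[of "\<kappa> c" D] norm_minus_commute[of D "\<kappa> c"] norm_ge_zero[of "\<kappa> c"] by linarith
    have "size (y \<otimes> x) \<le> 3 * \<delta>"
      using mult_diff(3)[of y x] x y nbhd_mono[OF \<delta>(5)] by (fastforce simp: nbhd_def)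
    then have "C * size c * size (y \<otimes> x) \<le> C * (2 * (M * (size x * size y))) * (3 * \<delta>)"
      using c2 D2 C_nonneg M by (intro mult_mono mult_left_mono) auto
    also have "\<dots> = (C * (6 * M * \<delta>)) * (size x * size y)" by simp
    also have "\<dots> \<le> \<epsilon> / 2 * (size x * size y)" by (intro mult_right_mono \<delta>') auto
    finally have "norm (\<kappa> c - D) \<le> \<epsilon> / 2 * (size x * size y)"
      using qc(2) by (simp add: norm_minus_commute)
    moreover have "norm (D - bracket (\<kappa> x) (\<kappa> y)) \<le> \<epsilon> / 2 * (size x * size y)"
      using D1 unfolding e1_def by simp
    ultimately have "norm ((\<kappa> c - D) + (D - bracket (\<kappa> x) (\<kappa> y))) \<le> \<epsilon> * (size x * size y)"
      using norm_triangle_ineq[of "\<kappa> c - D" "D - bracket (\<kappa> x) (\<kappa> y)"] by linarith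
    then show "norm (\<kappa> (comm x y) - bracket (\<kappa> x) (\<kappa> y)) \<le> \<epsilon> * size x * size y"
      unfolding c_def by (simp add: mult.assoc)
  qed
  then show ?thesis using \<delta>(1) by blast
qed

text \<open>\<open>jet m x u\<close>: the curve \<open>x\<close> has coordinates \<open>t\<^sup>m u + o(t\<^sup>m)\<close> as \<open>t\<close> tends to \<open>0\<close> from the right.\<close>

definition jet :: "nat \<Rightarrow> (real \<Rightarrow> 'l) \<Rightarrow> 'e \<Rightarrow> bool" where
  "jet m x u \<longleftrightarrow> (\<forall>\<^sub>F t in at_right 0. x t \<in> U) \<and> ((\<lambda>t. (1 / t ^ m) *\<^sub>R \<kappa> (x t)) \<longlongrightarrow> u) (at_right 0)"

lemma jet_small:
  assumes "jet m x u" "m > 0" "\<delta> > 0"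
  shows "\<forall>\<^sub>F t in at_right 0. x t \<in> nbhd \<delta>"
proof -
  have "((\<lambda>t::real. t ^ m) \<longlongrightarrow> 0 ^ m) (at_right 0)" by (intro tendsto_intros)
  then have "((\<lambda>t. t ^ m *\<^sub>R ((1 / t ^ m) *\<^sub>R \<kappa> (x t))) \<longlongrightarrow> 0 ^ m *\<^sub>R u) (at_right 0)"
    using assms(1) unfolding jet_def by (intro tendsto_scaleR) auto
  then have lim: "((\<lambda>t. t ^ m *\<^sub>R ((1 / t ^ m) *\<^sub>R \<kappa> (x t))) \<longlongrightarrow> 0) (at_right 0)"
    using assms(2) by (simp only: zero_power scaleR_zero_left)
  have "\<forall>\<^sub>F t in at_right 0. norm (t ^ m *\<^sub>R ((1 / t ^ m) *\<^sub>R \<kappa> (x t))) < \<delta>"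
    using tendstoD[OF lim assms(3)] by (simp only: dist_norm diff_zero)
  moreover have "\<forall>\<^sub>F t::real in at_right 0. t > 0" by (simp add: eventually_at_right_less)
  moreover have "\<forall>\<^sub>F t in at_right 0. x t \<in> U" using assms(1) by (simp add: jet_def)
  ultimately show ?thesis by eventually_elim (simp add: nbhd_def)
qed

lemma jet_ray: "jet 1 (\<lambda>t. \<eta> (t *\<^sub>R v)) v"
proof -
  have "((\<lambda>t. t *\<^sub>R v) \<longlongrightarrow> 0 *\<^sub>R v) (at_right 0)" by (intro tendsto_intros)
  then have "((\<lambda>t. t *\<^sub>R v) \<longlongrightarrow> 0) (at_right 0)" by simp
  from tendstoD[OF this R_pos] have ev: "\<forall>\<^sub>F t in at_right 0. norm (t *\<^sub>R v) < R" by (simp only: dist_norm diff_zero)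
  have "\<forall>\<^sub>F t::real in at_right 0. t > 0" by (simp add: eventually_at_right_less)
  with ev have "\<forall>\<^sub>F t in at_right 0. (1 / t ^ 1) *\<^sub>R \<kappa> (\<eta> (t *\<^sub>R v)) = v"
    by eventually_elim (simp add: \<kappa>_\<eta> del: norm_scaleR)
  then have "((\<lambda>t. (1 / t ^ 1) *\<^sub>R \<kappa> (\<eta> (t *\<^sub>R v))) \<longlongrightarrow> v) (at_right 0)" by (rule tendsto_eventually)
  moreover have "\<forall>\<^sub>F t in at_right 0. \<eta> (t *\<^sub>R v) \<in> U" using ev by eventually_elim (rule \<eta>_U)
  ultimately show ?thesis by (simp add: jet_def)
qed

text \<open>The error in \<open>comm_expansion\<close> is small against the product of the two
  sizes, hence against \<open>t ^ (m + n)\<close>, even when the curves vanish to different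
  orders.\<close>

lemma jet_comm:
  assumes x: "jet m x u" "m > 0" and y: "jet n y v" "n > 0"
  shows "jet (m + n) (\<lambda>t. comm (x t) (y t)) (bracket u v)"
proof -
  have pos: "\<forall>\<^sub>F t::real in at_right 0. t > 0" by (simp add: eventually_at_right_less)
  have small: "\<forall>\<^sub>F t in at_right 0. x t \<in> nbhd \<delta> \<and> y t \<in> nbhd \<delta>" if "\<delta> > 0" for \<delta>
    using jet_small[OF x that] jet_small[OF y that] by eventually_elim simp
  have inU: "\<forall>\<^sub>F t in at_right 0. comm (x t) (y t) \<in> U"
  proof -
    obtain \<delta> where "\<delta> > 0" "\<forall>x\<in>nbhd \<delta>. \<forall>y\<in>nbhd \<delta>. comm x y \<in> U" using comm_expansion[of 1] by auto
    then show ?thesis using small[of \<delta>] by (auto elim: eventually_mono)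
  qed
  define X where "X t = (1 / t ^ m) *\<^sub>R \<kappa> (x t)" for t
  define Y where "Y t = (1 / t ^ n) *\<^sub>R \<kappa> (y t)" for t
  have lim: "(X \<longlongrightarrow> u) (at_right 0)" "(Y \<longlongrightarrow> v) (at_right 0)"
    using x y unfolding jet_def X_def[abs_def] Y_def[abs_def] by auto
  have br: "((\<lambda>t. bracket (X t) (Y t)) \<longlongrightarrow> bracket u v) (at_right 0)"
    by (rule bounded_bilinear.tendsto[OF bounded_bilinear_bracket lim])
  define Z where "Z t = (1 / t ^ (m + n)) *\<^sub>R \<kappa> (comm (x t) (y t))" for t
  have "((\<lambda>t. Z t - bracket (X t) (Y t)) \<longlongrightarrow> 0) (at_right 0)"
  proof (rule tendstoI)
    fix e :: real assume e: "e > 0"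
    define B where "B = (norm u + 1) * (norm v + 1)"
    have B: "B > 0" unfolding B_def by (intro mult_pos_pos) (auto intro: add_nonneg_pos)
    obtain \<delta> where \<delta>: "\<delta> > 0" "\<forall>x\<in>nbhd \<delta>. \<forall>y\<in>nbhd \<delta>. comm x y \<in> U \<and>
        norm (\<kappa> (comm x y) - bracket (\<kappa> x) (\<kappa> y)) \<le> (e / (2 * B)) * size x * size y"
      using comm_expansion[of "e / (2 * B)"] e B by auto
    have "\<forall>\<^sub>F t in at_right 0. norm (X t) < norm u + 1" "\<forall>\<^sub>F t in at_right 0. norm (Y t) < norm v + 1"
      using order_tendstoD(2)[OF tendsto_norm[OF lim(1)], of "norm u + 1"]
        order_tendstoD(2)[OF tendsto_norm[OF lim(2)], of "norm v + 1"] by auto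
    with small[OF \<delta>(1)] pos show "\<forall>\<^sub>F t in at_right 0. dist (Z t - bracket (X t) (Y t)) 0 < e"
    proof eventually_elim
      case (elim t)
      have "bracket (X t) (Y t) = (1 / t ^ (m + n)) *\<^sub>R bracket (\<kappa> (x t)) (\<kappa> (y t))"
        unfolding X_def Y_def
        by (simp add: bounded_bilinear.scaleR_left[OF bounded_bilinear_bracket]
            bounded_bilinear.scaleR_right[OF bounded_bilinear_bracket] power_add)
      then have "Z t - bracket (X t) (Y t) = (1 / t ^ (m + n)) *\<^sub>R (\<kappa> (comm (x t) (y t)) - bracket (\<kappa> (x t)) (\<kappa> (y t)))"
        unfolding Z_def by (simp add: scaleR_diff_right)
      then have "norm (Z t - bracket (X t) (Y t)) =
          (1 / t ^ (m + n)) * norm (\<kappa> (comm (x t) (y t)) - bracket (\<kappa> (x t)) (\<kappa> (y t)))"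
        using elim by simp
      also have "\<dots> \<le> (1 / t ^ (m + n)) * ((e / (2 * B)) * size (x t) * size (y t))"
        using \<delta>(2) elim by (intro mult_left_mono) auto
      also have "\<dots> = e / (2 * B) * (norm (X t) * norm (Y t))"
        unfolding X_def Y_def using elim by (simp add: power_add mult_ac)
      also have "\<dots> \<le> e / (2 * B) * B"
        unfolding B_def using elim e B by (intro mult_left_mono mult_mono) (auto simp: B_def)
      also have "\<dots> < e" using e B by simp
      finally show ?case by (simp add: dist_norm)
    qed
  qed
  from tendsto_add[OF this br] have "(Z \<longlongrightarrow> bracket u v) (at_right 0)" by simp
  then show ?thesis using inU unfolding jet_def Z_def[abs_def] by blast
qed

lemma jet_unique:
  assumes "jet m x u" "jet m y v" "\<forall>\<^sub>F t in at_right 0. x t = y t"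
  shows "u = v"
proof -
  have "((\<lambda>t. (1 / t ^ m) *\<^sub>R \<kappa> (y t)) \<longlongrightarrow> u) (at_right 0)"
  proof (rule Lim_transform_eventually)
    show "((\<lambda>t. (1 / t ^ m) *\<^sub>R \<kappa> (x t)) \<longlongrightarrow> u) (at_right 0)" using assms(1) by (simp add: jet_def)
    show "\<forall>\<^sub>F t in at_right 0. (1 / t ^ m) *\<^sub>R \<kappa> (x t) = (1 / t ^ m) *\<^sub>R \<kappa> (y t)"
      using assms(3) by eventually_elim simp
  qed
  then show ?thesis using assms(2) tendsto_unique[of "at_right (0::real)"] unfolding jet_def by auto
qed

text \<open>Iterated commutators of rays have iterated brackets as leading coefficients. The order
  exceeds the index of the series by one, as the series starts with the whole group at index
  0.\<close>

lemma left_normed_bracket_jet: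
  "\<exists>y. jet (Suc (length vs)) y (foldl bracket v0 vs) \<and> (\<forall>t. y t \<in> lower_central_series L (length vs))"
proof (induction vs rule: rev_induct)
  case Nil
  show ?case using jet_ray[of v0] by (intro exI[of _ "\<lambda>t. \<eta> (t *\<^sub>R v0)"]) simp
next
  case (snoc v vs)
  then obtain y where y: "jet (Suc (length vs)) y (foldl bracket v0 vs)"
    "\<forall>t. y t \<in> lower_central_series L (length vs)" by blast
  have "jet (Suc (length vs) + 1) (\<lambda>t. comm (y t) (\<eta> (t *\<^sub>R v))) (bracket (foldl bracket v0 vs) v)"
    by (rule jet_comm[OF y(1) _ jet_ray]) auto
  moreover have "comm (y t) (\<eta> (t *\<^sub>R v)) \<in> lower_central_series L (Suc (length vs))" for t
    unfolding lower_central_series.simps comm_def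
    by (rule generate.incl, rule UN_I[OF y(2)[rule_format]], rule UN_I[OF car], simp)
  ultimately show ?case by (intro exI[of _ "\<lambda>t. comm (y t) (\<eta> (t *\<^sub>R v))"]) simp
qed

text \<open>A curve inside the trivial subgroup has zero leading coefficient; thus nilpotency passes
  from the group to the bracket.\<close>

lemma left_normed_bracket_zero:
  assumes "lower_central_series L n = {\<one>}" and len: "length vs = n"
  shows "foldl bracket v0 vs = 0"
proof -
  obtain y where y: "jet (Suc n) y (foldl bracket v0 vs)" "\<forall>t. y t \<in> lower_central_series L n"
    using left_normed_bracket_jet[of vs v0] len by blast
  have "y t = \<one>" for t using y(2) assms by simp
  then have "((\<lambda>t::real. 0) \<longlongrightarrow> foldl bracket v0 vs) (at_right 0)" using y(1) by (simp add: jet_def \<kappa>_one)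
  then show ?thesis using tendsto_unique[of "at_right (0::real)" "\<lambda>t. 0" "foldl bracket v0 vs" 0] by simp
qed

end

section \<open>Characters that an automorphism multiplies by a scalar\<close>

locale chart_automorphism = chart_group L U \<kappa> \<eta> \<beta> C R
  for L :: "'l::t2_space monoid" (structure) and U and \<kappa> :: "'l \<Rightarrow> 'e::real_normed_vector" and \<eta> \<beta> C R +
  fixes \<Phi> :: "'l \<Rightarrow> 'l" and T :: "'e \<Rightarrow> 'e"
  assumes fd: "\<exists>B::'e set. finite B \<and> span B = UNIV"
    and \<Phi>_mult: "\<And>x y. \<Phi> (x \<otimes> y) = \<Phi> x \<otimes> \<Phi> y"
    and T: "linear T"
    and \<Phi>_deriv: "\<And>\<epsilon>. \<epsilon> > 0 \<Longrightarrow> \<exists>\<delta>>0. \<forall>x\<in>nbhd \<delta>. \<Phi> x \<in> U \<and> norm (\<kappa> (\<Phi> x) - T (\<kappa> x)) \<le> \<epsilon> * size x"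
begin

sublocale endo T by (rule endo.intro[OF fd T])

lemma bounded_T: "bounded_linear T" by (rule finite_dim_linear_bounded[OF fd T])

lemma \<Phi>_one: "\<Phi> \<one> = \<one>"
  using \<Phi>_mult[of \<one> \<one>] l_cancel_one[of "\<Phi> \<one>" "\<Phi> \<one>"] by simp

lemma \<Phi>_inv: "\<Phi> (inv x) = inv (\<Phi> x)"
proof -
  have "\<Phi> (inv x) \<otimes> \<Phi> x = \<one>" by (simp add: \<Phi>_mult[symmetric] \<Phi>_one)
  then show ?thesis by (simp add: inv_equality)
qed

lemma jet_\<Phi>:
  assumes "jet m x u" "m > 0"
  shows "jet m (\<lambda>t. \<Phi> (x t)) (T u)"
proof -
  have pos: "\<forall>\<^sub>F t::real in at_right 0. t > 0" by (simp add: eventually_at_right_less)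
  obtain \<delta>0 where \<delta>0: "\<delta>0 > 0" "\<forall>x\<in>nbhd \<delta>0. \<Phi> x \<in> U" using \<Phi>_deriv[of 1] by auto
  have inU: "\<forall>\<^sub>F t in at_right 0. \<Phi> (x t) \<in> U"
    using jet_small[OF assms \<delta>0(1)] \<delta>0(2) by (auto elim: eventually_mono)
  define X where "X t = (1 / t ^ m) *\<^sub>R \<kappa> (x t)" for t
  have lim: "(X \<longlongrightarrow> u) (at_right 0)" using assms unfolding jet_def X_def[abs_def] by auto
  define Z where "Z t = (1 / t ^ m) *\<^sub>R \<kappa> (\<Phi> (x t))" for t
  have "((\<lambda>t. Z t - T (X t)) \<longlongrightarrow> 0) (at_right 0)"
  proof (rule tendstoI)
    fix e :: real assume e: "e > 0"
    define B where "B = norm u + 1"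
    have B: "B > 0" unfolding B_def by (auto intro: add_nonneg_pos)
    obtain \<delta> where \<delta>: "\<delta> > 0" "\<forall>x\<in>nbhd \<delta>. \<Phi> x \<in> U \<and> norm (\<kappa> (\<Phi> x) - T (\<kappa> x)) \<le> (e / (2 * B)) * size x"
      using \<Phi>_deriv[of "e / (2 * B)"] e B by auto
    have "\<forall>\<^sub>F t in at_right 0. norm (X t) < B"
      using order_tendstoD(2)[OF tendsto_norm[OF lim], of B] by (simp add: B_def)
    with jet_small[OF assms \<delta>(1)] pos show "\<forall>\<^sub>F t in at_right 0. dist (Z t - T (X t)) 0 < e"
    proof eventually_elim
      case (elim t)
      have "Z t - T (X t) = (1 / t ^ m) *\<^sub>R (\<kappa> (\<Phi> (x t)) - T (\<kappa> (x t)))"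
        unfolding Z_def X_def by (simp add: scaleR_diff_right linear_scale[OF T])
      then have "norm (Z t - T (X t)) = (1 / t ^ m) * norm (\<kappa> (\<Phi> (x t)) - T (\<kappa> (x t)))"
        using elim by simp
      also have "\<dots> \<le> (1 / t ^ m) * ((e / (2 * B)) * size (x t))"
        using \<delta>(2) elim by (intro mult_left_mono) auto
      also have "\<dots> = e / (2 * B) * norm (X t)" unfolding X_def using elim by simp
      also have "\<dots> \<le> e / (2 * B) * B" using elim e B by (intro mult_left_mono) auto
      also have "\<dots> < e" using e B by simp
      finally show ?case by (simp add: dist_norm)
    qed
  qed
  from tendsto_add[OF this bounded_linear.tendsto[OF bounded_T lim]]
  have "(Z \<longlongrightarrow> T u) (at_right 0)" by simp
  then show ?thesis using inU unfolding jet_def Z_def[abs_def] by blast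
qed

text \<open>\<open>\<Phi>\<close> maps commutators to commutators, so both sides are second-order
  coefficients of one and the same curve.\<close>

lemma T_bracket: "T (bracket u v) = bracket (T u) (T v)"
proof -
  let ?u = "\<lambda>t. \<eta> (t *\<^sub>R u)" and ?v = "\<lambda>t. \<eta> (t *\<^sub>R v)"
  have "jet (1 + 1) (\<lambda>t. \<Phi> (comm (?u t) (?v t))) (T (bracket u v))"
    by (intro jet_\<Phi> jet_comm jet_ray) auto
  moreover have "jet (1 + 1) (\<lambda>t. comm (\<Phi> (?u t)) (\<Phi> (?v t))) (bracket (T u) (T v))"
    by (intro jet_comm jet_\<Phi> jet_ray) auto
  ultimately show ?thesis by (rule jet_unique) (simp add: comm_def \<Phi>_mult \<Phi>_inv)
qed

lemma character_on_tangent: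
  assumes nil: "nilpotent_group L" and sr: "\<not> complex_spectral_radius T < 1"
  shows "\<exists>(f :: 'e \<Rightarrow> complex) l. bounded_linear f \<and> (\<exists>x. f x \<noteq> 0) \<and> (\<forall>u v. f (bracket u v) = 0) \<and>
    (\<forall>x. f (T x) = l * f x) \<and> cmod l \<ge> 1"
proof -
  interpret br: bounded_bilinear bracket by (rule bounded_bilinear_bracket)
  define N where "N = {x. (\<lambda>n. (T ^^ n) x) \<longlonglongrightarrow> 0}"
  have NU: "N \<noteq> UNIV" using sr complex_spectral_radius_less_1_iff by (auto simp: N_def)
  have subN: "subspace N"
  proof (rule subspaceI)
    show "0 \<in> N" by (simp add: N_def linear_0[OF linear_Tn])
    show "x + y \<in> N" if "x \<in> N" "y \<in> N" for x y
      using tendsto_add[of "\<lambda>n. (T ^^ n) x" 0 sequentially "\<lambda>n. (T ^^ n) y" 0] that by (simp add: N_def linear_add[OF linear_Tn])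
    show "c *\<^sub>R x \<in> N" if "x \<in> N" for c x
      using tendsto_scaleR[OF tendsto_const, of "\<lambda>n. (T ^^ n) x" 0 sequentially c] that by (simp add: N_def linear_scale[OF linear_Tn])
  qed
  have TN: "T x \<in> N" if "x \<in> N" for x
    using that LIMSEQ_Suc[of "\<lambda>n. (T ^^ n) x" 0] by (simp add: N_def funpow_swap1)
  have Tn_br: "(T ^^ n) (bracket x y) = bracket ((T ^^ n) x) ((T ^^ n) y)" for n x y
    by (induction n) (simp_all add: T_bracket)
  have brN: "bracket x y \<in> N" if "x \<in> N" "y \<in> N" for x y
    using br.tendsto[of "\<lambda>n. (T ^^ n) x" 0 sequentially "\<lambda>n. (T ^^ n) y" 0] that
    by (simp add: N_def Tn_br br.zero_left)
  \<comment> \<open>Left-normed brackets with \<open>k + 1\<close> entries; their spans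
    \<open>G k\<close> are the lower central series of the Lie algebra. \<open>brG\<close> raises
    the index through the left argument, hence the use of antisymmetry below.\<close>
  define S where "S k = {foldl bracket v0 vs |v0 vs. length vs = k}" for k
  define G where "G k = span (S k)" for k
  define add where "add k = {x + y |x y. x \<in> N \<and> y \<in> G k}" for k
  have sub_add: "subspace (add k)" for k
    unfolding add_def G_def using subspace_sums[OF subN subspace_span[of "S k"]] by simp
  have brG: "bracket x y \<in> G (Suc k)" if "x \<in> G k" for x y k
  proof -
    have "x \<in> span (S k)" using that by (simp add: G_def)
    then show ?thesis
    proof (induction rule: span_induct_alt)
      case base then show ?case by (simp add: br.zero_left G_def span_zero)
    next
      case (step c x z)
      obtain v0 vs where x: "x = foldl bracket v0 vs" "length vs = k" using step by (auto simp: S_def)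
      have "bracket x y = foldl bracket v0 (vs @ [y])" using x by simp
      then have "bracket x y \<in> S (Suc k)" unfolding S_def using x(2) by (metis (mono_tags, lifting) length_append_singleton mem_Collect_eq)
      then have "bracket x y \<in> G (Suc k)" by (simp add: G_def span_base)
      then show ?case using step
        by (simp add: br.add_left br.scaleR_left G_def span_add span_scale)
    qed
  qed
  \<comment> \<open>A subalgebra that together with the derived algebra spans a nilpotent Lie algebra is everything.\<close>
  have add1: "add 1 \<noteq> UNIV"
  proof
    assume full: "add 1 = UNIV"
    have all: "add (Suc k) = UNIV" for k
    proof (induction k)
      case 0 then show ?case using full by simp
    next
      case (Suc k)
      \<comment> \<open>Both arguments are decomposed along the previous sum. The part with both
        entries in \<open>N\<close> stays in \<open>N\<close>, and every other part has an entry in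
        \<open>G (Suc k)\<close>.\<close>
      have br_in: "bracket a b \<in> add (Suc (Suc k))" for a b
      proof -
        have "a \<in> add (Suc k)" "b \<in> add (Suc k)" using Suc by simp_all
        then obtain n g n' g' where a: "a = n + g" "n \<in> N" "g \<in> G (Suc k)"
          and b: "b = n' + g'" "n' \<in> N" "g' \<in> G (Suc k)" unfolding add_def by blast
        have "bracket a b = bracket n n' + (bracket g b + - bracket g' n)"
          unfolding a b by (simp add: br.add_left br.add_right bracket_swap[of n g'])
        moreover have "bracket g b + - bracket g' n \<in> G (Suc (Suc k))"
          using brG[OF a(3)] brG[OF b(3)] unfolding G_def by (intro span_add span_neg)
        ultimately show ?thesis unfolding add_def using brN[OF a(2) b(2)] by blast
      qed
      have "x \<in> add (Suc (Suc k))" for x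
      proof -
        have "x \<in> add 1" using full by simp
        then obtain n g where x: "x = n + g" "n \<in> N" "g \<in> G 1" unfolding add_def by blast
        have "S 1 \<subseteq> add (Suc (Suc k))"
        proof
          fix z assume "z \<in> S 1"
          then obtain v0 vs where "z = foldl bracket v0 vs" "length vs = 1" by (auto simp: S_def)
          then obtain v1 where "z = bracket v0 v1" by (cases vs) auto
          then show "z \<in> add (Suc (Suc k))" using br_in by simp
        qed
        then have "G 1 \<subseteq> add (Suc (Suc k))" unfolding G_def by (rule span_minimal[OF _ sub_add])
        moreover have "n \<in> add (Suc (Suc k))" unfolding add_def G_def using x(2) span_zero by force
        ultimately show ?thesis unfolding x(1) using x(3) subspace_add[OF sub_add] by blast
      qed
      then show ?case by blast
    qed
    obtain n where n: "lower_central_series L n = {\<one>}" using nil by (auto simp: nilpotent_group_def)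
    have S0: "S (Suc n) \<subseteq> {0}"
    proof
      fix z assume "z \<in> S (Suc n)"
      then obtain v0 vs where z: "z = foldl bracket v0 vs" "length vs = Suc n" by (auto simp: S_def)
      then obtain v1 ws where "vs = v1 # ws" "length ws = n" by (cases vs) auto
      then show "z \<in> {0}" using z left_normed_bracket_zero[OF n, of ws] by simp
    qed
    then have "G (Suc n) \<subseteq> {0}" unfolding G_def by (intro span_minimal) (auto simp: subspace_def)
    then have "add (Suc n) \<subseteq> N" unfolding add_def by auto
    then show False using all[of n] NU by auto
  qed
  have TG: "T x \<in> G 1" if "x \<in> G 1" for x
  proof -
    have "x \<in> span (S 1)" using that by (simp add: G_def)
    then show ?thesis
    proof (induction rule: span_induct_alt)
      case base then show ?case by (simp add: G_def linear_0[OF T] span_zero)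
    next
      case (step c x z)
      obtain v0 vs where x: "x = foldl bracket v0 vs" "length vs = 1" using step by (auto simp: S_def)
      then obtain v1 where "x = bracket v0 v1" by (cases vs) auto
      then have "T x = foldl bracket (T v0) [T v1]" by (simp add: T_bracket)
      then have "T x \<in> S 1" unfolding S_def by (metis (mono_tags, lifting) length_Cons list.size(3) mem_Collect_eq One_nat_def)
      then have "T x \<in> G 1" by (simp add: G_def span_base)
      then show ?case using step by (simp add: linear_add[OF T] linear_scale[OF T] G_def span_add span_scale)
    qed
  qed
  have N_sub: "N \<subseteq> add 1" unfolding add_def G_def using span_zero by force
  have T_add: "T ` add 1 \<subseteq> add 1"
    unfolding add_def using TN TG linear_add[OF T] by fastforce
  obtain f l where f: "linear f" "\<exists>x. f x \<noteq> 0" "\<forall>x\<in>add 1. f x = (0::complex)" "\<forall>x. f (T x) = l * f x" "cmod l \<ge> 1"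
    using eigenfunctional_modulus_ge_1[OF sub_add T_add N_sub[unfolded N_def] add1] by blast
  have "bracket u v \<in> add 1" for u v
  proof -
    have "bracket u v = foldl bracket u [v]" by simp
    then have "bracket u v \<in> S 1" unfolding S_def by (metis (mono_tags, lifting) length_Cons list.size(3) mem_Collect_eq One_nat_def)
    then have "bracket u v \<in> G 1" by (simp add: G_def span_base)
    then show ?thesis unfolding add_def using subspace_0[OF subN] by force
  qed
  then show ?thesis using f finite_dim_linear_bounded[OF fd f(1)] by blast
qed

text \<open>\<open>F\<close> agrees with \<open>f \<circ> \<kappa>\<close> up to second order at the
  identity. The eigenvalue equation follows since the difference of its sides is a homomorphism
  vanishing to first order; nonvanishing and continuity come from the same approximation.\<close>

lemma global_character:
  assumes nil: "nilpotent_group L" and sr: "\<not> complex_spectral_radius T < 1"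
    and conn: "connected (UNIV :: 'l set)" and sc: "simply_connected (UNIV :: 'l set)"
  shows "\<exists>(F :: 'l \<Rightarrow> complex) l. (\<forall>x y. F (x \<otimes> y) = F x + F y) \<and> (\<exists>x. F x \<noteq> 0) \<and> continuous_on UNIV F \<and>
    (\<forall>x. F (\<Phi> x) = l * F x) \<and> cmod l \<ge> 1"
proof -
  obtain f :: "'e \<Rightarrow> complex" and l where f: "bounded_linear f" "\<exists>x. f x \<noteq> 0" "\<forall>u v. f (bracket u v) = 0"
    "\<forall>x. f (T x) = l * f x" "cmod l \<ge> 1" using character_on_tangent[OF nil sr] by blast
  interpret f: bounded_linear f by (rule f(1))
  have sym: "f (\<beta> u v) = f (\<beta> v u)" for u v using f(3) by (simp add: bracket_def f.diff)
  obtain \<phi> \<rho> K where \<phi>: "\<rho> > 0" "\<forall>x\<in>nbhd \<rho>. \<forall>y\<in>nbhd \<rho>. \<phi> (x \<otimes> y) = \<phi> x + \<phi> y"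
    "\<forall>x\<in>nbhd \<rho>. cmod (\<phi> x - f (\<kappa> x)) \<le> K * (size x)\<^sup>2"
    using local_homomorphism[OF f(1) sym] by blast
  obtain F \<delta>1 where F: "\<delta>1 > 0" "\<And>x y. F (x \<otimes> y) = F x + F y" "\<forall>x\<in>nbhd \<delta>1. F x = \<phi> x"
    using local_homomorphism_extends[OF conn sc \<phi>(1), of \<phi>] \<phi>(2) by blast
  have F1: "F \<one> = 0" using F(2)[of \<one> \<one>] by simp
  have Finv: "F (inv x) = - F x" for x using F(2)[of x "inv x"] F1 by (simp add: eq_neg_iff_add_eq_0 add.commute)
  have approx: "\<exists>\<delta>>0. \<delta> \<le> rad \<and> (\<forall>x\<in>nbhd \<delta>. cmod (F x - f (\<kappa> x)) \<le> \<epsilon> * size x)" if e: "\<epsilon> > 0" for \<epsilon>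
  proof -
    define \<delta> where "\<delta> = min (min rad \<delta>1) (min \<rho> (\<epsilon> / (\<bar>K\<bar> + 1)))"
    have \<delta>: "\<delta> > 0" "\<delta> \<le> rad" "\<delta> \<le> \<delta>1" "\<delta> \<le> \<rho>" "\<delta> \<le> \<epsilon> / (\<bar>K\<bar> + 1)"
      unfolding \<delta>_def using rad F(1) \<phi>(1) e by auto
    have "cmod (F x - f (\<kappa> x)) \<le> \<epsilon> * size x" if x: "x \<in> nbhd \<delta>" for x
    proof -
      have "F x = \<phi> x" using F(3) nbhd_mono[OF \<delta>(3)] x by blast
      then have "cmod (F x - f (\<kappa> x)) \<le> K * (size x)\<^sup>2" using \<phi>(3) nbhd_mono[OF \<delta>(4)] x by auto
      also have "\<dots> \<le> \<bar>K\<bar> * size x * size x" by (simp add: power2_eq_square mult_right_mono mult.assoc)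
      also have "\<dots> \<le> \<epsilon> * size x"
      proof (intro mult_right_mono)
        have "size x \<le> \<epsilon> / (\<bar>K\<bar> + 1)" using x \<delta>(5) by (simp add: nbhd_def)
        then have "size x * (\<bar>K\<bar> + 1) \<le> \<epsilon>" by (simp add: pos_le_divide_eq)
        moreover have "size x * (\<bar>K\<bar> + 1) = \<bar>K\<bar> * size x + size x" by (simp add: algebra_simps)
        ultimately show "\<bar>K\<bar> * size x \<le> \<epsilon>" using norm_ge_zero[of "\<kappa> x"] by linarith
      qed simp
      finally show ?thesis .
    qed
    then show ?thesis using \<delta> by blast
  qed
  \<comment> \<open>Cutting a ray into \<open>n\<close> pieces of size \<open>O(1/n)\<close> shows that a homomorphism vanishing to first order is zero.\<close>
  have ker: "D x = 0" if D: "\<And>x y. D (x \<otimes> y) = D x + D y"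
    and small: "\<And>\<epsilon>. \<epsilon> > 0 \<Longrightarrow> \<exists>\<delta>>0. \<forall>x\<in>nbhd \<delta>. cmod (D x) \<le> \<epsilon> * size x" for D :: "'l \<Rightarrow> complex" and x
  proof -
    have D1: "D \<one> = 0" using D[of \<one> \<one>] by simp
    have Dinv: "D (inv x) = - D x" for x using D[of x "inv x"] D1 by (simp add: eq_neg_iff_add_eq_0 add.commute)
    have loc: "D x = 0" if x: "x \<in> nbhd rad" for x
    proof -
      have "cmod (D x) \<le> e" if e: "e > 0" for e
      proof -
        define B where "B = 2 * size x + 1"
        have B: "B > 0" unfolding B_def using norm_ge_zero[of "\<kappa> x"] by linarith
        obtain \<delta> where \<delta>: "\<delta> > 0" "\<forall>y\<in>nbhd \<delta>. cmod (D y) \<le> (e / B) * size y" using small[of "e / B"] e B by auto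
        obtain n :: nat where n: "B / \<delta> < real n" using reals_Archimedean2 by blast
        then have n0: "n > 0" using B \<delta>(1) by (metis divide_pos_pos gr0I less_asym of_nat_0)
        have n1: "B / n < \<delta>" using n n0 \<delta>(1) by (simp add: field_simps)
        define p where "p i = ray x (real i / n)" for i
        have step: "cmod (D (p (Suc i)) - D (p i)) \<le> e / n" if i: "i < n" for i
        proof -
          define c where "c = inv (p i) \<otimes> p (Suc i)"
          have "real (Suc i) / n - real i / n = 1 / n" by (simp add: diff_divide_distrib[symmetric])
          moreover have c: "c \<in> nbhd R" "size c \<le> 2 * \<bar>real (Suc i) / n - real i / n\<bar> * size x"
            unfolding c_def p_def using i by (intro ray_diff[OF x]; simp add: field_simps)+
          ultimately have "size c \<le> 2 * size x / n" by simp
          also have "\<dots> \<le> B / n" unfolding B_def by (intro divide_right_mono) auto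
          finally have cB: "size c \<le> B / n" .
          then have "c \<in> nbhd \<delta>" using c n1 by (auto simp: nbhd_def)
          then have "cmod (D c) \<le> (e / B) * size c" using \<delta>(2) by blast
          also have "\<dots> \<le> (e / B) * (B / n)" using cB e B by (intro mult_left_mono) auto
          also have "\<dots> = e / n" using B by simp
          finally show ?thesis unfolding c_def by (simp add: D Dinv)
        qed
        have "D x = (\<Sum>i<n. D (p (Suc i)) - D (p i))"
          unfolding sum_lessThan_telescope[of "\<lambda>i. D (p i)"] using n0 x by (simp add: p_def ray_1 D1 nbhd_def)
        also have "cmod \<dots> \<le> (\<Sum>i<n. e / n)" by (rule sum_norm_le) (use step in auto)
        also have "\<dots> = e" using n0 by simp
        finally show ?thesis .
      qed
      then show ?thesis by (metis field_le_epsilon add_0 norm_le_zero_iff)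
    qed
    have "{x. D x = 0} = UNIV"
      by (rule open_subgroup_UNIV[OF conn _ _ _ rad(1)]) (auto simp: D D1 Dinv loc)
    then show ?thesis by blast
  qed
  have eig: "F (\<Phi> x) = l * F x" for x
  proof -
    have "F (\<Phi> x) - l * F x = 0"
    proof (rule ker[of "\<lambda>x. F (\<Phi> x) - l * F x"])
      show "F (\<Phi> (x \<otimes> y)) - l * F (x \<otimes> y) = F (\<Phi> x) - l * F x + (F (\<Phi> y) - l * F y)" for x y
        by (simp add: \<Phi>_mult F(2) algebra_simps)
      fix \<epsilon> :: real assume e: "\<epsilon> > 0"
      obtain Kf where Kf: "Kf > 0" "\<And>x. norm (f x) \<le> norm x * Kf" using f.pos_bounded by blast
      obtain KT where KT: "KT > 0" "\<And>x. norm (T x) \<le> norm x * KT" using bounded_linear.pos_bounded[OF bounded_T] by blast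
      \<comment> \<open>One third of the error is meant for \<open>F\<close> at
        \<open>\<Phi> x\<close>, one for the linearisation of \<open>\<Phi>\<close>, and one for
        \<open>F\<close> at \<open>x\<close>.\<close>
      define e1 where "e1 = \<epsilon> / (3 * (KT + 1))"
      define e2 where "e2 = min 1 (\<epsilon> / (3 * Kf))"
      define e3 where "e3 = \<epsilon> / (3 * (cmod l + 1))"
      have pos: "e1 > 0" "e2 > 0" "e3 > 0" unfolding e1_def e2_def e3_def using e KT Kf
        by (auto intro!: divide_pos_pos mult_pos_pos add_nonneg_pos)
      obtain a where a: "a > 0" "\<forall>x\<in>nbhd a. cmod (F x - f (\<kappa> x)) \<le> e1 * size x" using approx[OF pos(1)] by blast
      obtain b where b: "b > 0" "\<forall>x\<in>nbhd b. \<Phi> x \<in> U \<and> norm (\<kappa> (\<Phi> x) - T (\<kappa> x)) \<le> e2 * size x" using \<Phi>_deriv[OF pos(2)] by blast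
      obtain c where c: "c > 0" "\<forall>x\<in>nbhd c. cmod (F x - f (\<kappa> x)) \<le> e3 * size x" using approx[OF pos(3)] by blast
      define \<delta> where "\<delta> = min (min b c) (a / (KT + 1))"
      have \<delta>: "\<delta> > 0" "\<delta> \<le> b" "\<delta> \<le> c" "\<delta> \<le> a / (KT + 1)" unfolding \<delta>_def using a b c KT by auto
      have "cmod (F (\<Phi> x) - l * F x) \<le> \<epsilon> * size x" if x: "x \<in> nbhd \<delta>" for x
      proof -
        have xb: "\<Phi> x \<in> U" "norm (\<kappa> (\<Phi> x) - T (\<kappa> x)) \<le> e2 * size x" using b(2) x nbhd_mono[OF \<delta>(2)] by auto
        have "e2 * size x \<le> 1 * size x" unfolding e2_def by (intro mult_right_mono) auto
        then have s\<Phi>: "size (\<Phi> x) \<le> (KT + 1) * size x"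
          using norm_triangle_sub[of "\<kappa> (\<Phi> x)" "T (\<kappa> x)"] xb(2) KT(2)[of "\<kappa> x"] by (simp add: algebra_simps)
        have "(KT + 1) * size x < (KT + 1) * (a / (KT + 1))"
          using x \<delta>(4) KT by (intro mult_strict_left_mono) (auto simp: nbhd_def)
        then have "\<Phi> x \<in> nbhd a" using xb(1) s\<Phi> KT by (simp add: nbhd_def)
        then have "cmod (F (\<Phi> x) - f (\<kappa> (\<Phi> x))) \<le> e1 * size (\<Phi> x)" using a(2) by blast
        also have "\<dots> \<le> e1 * ((KT + 1) * size x)" using s\<Phi> pos by (intro mult_left_mono) auto
        also have "\<dots> = \<epsilon> / 3 * size x"
        proof -
          define P where "P = KT + 1"
          have "P > 0" unfolding P_def using KT by simp
          then show ?thesis unfolding e1_def P_def[symmetric] by simp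
        qed
        finally have 1: "cmod (F (\<Phi> x) - f (\<kappa> (\<Phi> x))) \<le> \<epsilon> / 3 * size x" .
        have "cmod (f (\<kappa> (\<Phi> x)) - l * f (\<kappa> x)) = cmod (f (\<kappa> (\<Phi> x) - T (\<kappa> x)))" using f(4) by (simp add: f.diff)
        also have "\<dots> \<le> (e2 * size x) * Kf" using order_trans[OF Kf(2) mult_right_mono[OF xb(2)]] Kf(1) by simp
        also have "\<dots> = (e2 * Kf) * size x" by simp
        also have "\<dots> \<le> \<epsilon> / 3 * size x"
        proof (intro mult_right_mono)
          have "e2 \<le> \<epsilon> / (3 * Kf)" unfolding e2_def by simp
          then show "e2 * Kf \<le> \<epsilon> / 3" using Kf(1) by (simp add: field_simps)
        qed simp
        finally have 2: "cmod (f (\<kappa> (\<Phi> x)) - l * f (\<kappa> x)) \<le> \<epsilon> / 3 * size x" .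
        have "cmod (F x - f (\<kappa> x)) \<le> e3 * size x" using c(2) x nbhd_mono[OF \<delta>(3)] by blast
        then have "cmod l * cmod (F x - f (\<kappa> x)) \<le> cmod l * (e3 * size x)" by (intro mult_left_mono) auto
        also have "\<dots> \<le> (cmod l + 1) * (e3 * size x)" using pos by (intro mult_right_mono) auto
        also have "\<dots> = \<epsilon> / 3 * size x"
        proof -
          define P where "P = cmod l + 1"
          have "P > 0" unfolding P_def by (auto intro: add_nonneg_pos)
          then show ?thesis unfolding e3_def P_def[symmetric] by simp
        qed
        finally have 3: "cmod (l * (f (\<kappa> x) - F x)) \<le> \<epsilon> / 3 * size x" by (simp add: norm_mult norm_minus_commute)
        have "F (\<Phi> x) - l * F x = (F (\<Phi> x) - f (\<kappa> (\<Phi> x))) + (f (\<kappa> (\<Phi> x)) - l * f (\<kappa> x)) + l * (f (\<kappa> x) - F x)"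
          by (simp add: algebra_simps)
        also have "cmod \<dots> \<le> \<epsilon> / 3 * size x + \<epsilon> / 3 * size x + \<epsilon> / 3 * size x"
          by (intro norm_triangle_le add_mono 1 2 3)
        finally show ?thesis by simp
      qed
      then show "\<exists>\<delta>>0. \<forall>x\<in>nbhd \<delta>. cmod (F (\<Phi> x) - l * F x) \<le> \<epsilon> * size x" using \<delta>(1) by blast
    qed
    then show ?thesis by simp
  qed
  have nz: "\<exists>x. F x \<noteq> 0"
  proof (rule ccontr)
    assume "\<not> ?thesis"
    then have F0: "F x = 0" for x by simp
    obtain v where v: "f v \<noteq> 0" using f(2) by blast
    have v0: "v \<noteq> 0" using v f.zero by auto
    \<comment> \<open>The constant is half the slope of \<open>f\<close> in the direction
      \<open>v\<close>, so a short multiple of \<open>v\<close> contradicts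
      \<open>F = 0\<close>.\<close>
    obtain \<delta> where \<delta>: "\<delta> > 0" "\<delta> \<le> rad" "\<forall>x\<in>nbhd \<delta>. cmod (F x - f (\<kappa> x)) \<le> (cmod (f v) / (2 * norm v)) * size x"
      using approx[of "cmod (f v) / (2 * norm v)"] v v0 by auto
    define t where "t = \<delta> / (2 * norm v)"
    have t: "t > 0" "norm (t *\<^sub>R v) < \<delta>" unfolding t_def using \<delta> v0 by auto
    have "norm (t *\<^sub>R v) < R" using t \<delta> rad by linarith
    then have x: "\<eta> (t *\<^sub>R v) \<in> nbhd \<delta>" "\<kappa> (\<eta> (t *\<^sub>R v)) = t *\<^sub>R v" using \<eta>_nbhd \<kappa>_\<eta> t by auto
    have "cmod (f (t *\<^sub>R v)) \<le> (cmod (f v) / (2 * norm v)) * norm (t *\<^sub>R v)" using \<delta>(3) x F0 by fastforce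
    then show False using t(1) v v0 by (simp add: f.scaleR)
  qed
  have "continuous_on UNIV F"
    unfolding continuous_on_eq_continuous_at[OF open_UNIV]
  proof (intro ballI)
    fix x
    show "isCont F x"
      unfolding continuous_at_open
    proof (intro allI impI)
      fix t assume t: "open t \<and> F x \<in> t"
      then obtain e where e: "e > 0" "ball (F x) e \<subseteq> t" using open_contains_ball by blast
      obtain Kf where Kf: "Kf > 0" "\<And>x. norm (f x) \<le> norm x * Kf" using f.pos_bounded by blast
      obtain a where a: "a > 0" "\<forall>x\<in>nbhd a. cmod (F x - f (\<kappa> x)) \<le> 1 * size x" using approx[of 1] by auto
      define \<delta> where "\<delta> = min a (e / (Kf + 1))"
      have \<delta>: "\<delta> > 0" "\<delta> \<le> a" "\<delta> \<le> e / (Kf + 1)" unfolding \<delta>_def using a e Kf by auto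
      define W where "W = (\<lambda>y. inv x \<otimes> y) -` nbhd \<delta>"
      have "open W" unfolding W_def by (rule open_vimage[OF open_nbhd continuous_on_translate])
      moreover have "x \<in> W" unfolding W_def using one_nbhd[OF \<delta>(1)] by simp
      moreover have "F y \<in> t" if "y \<in> W" for y
      proof -
        define z where "z = inv x \<otimes> y"
        have z: "z \<in> nbhd \<delta>" using that by (simp add: W_def z_def)
        then have "cmod (F z - f (\<kappa> z)) \<le> size z" using a(2) nbhd_mono[OF \<delta>(2)] by auto
        then have "cmod (F z) \<le> (Kf + 1) * size z"
          using norm_triangle_sub[of "F z" "f (\<kappa> z)"] Kf(2)[of "\<kappa> z"] by (simp add: algebra_simps)
        also have "\<dots> < (Kf + 1) * (e / (Kf + 1))" using z \<delta>(3) Kf by (intro mult_strict_left_mono) (auto simp: nbhd_def)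
        also have "\<dots> = e" using Kf by simp
        finally have "cmod (F z) < e" .
        moreover have "F y - F x = F z" unfolding z_def by (simp add: F(2) Finv)
        ultimately have "F y \<in> ball (F x) e" by (metis dist_norm dist_commute mem_ball)
        then show ?thesis using e(2) by blast
      qed
      ultimately show "\<exists>S. open S \<and> x \<in> S \<and> (\<forall>x'\<in>S. F x' \<in> t)" by blast
    qed
  qed
  then show ?thesis using F(2) nz eig f(5) by blast
qed

end

section \<open>Contracting automorphisms\<close>

context chart_group
begin

text \<open>Every point has a translated ball with at most one element of \<open>\<Gamma>\<close>,
  because quotients of two such elements fall into the neighbourhood that isolates the identity;
  finitely many of these balls cover \<open>K\<close>.\<close>

lemma discrete_subgroup_compact_finite:
  assumes \<Gamma>: "subgroup \<Gamma> L" "discrete \<Gamma>" and K: "compact K"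
  shows "finite (\<Gamma> \<inter> K)"
proof -
  have "\<one> isolated_in \<Gamma>" using discreteD[OF \<Gamma>(2) subgroup.one_closed[OF \<Gamma>(1)]] .
  then obtain W where W: "open W" "W \<inter> \<Gamma> = {\<one>}" unfolding isolated_in_def by blast
  then obtain \<delta>0 where \<delta>0: "\<delta>0 > 0" "nbhd \<delta>0 \<subseteq> W" using nbhd_base[of W] by blast
  have "continuous_on UNIV (\<lambda>(x, y). inv x \<otimes> y)"
    unfolding case_prod_unfold by (intro continuous_on_mult continuous_on_inv continuous_intros)
  then obtain \<delta> where \<delta>: "\<delta> > 0" "\<forall>x\<in>nbhd \<delta>. \<forall>y\<in>nbhd \<delta>. inv x \<otimes> y \<in> nbhd \<delta>0"
    using nbhd_base2[of "\<lambda>x y. inv x \<otimes> y" \<delta>0] \<delta>0 by auto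
  define V where "V x = (\<lambda>y. inv x \<otimes> y) -` nbhd \<delta>" for x
  have oV: "open (V x)" for x unfolding V_def by (rule open_vimage[OF open_nbhd continuous_on_translate])
  have xV: "x \<in> V x" for x unfolding V_def using one_nbhd[OF \<delta>(1)] by simp
  have one: "y = y'" if "y \<in> V x \<inter> \<Gamma>" "y' \<in> V x \<inter> \<Gamma>" for x y y'
  proof -
    have "inv (inv x \<otimes> y) \<otimes> (inv x \<otimes> y') \<in> nbhd \<delta>0" using that \<delta>(2) by (auto simp: V_def)
    then have "inv y \<otimes> y' \<in> W" using \<delta>0(2) by (auto simp: inv_mult_group m_assoc)
    moreover have "inv y \<otimes> y' \<in> \<Gamma>"
      using that subgroup.m_closed[OF \<Gamma>(1)] subgroup.m_inv_closed[OF \<Gamma>(1)] by auto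
    ultimately have "inv y \<otimes> y' = \<one>" using W(2) by blast
    then show ?thesis using mult_inv_cancel(1)[of y y'] by simp
  qed
  have cover: "K \<subseteq> (\<Union>x\<in>UNIV. V x)" using xV by auto
  obtain I where I: "finite I" "K \<subseteq> (\<Union>x\<in>I. V x)"
    by (rule compactE_image[OF K oV cover])
  have fin: "finite (V x \<inter> \<Gamma>)" for x
  proof (cases "V x \<inter> \<Gamma> = {}")
    case False
    then obtain y where "y \<in> V x \<inter> \<Gamma>" by blast
    then have "V x \<inter> \<Gamma> \<subseteq> {y}" using one by blast
    then show ?thesis using finite_subset by blast
  qed simp
  have "\<Gamma> \<inter> K \<subseteq> (\<Union>x\<in>I. V x \<inter> \<Gamma>)" using I(2) by blast
  then show ?thesis using I(1) fin finite_subset by blast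
qed

end

context chart_automorphism
begin

section \<open>Iterates of an automorphism near the identity\<close>

lemma \<Phi>n_mult: "(\<Phi> ^^ n) (x \<otimes> y) = (\<Phi> ^^ n) x \<otimes> (\<Phi> ^^ n) y"
  by (induction n) (simp_all add: \<Phi>_mult)
lemma \<Phi>n_one: "(\<Phi> ^^ n) \<one> = \<one>"
  by (induction n) (simp_all add: \<Phi>_one)
lemma \<Phi>n_inv: "(\<Phi> ^^ n) (inv x) = inv ((\<Phi> ^^ n) x)"
  by (induction n) (simp_all add: \<Phi>_inv)

lemma \<Phi>n_deriv:
  "\<epsilon> > 0 \<Longrightarrow> \<exists>\<delta>>0. \<forall>x\<in>nbhd \<delta>. (\<Phi> ^^ n) x \<in> U \<and> norm (\<kappa> ((\<Phi> ^^ n) x) - (T ^^ n) (\<kappa> x)) \<le> \<epsilon> * size x"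
proof (induction n arbitrary: \<epsilon>)
  case 0
  then show ?case using R_pos by (intro exI[of _ R]) (auto simp: nbhd_def)
next
  case (Suc n)
  obtain K where K: "K > 0" "\<And>x. norm ((T ^^ n) x) \<le> norm x * K"
    using bounded_linear.pos_bounded[OF finite_dim_linear_bounded[OF fd linear_Tn]] by blast
  obtain KT where KT: "KT > 0" "\<And>x. norm (T x) \<le> norm x * KT" using bounded_linear.pos_bounded[OF bounded_T] by blast
  define P where "P = K + 1"
  have P: "P > 0" unfolding P_def using K by simp
  define e1 where "e1 = \<epsilon> / (2 * P)"
  define e2 where "e2 = min 1 (\<epsilon> / (2 * KT))"
  have e: "e1 > 0" "e2 > 0" "e2 \<le> 1" "e2 \<le> \<epsilon> / (2 * KT)" unfolding e1_def e2_def using P KT Suc.prems by auto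
  obtain a where a: "a > 0" "\<forall>x\<in>nbhd a. \<Phi> x \<in> U \<and> norm (\<kappa> (\<Phi> x) - T (\<kappa> x)) \<le> e1 * size x" using \<Phi>_deriv[OF e(1)] by blast
  obtain b where b: "b > 0" "\<forall>x\<in>nbhd b. (\<Phi> ^^ n) x \<in> U \<and> norm (\<kappa> ((\<Phi> ^^ n) x) - (T ^^ n) (\<kappa> x)) \<le> e2 * size x"
    using Suc.IH[OF e(2)] by blast
  define \<delta> where "\<delta> = min b (a / P)"
  have \<delta>: "\<delta> > 0" "\<delta> \<le> b" "\<delta> \<le> a / P" unfolding \<delta>_def using a b P by auto
  have "(\<Phi> ^^ Suc n) x \<in> U \<and> norm (\<kappa> ((\<Phi> ^^ Suc n) x) - (T ^^ Suc n) (\<kappa> x)) \<le> \<epsilon> * size x" if x: "x \<in> nbhd \<delta>" for x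
  proof -
    define y where "y = (\<Phi> ^^ n) x"
    have y: "y \<in> U" "norm (\<kappa> y - (T ^^ n) (\<kappa> x)) \<le> e2 * size x" using b(2) x nbhd_mono[OF \<delta>(2)] unfolding y_def by auto
    have "e2 * size x \<le> 1 * size x" using e by (intro mult_right_mono) auto
    then have sy: "size y \<le> P * size x"
      using norm_triangle_sub[of "\<kappa> y" "(T ^^ n) (\<kappa> x)"] y(2) K(2)[of "\<kappa> x"] by (simp add: P_def algebra_simps)
    have "P * size x < P * (a / P)" using x \<delta>(3) P by (intro mult_strict_left_mono) (auto simp: nbhd_def)
    then have "y \<in> nbhd a" using y(1) sy P by (simp add: nbhd_def)
    then have 1: "\<Phi> y \<in> U" "norm (\<kappa> (\<Phi> y) - T (\<kappa> y)) \<le> e1 * size y" using a(2) by auto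
    have "e1 * size y \<le> e1 * (P * size x)" using sy e by (intro mult_left_mono) auto
    also have "\<dots> = \<epsilon> / 2 * size x" unfolding e1_def using P by simp
    finally have 2: "norm (\<kappa> (\<Phi> y) - T (\<kappa> y)) \<le> \<epsilon> / 2 * size x" using 1 by simp
    have "norm (T (\<kappa> y) - T ((T ^^ n) (\<kappa> x))) = norm (T (\<kappa> y - (T ^^ n) (\<kappa> x)))" by (simp add: linear_diff[OF T])
    also have "\<dots> \<le> (e2 * size x) * KT" using order_trans[OF KT(2) mult_right_mono[OF y(2)]] KT(1) by simp
    also have "\<dots> = (e2 * KT) * size x" by simp
    also have "\<dots> \<le> \<epsilon> / 2 * size x"
      using e(4) KT(1) by (intro mult_right_mono) (simp_all add: field_simps)
    finally have 3: "norm (T (\<kappa> y) - T ((T ^^ n) (\<kappa> x))) \<le> \<epsilon> / 2 * size x" .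
    have "norm (\<kappa> (\<Phi> y) - T ((T ^^ n) (\<kappa> x))) \<le> \<epsilon> * size x"
      using norm_triangle_ineq[of "\<kappa> (\<Phi> y) - T (\<kappa> y)" "T (\<kappa> y) - T ((T ^^ n) (\<kappa> x))"] 2 3 by simp
    then show ?thesis using 1(1) by (simp add: y_def)
  qed
  then show ?case using \<delta>(1) by blast
qed

lemma \<Phi>n_bounded:
  "\<exists>A>0. \<exists>\<delta>>0. \<forall>x\<in>nbhd \<delta>. (\<Phi> ^^ n) x \<in> U \<and> size ((\<Phi> ^^ n) x) \<le> A * size x"
proof -
  obtain K where K: "K > 0" "\<And>x. norm ((T ^^ n) x) \<le> norm x * K"
    using bounded_linear.pos_bounded[OF finite_dim_linear_bounded[OF fd linear_Tn]] by blast
  obtain b where b: "b > 0" "\<forall>x\<in>nbhd b. (\<Phi> ^^ n) x \<in> U \<and> norm (\<kappa> ((\<Phi> ^^ n) x) - (T ^^ n) (\<kappa> x)) \<le> 1 * size x"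
    using \<Phi>n_deriv[of 1 n] by auto
  have "size ((\<Phi> ^^ n) x) \<le> (K + 1) * size x" if "x \<in> nbhd b" for x
    using norm_triangle_sub[of "\<kappa> ((\<Phi> ^^ n) x)" "(T ^^ n) (\<kappa> x)"] K(2)[of "\<kappa> x"] b(2) that by (fastforce simp: algebra_simps)
  then show ?thesis using b K(1) by (intro exI[of _ "K + 1"] conjI exI[of _ b]) auto
qed

text \<open>Some \<open>\<Phi> ^^ p\<close> halves sizes near the identity: a quarter comes from
  \<open>T ^^ p\<close> and a quarter from the linearisation error. The fewer than \<open>p\<close>
  remaining iterations cost the constant \<open>A0\<close>.\<close>

lemma local_contraction:
  assumes sr: "complex_spectral_radius T < 1"
  shows "\<exists>A \<rho> r. A > 0 \<and> 0 < \<rho> \<and> \<rho> < 1 \<and> r > 0 \<and>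
    (\<forall>x\<in>nbhd r. \<forall>n. (\<Phi> ^^ n) x \<in> U \<and> size ((\<Phi> ^^ n) x) \<le> A * \<rho> ^ n * size x)"
proof -
  obtain p where p: "p > 0" "\<forall>x. norm ((T ^^ p) x) \<le> 1/4 * norm x"
    using powers_uniformly_small[of "1/4"] sr complex_spectral_radius_less_1_iff by auto
  obtain d where d: "d > 0" "\<forall>x\<in>nbhd d. (\<Phi> ^^ p) x \<in> U \<and> norm (\<kappa> ((\<Phi> ^^ p) x) - (T ^^ p) (\<kappa> x)) \<le> (1/4) * size x"
    using \<Phi>n_deriv[of "1/4" p] by auto
  have half: "(\<Phi> ^^ p) x \<in> U \<and> size ((\<Phi> ^^ p) x) \<le> (1/2) * size x" if "x \<in> nbhd d" for x
  proof -
    have "(\<Phi> ^^ p) x \<in> U" "norm (\<kappa> ((\<Phi> ^^ p) x) - (T ^^ p) (\<kappa> x)) \<le> (1/4) * size x" using d(2) that by auto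
    then show ?thesis
      using norm_triangle_sub[of "\<kappa> ((\<Phi> ^^ p) x)" "(T ^^ p) (\<kappa> x)"] p(2)[rule_format, of "\<kappa> x"] by simp
  qed
  obtain A r where Ar: "\<And>j. A j > 0" "\<And>j. r j > 0" "\<And>j x. x \<in> nbhd (r j) \<Longrightarrow> (\<Phi> ^^ j) x \<in> U \<and> size ((\<Phi> ^^ j) x) \<le> A j * size x"
    using \<Phi>n_bounded by metis
  define A0 where "A0 = Max (A ` {..<p})"
  define r0 where "r0 = min d (Min (r ` {..<p}))"
  have A0: "A j \<le> A0" if "j < p" for j unfolding A0_def using that by (intro Max_ge) auto
  have A0_pos: "A0 > 0" using A0[OF p(1)] Ar(1)[of 0] by linarith
  have r0: "r0 > 0" 
  proof -
    have "Min (r ` {..<p}) > 0" using Ar(2) p(1) by (subst Min_gr_iff) (auto simp: lessThan_empty_iff)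
    then show ?thesis unfolding r0_def using d by simp
  qed
  have r0_le: "r0 \<le> d" "\<And>j. j < p \<Longrightarrow> r0 \<le> r j"
    unfolding r0_def by (auto intro!: min.coboundedI2)
  \<comment> \<open>The rate per iteration when a halving takes \<open>p\<close> of them.\<close>
  define \<rho> where "\<rho> = root p (1/2)"
  have \<rho>: "0 < \<rho>" "\<rho> < 1" "\<rho> ^ p = 1/2"
    unfolding \<rho>_def using p(1) real_root_less_mono[of p "1/2" 1] by auto
  have iter: "((\<Phi> ^^ p) ^^ q) x \<in> nbhd r0 \<and> size (((\<Phi> ^^ p) ^^ q) x) \<le> (1/2) ^ q * size x" if x: "x \<in> nbhd r0" for x q
  proof (induction q)
    case 0 then show ?case using x by simp
  next
    case (Suc q)
    then have y: "((\<Phi> ^^ p) ^^ q) x \<in> nbhd r0" "size (((\<Phi> ^^ p) ^^ q) x) \<le> (1/2) ^ q * size x" by auto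
    then have h: "(\<Phi> ^^ p) (((\<Phi> ^^ p) ^^ q) x) \<in> U" "size ((\<Phi> ^^ p) (((\<Phi> ^^ p) ^^ q) x)) \<le> (1/2) * size (((\<Phi> ^^ p) ^^ q) x)"
      using half nbhd_mono[OF r0_le(1)] by auto
    moreover have "(1/2) * size (((\<Phi> ^^ p) ^^ q) x) < r0" using y(1) r0 by (simp add: nbhd_def)
    ultimately show ?case using y(2) by (simp add: nbhd_def)
  qed
  have "(\<Phi> ^^ n) x \<in> U \<and> size ((\<Phi> ^^ n) x) \<le> (2 * A0) * \<rho> ^ n * size x" if x: "x \<in> nbhd r0" for x n
  proof -
    define q j where "q = n div p" and "j = n mod p"
    have j: "j < p" "n = j + p * q" unfolding j_def q_def using p(1) by auto
    define y where "y = ((\<Phi> ^^ p) ^^ q) x"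
    have y: "y \<in> nbhd r0" "size y \<le> (1/2) ^ q * size x" using iter[OF x] by (auto simp: y_def)
    have n: "(\<Phi> ^^ n) x = (\<Phi> ^^ j) y" unfolding y_def j(2) by (simp add: funpow_add funpow_mult mult.commute)
    have U: "(\<Phi> ^^ j) y \<in> U" "size ((\<Phi> ^^ j) y) \<le> A j * size y" using Ar(3)[of y j] y(1) nbhd_mono[OF r0_le(2)[OF j(1)]] by auto
    have "A j * size y \<le> A0 * ((1/2) ^ q * size x)" using y(2) A0[OF j(1)] A0_pos by (intro mult_mono) auto
    \<comment> \<open>Rounding \<open>n\<close> down to a multiple of \<open>p\<close> costs at most
      the factor 2, as \<open>\<rho> ^ j \<ge> \<rho> ^ p = 1/2\<close>.\<close>
    also have "(1/2) ^ q \<le> 2 * \<rho> ^ n"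
    proof -
      have "\<rho> ^ p \<le> \<rho> ^ j" using \<rho> j(1) by (intro power_decreasing) auto
      then have "1 \<le> 2 * \<rho> ^ j" using \<rho>(3) by simp
      then have "(1/2) ^ q * 1 \<le> (1/2) ^ q * (2 * \<rho> ^ j)" by (intro mult_left_mono) auto
      then show ?thesis unfolding j(2) power_add power_mult \<rho>(3) by (simp add: mult_ac)
    qed
    finally have "A j * size y \<le> A0 * ((2 * \<rho> ^ n) * size x)" using A0_pos by (simp add: mult_left_mono mult_right_mono)
    then show ?thesis using U n by (simp add: mult_ac)
  qed
  then show ?thesis using A0_pos \<rho> r0 by (intro exI[of _ "2 * A0"] exI[of _ \<rho>] exI[of _ r0]) auto
qed

text \<open>The state of \<open>g\<close> at a word of length \<open>n\<close> is \<open>a\<inverse> \<Phi>\<^sup>n(g) b\<close> for some \<open>a, b\<close> in \<open>prods D n\<close>, where \<open>D\<close> is the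
  set of digits.\<close>

primrec prods :: "'l set \<Rightarrow> nat \<Rightarrow> 'l set" where
  "prods D 0 = {\<one>}"
| "prods D (Suc n) = (\<lambda>(d, a). (\<Phi> ^^ Suc n) d \<otimes> a) ` (D \<times> prods D n)"

lemma finite_prods: "finite D \<Longrightarrow> finite (prods D n)"
  by (induction n) auto

text \<open>A product splits into a tail of factors with index above \<open>N\<close>, whose size is
  bounded by a geometric series, and a head from the finite set \<open>prods D N\<close>. Short
  words give finitely many values, long ones lie in a continuous image of a compact set.\<close>

lemma products_relatively_compact:
  assumes sr: "complex_spectral_radius T < 1" and conn: "connected (UNIV :: 'l set)" and D: "finite D"
  shows "\<exists>K. compact K \<and> (\<forall>n. \<forall>a\<in>prods D n. \<forall>b\<in>prods D n. inv a \<otimes> (\<Phi> ^^ n) g \<otimes> b \<in> K)"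
proof -
  obtain A0 \<rho> r where A0: "A0 > 0" "0 < \<rho>" "\<rho> < 1" "r > 0"
    "\<forall>x\<in>nbhd r. \<forall>n. (\<Phi> ^^ n) x \<in> U \<and> size ((\<Phi> ^^ n) x) \<le> A0 * \<rho> ^ n * size x"
    using local_contraction[OF sr] by blast
  have pow_small: "\<forall>\<^sub>F n in sequentially. B * \<rho> ^ n < \<delta>" if "\<delta> > 0" for B \<delta>
  proof -
    have "(\<lambda>n. B * \<rho> ^ n) \<longlonglongrightarrow> B * 0" using A0 by (intro tendsto_mult tendsto_const LIMSEQ_power_zero) auto
    then show ?thesis using that order_tendstoD(2)[of _ 0] by simp
  qed
  \<comment> \<open>Only eventually, since early iterates may lie outside the chart. The elements
    with some constant \<open>A\<close> form a subgroup containing a neighbourhood of the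
    identity.\<close>
  define good where "good A x \<longleftrightarrow> (\<forall>\<^sub>F n in sequentially. (\<Phi> ^^ n) x \<in> U \<and> size ((\<Phi> ^^ n) x) \<le> A * \<rho> ^ n)" for A x
  have good_small: "\<forall>\<^sub>F n in sequentially. (\<Phi> ^^ n) x \<in> nbhd \<delta>" if "good A x" "\<delta> > 0" for A x \<delta>
    using that(1)[unfolded good_def] pow_small[OF that(2), of A] by eventually_elim (auto simp: nbhd_def)
  have "{x. \<exists>A. good A x} = UNIV"
  proof (rule open_subgroup_UNIV[OF conn _ _ _ A0(4)])
    show "\<one> \<in> {x. \<exists>A. good A x}" by (auto simp: good_def \<Phi>n_one one_U intro!: exI[of _ 0])
    show "nbhd r \<subseteq> {x. \<exists>A. good A x}"
    proof
      fix x assume "x \<in> nbhd r"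
      then have "good (A0 * size x) x" unfolding good_def using A0(5) by (simp add: mult_ac)
      then show "x \<in> {x. \<exists>A. good A x}" by blast
    qed
    fix x y assume "x \<in> {x. \<exists>A. good A x}" "y \<in> {x. \<exists>A. good A x}"
    then obtain A B where AB: "good A x" "good B y" by blast
    have "good (A + 2 * B) (x \<otimes> y)"
      unfolding good_def using AB[unfolded good_def] good_small[OF AB(1) R_pos] good_small[OF AB(2) R_pos]
    proof eventually_elim
      case (elim n)
      then have "size ((\<Phi> ^^ n) x \<otimes> (\<Phi> ^^ n) y) \<le> A * \<rho> ^ n + 2 * (B * \<rho> ^ n)"
        using mult_diff(3)[of "(\<Phi> ^^ n) x" "(\<Phi> ^^ n) y"] by linarith
      then show ?case using elim quasi_U by (simp add: \<Phi>n_mult nbhd_def algebra_simps)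
    qed
    then show "x \<otimes> y \<in> {x. \<exists>A. good A x}" by blast
  next
    fix x assume "x \<in> {x. \<exists>A. good A x}"
    then obtain A where A: "good A x" by blast
    have "good (2 * A) (inv x)"
      unfolding good_def using A[unfolded good_def] good_small[OF A rad(1)]
    proof eventually_elim
      case (elim n)
      then show ?case using size_inv[of "(\<Phi> ^^ n) x"] by (auto simp: \<Phi>n_inv nbhd_def)
    qed
    then show "inv x \<in> {x. \<exists>A. good A x}" by blast
  qed
  then have "\<exists>A. good A x" for x by blast
  then obtain A where A: "\<And>x. good (A x) x" by metis
  \<comment> \<open>Half the radius, so that the closed ball stays inside the open ball on which
    \<open>\<eta>\<close> is continuous.\<close>
  define s where "s = R / 2"
  have s: "0 < s" "s < R" unfolding s_def using R_pos by auto
  define cl where "cl = \<eta> ` cball 0 s"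
  have ccl: "compact cl"
    unfolding cl_def
    by (intro compact_continuous_image finite_dim_cball_compact[OF fd] continuous_on_subset[OF continuous_\<eta>])
      (use s in auto)
  have cl_I: "x \<in> cl" if "x \<in> U" "size x \<le> s" for x
    unfolding cl_def using that \<eta>_\<kappa> by (intro image_eqI[of _ _ "\<kappa> x"]) auto
  define B where "B = (\<Sum>d\<in>D. \<bar>A d\<bar>)"
  have B: "A d \<le> B" if "d \<in> D" for d
  proof -
    have "\<bar>A d\<bar> \<le> B" unfolding B_def by (rule member_le_sum) (use that D in auto)
    then show ?thesis by linarith
  qed
  have B0: "B \<ge> 0" unfolding B_def by (intro sum_nonneg) auto
  \<comment> \<open>Makes \<open>c * (\<rho> ^ n - \<rho> ^ Suc n) = 2 * (B * \<rho> ^ n)\<close>,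
    so that the bounds in \<open>decomp\<close> telescope; the 2 comes from
    \<open>mult_diff\<close>.\<close>
  define c where "c = 2 * B / (1 - \<rho>)"
  have c0: "c \<ge> 0" unfolding c_def using B0 A0 by simp
  have "\<forall>\<^sub>F n in sequentially. (\<forall>d\<in>D. (\<Phi> ^^ n) d \<in> nbhd R \<and> size ((\<Phi> ^^ n) d) \<le> B * \<rho> ^ n) \<and>
      (\<Phi> ^^ n) g \<in> nbhd s \<and> c * \<rho> ^ n < s"
  proof (intro eventually_conj)
    show "\<forall>\<^sub>F n in sequentially. \<forall>d\<in>D. (\<Phi> ^^ n) d \<in> nbhd R \<and> size ((\<Phi> ^^ n) d) \<le> B * \<rho> ^ n"
    proof (rule eventually_ball_finite[OF D], rule ballI)
      fix d assume d: "d \<in> D"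
      show "\<forall>\<^sub>F n in sequentially. (\<Phi> ^^ n) d \<in> nbhd R \<and> size ((\<Phi> ^^ n) d) \<le> B * \<rho> ^ n"
        using good_small[OF A R_pos, of d] A[of d, unfolded good_def]
      proof eventually_elim
        case (elim n)
        have "A d * \<rho> ^ n \<le> B * \<rho> ^ n" using B[OF d] A0 by (intro mult_right_mono) auto
        then show ?case using elim by auto
      qed
    qed
  qed (use good_small[OF A s(1)] pow_small[OF s(1)] in auto)
  then obtain N where N: "\<And>n d. n \<ge> N \<Longrightarrow> d \<in> D \<Longrightarrow> (\<Phi> ^^ n) d \<in> nbhd R \<and> size ((\<Phi> ^^ n) d) \<le> B * \<rho> ^ n"
    "\<And>n. n \<ge> N \<Longrightarrow> (\<Phi> ^^ n) g \<in> nbhd s" "c * \<rho> ^ N < s"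
    unfolding eventually_sequentially by blast
  have decomp: "\<exists>z a0. a = z \<otimes> a0 \<and> a0 \<in> prods D N \<and> z \<in> U \<and> size z \<le> c * (\<rho> ^ N - \<rho> ^ n)"
    if "n \<ge> N" "a \<in> prods D n" for n a
    using that
  proof (induction n arbitrary: a rule: dec_induct)
    case base
    then show ?case by (intro exI[of _ \<one>] exI[of _ a]) (simp add: one_U)
  next
    case (step n)
    then obtain d a' where a: "a = (\<Phi> ^^ Suc n) d \<otimes> a'" "d \<in> D" "a' \<in> prods D n" by auto
    from step.IH[OF a(3)] obtain z a0 where z: "a' = z \<otimes> a0" "a0 \<in> prods D N" "z \<in> U" "size z \<le> c * (\<rho> ^ N - \<rho> ^ n)"
      by blast
    define y where "y = (\<Phi> ^^ Suc n) d"
    have y: "y \<in> nbhd R" "size y \<le> B * \<rho> ^ Suc n" using N(1)[of "Suc n" d] a(2) step(1) unfolding y_def by auto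
    have "c * (\<rho> ^ N - \<rho> ^ n) \<le> c * \<rho> ^ N" using c0 A0 by (intro mult_left_mono) auto
    then have zR: "z \<in> nbhd R" using z N(3) s by (auto simp: nbhd_def)
    have "B * \<rho> ^ Suc n \<le> B * \<rho> ^ n" using B0 A0 by (intro mult_left_mono power_decreasing) auto
    then have "size (y \<otimes> z) \<le> c * (\<rho> ^ N - \<rho> ^ n) + 2 * (B * \<rho> ^ n)"
      using mult_diff(4)[OF y(1) zR] y(2) z(4) by linarith
    also have "2 * (B * \<rho> ^ n) = c * (\<rho> ^ n - \<rho> ^ Suc n)"
      unfolding c_def using A0 by (simp add: field_simps)
    also have "c * (\<rho> ^ N - \<rho> ^ n) + c * (\<rho> ^ n - \<rho> ^ Suc n) = c * (\<rho> ^ N - \<rho> ^ Suc n)" by (simp add: algebra_simps)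
    finally have "size (y \<otimes> z) \<le> c * (\<rho> ^ N - \<rho> ^ Suc n)" .
    moreover have "y \<otimes> z \<in> U" using quasi_U y zR by (auto simp: nbhd_def)
    moreover have "a = (y \<otimes> z) \<otimes> a0" unfolding a(1) z(1) y_def by (simp add: m_assoc)
    ultimately show ?case using z(2) by blast
  qed
  have decomp_cl: "\<exists>z\<in>cl. \<exists>a0\<in>prods D N. a = z \<otimes> a0" if na: "n \<ge> N" "a \<in> prods D n" for n a
  proof -
    obtain z a0 where z: "a = z \<otimes> a0" "a0 \<in> prods D N" "z \<in> U" "size z \<le> c * (\<rho> ^ N - \<rho> ^ n)" using decomp[OF na] by blast
    have "c * (\<rho> ^ N - \<rho> ^ n) \<le> c * \<rho> ^ N" using c0 A0 by (intro mult_left_mono) auto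
    then have "z \<in> cl" using z N(3) by (intro cl_I) auto
    then show ?thesis using z by blast
  qed
  define K0 where "K0 = (\<Union>n<N. (\<lambda>(a, b). inv a \<otimes> (\<Phi> ^^ n) g \<otimes> b) ` (prods D n \<times> prods D n))"
  define K1 where "K1 = (\<Union>(a, b)\<in>prods D N \<times> prods D N.
      (\<lambda>(z, y, w). inv (z \<otimes> a) \<otimes> y \<otimes> (w \<otimes> b)) ` (cl \<times> cl \<times> cl))"
  have "finite K0" unfolding K0_def using finite_prods[OF D] by auto
  then have "compact K0" by (rule finite_imp_compact)
  moreover have "compact K1"
    unfolding K1_def
  proof (rule compact_UN)
    show "finite (prods D N \<times> prods D N)" using finite_prods[OF D] by blast
    fix ab assume "ab \<in> prods D N \<times> prods D N"
    have "compact ((\<lambda>(z, y, w). inv (z \<otimes> a) \<otimes> y \<otimes> (w \<otimes> b)) ` (cl \<times> cl \<times> cl))" for a b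
      unfolding case_prod_unfold
      by (intro compact_continuous_image compact_Times ccl continuous_on_mult continuous_on_inv continuous_intros)
    then show "compact (case ab of (a, b) \<Rightarrow> (\<lambda>(z, y, w). inv (z \<otimes> a) \<otimes> y \<otimes> (w \<otimes> b)) ` (cl \<times> cl \<times> cl))"
      by (cases ab) simp
  qed
  ultimately have "compact (K0 \<union> K1)" by (rule compact_Un)
  moreover have "inv a \<otimes> (\<Phi> ^^ n) g \<otimes> b \<in> K0 \<union> K1" if ab: "a \<in> prods D n" "b \<in> prods D n" for n a b
  proof (cases "n < N")
    case True
    then show ?thesis unfolding K0_def using ab by auto
  next
    case False
    then have n: "n \<ge> N" by simp
    obtain z a0 where z: "z \<in> cl" "a0 \<in> prods D N" "a = z \<otimes> a0" using decomp_cl[OF n ab(1)] by blast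
    obtain w b0 where w: "w \<in> cl" "b0 \<in> prods D N" "b = w \<otimes> b0" using decomp_cl[OF n ab(2)] by blast
    have y: "(\<Phi> ^^ n) g \<in> cl" using N(2)[OF n] by (intro cl_I) (auto simp: nbhd_def)
    have "inv a \<otimes> (\<Phi> ^^ n) g \<otimes> b \<in> (\<lambda>(z, y, w). inv (z \<otimes> a0) \<otimes> y \<otimes> (w \<otimes> b0)) ` (cl \<times> cl \<times> cl)"
      unfolding z(3) w(3) using z(1) w(1) y by (intro image_eqI[of _ _ "(z, (\<Phi> ^^ n) g, w)"]) auto
    then show ?thesis unfolding K1_def using z(2) w(2) by blast
  qed
  ultimately show ?thesis by blast
qed

end

section \<open>Self-similar actions\<close>

text \<open>The variance: the sum of \<open>(cmod (z x - w))\<^sup>2\<close> equals the sum of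
  \<open>(cmod (z x))\<^sup>2\<close> minus \<open>card X * (cmod w)\<^sup>2\<close>, and this is at
  most 0.\<close>

lemma equal_if_sum_norm_maximal:
  fixes z :: "'x \<Rightarrow> complex"
  assumes X: "finite X" and z: "\<And>x. x \<in> X \<Longrightarrow> cmod (z x) \<le> m" and w: "(\<Sum>x\<in>X. z x) = of_nat (card X) * w" "m \<le> cmod w"
    and x: "x \<in> X"
  shows "z x = w"
proof -
  have m: "0 \<le> m" using z[OF x] norm_ge_zero order_trans by blast
  have sq: "(cmod (a - w))\<^sup>2 = (cmod a)\<^sup>2 + (cmod w)\<^sup>2 - 2 * Re (a * cnj w)" for a
    by (simp only: cmod_power2) (simp add: power2_eq_square algebra_simps)
  have "(\<Sum>x\<in>X. (cmod (z x - w))\<^sup>2) = (\<Sum>x\<in>X. (cmod (z x))\<^sup>2) + card X * (cmod w)\<^sup>2 - 2 * Re ((\<Sum>x\<in>X. z x) * cnj w)"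
    by (simp add: sq sum.distrib sum_subtractf sum_distrib_left sum_distrib_right Re_sum)
  also have "Re ((\<Sum>x\<in>X. z x) * cnj w) = card X * (cmod w)\<^sup>2"
    unfolding w(1) cmod_power2 by (simp add: power2_eq_square algebra_simps)
  also have "(\<Sum>x\<in>X. (cmod (z x))\<^sup>2) \<le> (\<Sum>x\<in>X. (cmod w)\<^sup>2)"
    using z w(2) by (intro sum_mono power_mono) (auto intro: order_trans)
  finally have "(\<Sum>x\<in>X. (cmod (z x - w))\<^sup>2) \<le> 0" by simp
  then have "(cmod (z x - w))\<^sup>2 = 0"
    using X x by (metis (no_types, lifting) sum_nonneg_0 order_antisym sum_nonneg zero_le_power2)
  then show ?thesis by simp
qed

section \<open>Cosets of the domain of a virtual endomorphism\<close>

locale virtual_endo = group G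
  for G :: "('g, 'm) monoid_scheme" (structure) +
  fixes H :: "'g set" and \<phi> :: "'g \<Rightarrow> 'g"
  assumes virtual: "virtual_endomorphism G H \<phi>"
begin

lemma subgroup_H: "subgroup H G" using virtual by (simp add: virtual_endomorphism_def)

lemma H_carrier: "h \<in> H \<Longrightarrow> h \<in> carrier G" using subgroup.mem_carrier[OF subgroup_H] .

lemma \<phi>_closed: "h \<in> H \<Longrightarrow> \<phi> h \<in> carrier G"
  and \<phi>_mult: "h \<in> H \<Longrightarrow> k \<in> H \<Longrightarrow> \<phi> (h \<otimes> k) = \<phi> h \<otimes> \<phi> k"
  using virtual by (auto simp: virtual_endomorphism_def hom_def)

lemma \<phi>_one: "\<phi> \<one> = \<one>"
proof -
  have "\<one> \<in> H" using subgroup.one_closed[OF subgroup_H] .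
  then have "\<phi> \<one> \<otimes> \<phi> \<one> = \<phi> \<one>" "\<phi> \<one> \<in> carrier G" using \<phi>_mult[of \<one> \<one>] \<phi>_closed by auto
  then show ?thesis using l_cancel_one by blast
qed

lemma cancel: "x \<in> carrier G \<Longrightarrow> y \<in> carrier G \<Longrightarrow> x \<otimes> (inv x \<otimes> y) = y"
  "x \<in> carrier G \<Longrightarrow> y \<in> carrier G \<Longrightarrow> inv x \<otimes> (x \<otimes> y) = y"
  by (simp_all add: m_assoc[symmetric])

lemma lcoset_mem: "x \<in> a <# H \<longleftrightarrow> (\<exists>h\<in>H. x = a \<otimes> h)"
  by (auto simp: l_coset_def)

lemma lcoset_eq:
  assumes "a \<in> carrier G" "b \<in> carrier G"
  shows "a <# H = b <# H \<longleftrightarrow> inv a \<otimes> b \<in> H"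
proof
  assume "a <# H = b <# H"
  moreover have "b \<in> b <# H" using assms subgroup.one_closed[OF subgroup_H] by (force simp: lcoset_mem)
  ultimately have "b \<in> a <# H" by blast
  then obtain h where "h \<in> H" "b = a \<otimes> h" by (auto simp: lcoset_mem)
  then show "inv a \<otimes> b \<in> H" using assms H_carrier by (simp add: cancel)
next
  assume h: "inv a \<otimes> b \<in> H"
  have sub: "c <# H \<subseteq> d <# H" if "c \<in> carrier G" "d \<in> carrier G" "inv d \<otimes> c \<in> H" for c d
  proof
    fix x assume "x \<in> c <# H"
    then obtain k where k: "k \<in> H" "x = c \<otimes> k" by (auto simp: lcoset_mem)
    then have "x = d \<otimes> (inv d \<otimes> c \<otimes> k)" using that H_carrier by (simp add: m_assoc cancel)
    then show "x \<in> d <# H" using k that subgroup.m_closed[OF subgroup_H] by (auto simp: lcoset_mem)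
  qed
  have "inv b \<otimes> a = inv (inv a \<otimes> b)" using assms by (simp add: inv_mult_group)
  then have "inv b \<otimes> a \<in> H" using subgroup.m_inv_closed[OF subgroup_H h] by simp
  then show "a <# H = b <# H" using sub assms h by blast
qed

text \<open>Finite index is given for right cosets, digits represent left cosets, and inversion
  exchanges the two.\<close>

lemma finite_lcosets: "finite ((\<lambda>g. g <# H) ` carrier G)"
proof -
  have "(\<lambda>g. g <# H) ` carrier G \<subseteq> (\<lambda>C. (\<lambda>x. inv x) ` C) ` (rcosets H)"
  proof (rule image_subsetI)
    fix g assume g: "g \<in> carrier G"
    have "g <# H = (\<lambda>x. inv x) ` (H #> inv g)"
    proof
      show "g <# H \<subseteq> (\<lambda>x. inv x) ` (H #> inv g)"
      proof
        fix x assume "x \<in> g <# H"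
        then obtain h where h: "h \<in> H" "x = g \<otimes> h" by (auto simp: lcoset_mem)
        have "x = inv (inv h \<otimes> inv g)" using g h H_carrier by (simp add: inv_mult_group)
        moreover have "inv h \<otimes> inv g \<in> H #> inv g"
          using h subgroup.m_inv_closed[OF subgroup_H] by (auto simp: r_coset_def)
        ultimately show "x \<in> (\<lambda>x. inv x) ` (H #> inv g)" by blast
      qed
      show "(\<lambda>x. inv x) ` (H #> inv g) \<subseteq> g <# H"
        using g H_carrier subgroup.m_inv_closed[OF subgroup_H]
        by (auto simp: r_coset_def lcoset_mem inv_mult_group)
    qed
    moreover have "H #> inv g \<in> rcosets H" using g by (auto simp: RCOSETS_def)
    ultimately show "g <# H \<in> (\<lambda>C. (\<lambda>x. inv x) ` C) ` (rcosets H)" by blast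
  qed
  moreover have "finite (rcosets H)" using virtual by (simp add: virtual_endomorphism_def)
  ultimately show ?thesis using finite_surj by blast
qed

end

section \<open>The self-similar action of a digit set\<close>

locale digit_action = virtual_endo G H \<phi>
  for G :: "('g, 'm) monoid_scheme" (structure) and H \<phi> +
  fixes X :: "'x set" and q :: "'x \<Rightarrow> 'g"
  assumes digits: "digit_set G H X q" and core: "is_virtual_core G H \<phi> {\<one>}"
begin

abbreviation "act \<equiv> associated_action G H \<phi> X q"

definition letter :: "'g \<Rightarrow> 'x \<Rightarrow> 'x" where
  "letter g x = (THE y. y \<in> X \<and> inv (q y) \<otimes> g \<otimes> q x \<in> H)"

definition state :: "'g \<Rightarrow> 'x \<Rightarrow> 'g" where
  "state g x = \<phi> (inv (q (letter g x)) \<otimes> g \<otimes> q x)"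

fun states :: "'g \<Rightarrow> 'x list \<Rightarrow> 'g" where
  "states g [] = g"
| "states g (x # v) = states (state g x) v"

lemma act_Cons: "act g (x # v) = letter g x # act (state g x) v"
  by (simp add: letter_def state_def Let_def)

declare associated_action.simps(2) [simp del]
declare act_Cons [simp]

lemma q_closed: "x \<in> X \<Longrightarrow> q x \<in> carrier G" using digits by (auto simp: digit_set_def)

lemma finite_X: "finite X"
  using digits finite_lcosets bij_betw_finite by (auto simp: digit_set_def)

lemma letter_ex1:
  assumes "g \<in> carrier G" "x \<in> X"
  shows "\<exists>!y. y \<in> X \<and> inv (q y) \<otimes> g \<otimes> q x \<in> H"
proof -
  have b: "bij_betw (\<lambda>x. q x <# H) X ((\<lambda>g. g <# H) ` carrier G)" using digits by (simp add: digit_set_def)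
  have c: "g \<otimes> q x \<in> carrier G" using assms q_closed by simp
  then have "(g \<otimes> q x) <# H \<in> (\<lambda>x. q x <# H) ` X" using b by (auto simp: bij_betw_def)
  then obtain y where y: "y \<in> X" "(g \<otimes> q x) <# H = q y <# H" by blast
  have eq: "inv (q y') \<otimes> g \<otimes> q x \<in> H \<longleftrightarrow> q y' <# H = (g \<otimes> q x) <# H" if "y' \<in> X" for y'
    using lcoset_eq[OF q_closed[OF that] c] assms q_closed that by (simp add: m_assoc)
  show ?thesis
  proof (rule ex1I)
    show "y \<in> X \<and> inv (q y) \<otimes> g \<otimes> q x \<in> H" using y eq by simp
    fix y' assume "y' \<in> X \<and> inv (q y') \<otimes> g \<otimes> q x \<in> H"
    then have "y' \<in> X" "q y' <# H = q y <# H" using eq y by auto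
    then show "y' = y" using b y(1) by (auto simp: bij_betw_def inj_on_def)
  qed
qed

lemma letter:
  assumes "g \<in> carrier G" "x \<in> X"
  shows "letter g x \<in> X" "inv (q (letter g x)) \<otimes> g \<otimes> q x \<in> H"
  using theI'[OF letter_ex1[OF assms]] by (auto simp: letter_def)

lemma letter_eqI:
  assumes "g \<in> carrier G" "x \<in> X" "y \<in> X" "inv (q y) \<otimes> g \<otimes> q x \<in> H"
  shows "letter g x = y"
  using letter_ex1[OF assms(1,2)] letter[OF assms(1,2)] assms by blast

lemma state_closed: "g \<in> carrier G \<Longrightarrow> x \<in> X \<Longrightarrow> state g x \<in> carrier G"
  by (simp add: state_def \<phi>_closed letter)

lemma states_closed: "g \<in> carrier G \<Longrightarrow> v \<in> lists X \<Longrightarrow> states g v \<in> carrier G"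
  by (induction v arbitrary: g) (auto simp: state_closed)

lemma states_append: "states g (u @ v) = states (states g u) v"
  by (induction u arbitrary: g) auto

text \<open>The digit of the intermediate letter and its inverse are inserted; both factors lie in
  \<open>H\<close>, which yields the cocycle rules for letters and for states.\<close>

lemma letter_mult_aux:
  assumes "g \<in> carrier G" "h \<in> carrier G" "x \<in> X"
  shows "inv (q (letter g (letter h x))) \<otimes> (g \<otimes> h) \<otimes> q x =
    (inv (q (letter g (letter h x))) \<otimes> g \<otimes> q (letter h x)) \<otimes> (inv (q (letter h x)) \<otimes> h \<otimes> q x)"
  using assms letter(1) q_closed by (simp add: m_assoc cancel)

lemma letter_mult:
  assumes "g \<in> carrier G" "h \<in> carrier G" "x \<in> X"
  shows "letter (g \<otimes> h) x = letter g (letter h x)"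
  using assms letter letter_mult_aux subgroup.m_closed[OF subgroup_H] by (intro letter_eqI) auto

lemma state_mult:
  assumes "g \<in> carrier G" "h \<in> carrier G" "x \<in> X"
  shows "state (g \<otimes> h) x = state g (letter h x) \<otimes> state h x"
  unfolding state_def letter_mult[OF assms] letter_mult_aux[OF assms]
  using assms letter by (intro \<phi>_mult) auto

lemma letter_one: "x \<in> X \<Longrightarrow> letter \<one> x = x"
  using q_closed subgroup.one_closed[OF subgroup_H] by (intro letter_eqI) auto

lemma state_one: "x \<in> X \<Longrightarrow> state \<one> x = \<one>"
  using q_closed by (simp add: state_def letter_one \<phi>_one)

lemma act_closed: "g \<in> carrier G \<Longrightarrow> v \<in> lists X \<Longrightarrow> act g v \<in> lists X"
  by (induction v arbitrary: g) (auto simp: letter state_closed)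

lemma act_mult: "g \<in> carrier G \<Longrightarrow> h \<in> carrier G \<Longrightarrow> v \<in> lists X \<Longrightarrow> act (g \<otimes> h) v = act g (act h v)"
  by (induction v arbitrary: g h) (auto simp: letter state_closed letter_mult state_mult)

lemma act_one: "v \<in> lists X \<Longrightarrow> act \<one> v = v"
  by (induction v) (auto simp: letter_one state_one)

lemma act_inv: "g \<in> carrier G \<Longrightarrow> v \<in> lists X \<Longrightarrow> act (inv g) (act g v) = v"
  "g \<in> carrier G \<Longrightarrow> v \<in> lists X \<Longrightarrow> act g (act (inv g) v) = v"
  using act_mult[of "inv g" g v] act_mult[of g "inv g" v] by (auto simp: act_one)

lemma act_bij: "g \<in> carrier G \<Longrightarrow> bij_betw (act g) (lists X) (lists X)"
  using act_closed[of g] act_closed[of "inv g"]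
  by (intro bij_betw_byWitness[where f' = "act (inv g)"] ballI image_subsetI act_inv) blast+

lemma letter_bij:
  assumes "g \<in> carrier G"
  shows "bij_betw (letter g) X X"
proof (rule bij_betw_byWitness[where f' = "letter (inv g)"])
  show "\<forall>a\<in>X. letter (inv g) (letter g a) = a" "\<forall>a\<in>X. letter g (letter (inv g) a) = a"
    using assms by (simp_all add: letter_mult[symmetric] letter_one)
qed (use assms letter in auto)

lemma group_action_act: "group_action G (lists X) (\<lambda>g. restrict (act g) (lists X))"
proof -
  have B: "restrict (act g) (lists X) \<in> Bij (lists X)" if "g \<in> carrier G" for g
    using act_bij[OF that] unfolding Bij_def by (simp add: bij_betw_restrict_eq)
  have "(\<lambda>g. restrict (act g) (lists X)) \<in> hom G (BijGroup (lists X))"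
  proof (rule homI)
    show "restrict (act g) (lists X) \<in> carrier (BijGroup (lists X))" if "g \<in> carrier G" for g
      using B[OF that] by (simp add: BijGroup_def)
    show "restrict (act (g \<otimes> h)) (lists X) = restrict (act g) (lists X) \<otimes>\<^bsub>BijGroup (lists X)\<^esub> restrict (act h) (lists X)"
      if "g \<in> carrier G" "h \<in> carrier G" for g h
    proof -
      have "restrict (act (g \<otimes> h)) (lists X) = compose (lists X) (restrict (act g) (lists X)) (restrict (act h) (lists X))"
        unfolding compose_def using that act_mult act_closed by (intro restrict_ext) (simp del: in_listsI in_lists_conv_set)
      then show ?thesis using B that by (simp add: BijGroup_def)
    qed
  qed
  then show ?thesis
    using group_BijGroup by (auto simp: group_action_def group_hom_def group_hom_axioms_def)
qed

text \<open>The kernel of the action is a normal subgroup inside \<open>H\<close> that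
  \<open>\<phi>\<close> maps into itself, so it is contained in the core.\<close>

lemma trivial_kernel:
  assumes g: "g \<in> carrier G" "\<And>v. v \<in> lists X \<Longrightarrow> act g v = v"
  shows "g = \<one>"
proof -
  define K where "K = {g \<in> carrier G. \<forall>v\<in>lists X. act g v = v}"
  have sub: "subgroup K G"
  proof
    show "K \<subseteq> carrier G" by (auto simp: K_def)
    show "\<one> \<in> K" using act_one by (auto simp: K_def)
    show "x \<otimes> y \<in> K" if "x \<in> K" "y \<in> K" for x y
      using that by (simp add: K_def act_mult del: in_listsI in_lists_conv_set)
    show "inv x \<in> K" if "x \<in> K" for x
    proof -
      have "act (inv x) v = v" if v: "v \<in> lists X" for v
      proof -
        have x: "x \<in> carrier G" "act x v = v" using \<open>x \<in> K\<close> v by (simp_all add: K_def del: in_listsI in_lists_conv_set)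
        show ?thesis using act_inv(1)[OF x(1) v] x(2) by simp
      qed
      then show ?thesis using that by (simp add: K_def)
    qed
  qed
  have "K \<lhd> G"
    unfolding normal_inv_iff
  proof (intro conjI sub ballI)
    fix x k assume x: "x \<in> carrier G" and k: "k \<in> K"
    have kc: "k \<in> carrier G" "\<And>v. v \<in> lists X \<Longrightarrow> act k v = v" using k by (simp_all add: K_def del: in_listsI in_lists_conv_set)
    have "act (x \<otimes> k \<otimes> inv x) v = v" if v: "v \<in> lists X" for v
    proof -
      have "act (x \<otimes> k \<otimes> inv x) v = act x (act k (act (inv x) v))"
        using x kc(1) v by (simp add: act_mult act_closed del: in_listsI in_lists_conv_set)
      also have "\<dots> = v" using kc(2) x v by (simp add: act_closed act_inv del: in_listsI in_lists_conv_set)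
      finally show ?thesis .
    qed
    then show "x \<otimes> k \<otimes> inv x \<in> K" using x kc by (simp add: K_def)
  qed
  have "\<one> <# H \<in> (\<lambda>x. q x <# H) ` X" using digits by (auto simp: digit_set_def bij_betw_def)
  \<comment> \<open>The letter that stands for the coset \<open>H\<close> itself; its digit lies in
    \<open>H\<close>.\<close>
  then obtain x0 where x0: "x0 \<in> X" "q x0 <# H = \<one> <# H" by force
  then have "inv (q x0) \<in> H" using lcoset_eq[of "q x0" \<one>] q_closed by simp
  then have h: "q x0 \<in> H" using subgroup.m_inv_closed[OF subgroup_H, of "inv (q x0)"] q_closed x0 by simp
  have K0: "letter k x0 = x0" "state k x0 \<in> K" if "k \<in> K" for k
  proof -
    have k: "k \<in> carrier G" "\<And>v. v \<in> lists X \<Longrightarrow> act k (x0 # v) = x0 # v" using that Cons_in_lists_iff x0(1) by (simp_all add: K_def del: act_Cons in_listsI in_lists_conv_set)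
    from k(2)[of "[]"] show "letter k x0 = x0" by simp
    have "act (state k x0) v = v" if "v \<in> lists X" for v using k(2)[OF that] by simp
    then show "state k x0 \<in> K" using k(1) x0(1) by (simp add: K_def state_closed)
  qed
  have "K \<subseteq> H"
  proof
    fix k assume k: "k \<in> K"
    then have kc: "k \<in> carrier G" by (simp add: K_def)
    have "inv (q x0) \<otimes> k \<otimes> q x0 \<in> H" using letter(2)[OF kc x0(1)] K0(1)[OF k] by simp
    then have "q x0 \<otimes> (inv (q x0) \<otimes> k \<otimes> q x0) \<otimes> inv (q x0) \<in> H"
      using h subgroup.m_closed[OF subgroup_H] subgroup.m_inv_closed[OF subgroup_H] by simp
    then show "k \<in> H" using kc q_closed[OF x0(1)] by (simp add: m_assoc cancel)
  qed
  moreover have "\<phi> ` K \<subseteq> K"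
  proof (rule image_subsetI)
    fix k assume k: "k \<in> K"
    then have kc: "k \<in> carrier G" by (simp add: K_def)
    \<comment> \<open>Conjugation by the digit cancels the digits in the formula for states, which
      exhibits \<open>\<phi> k\<close> as a state of an element of the kernel.\<close>
    define k' where "k' = q x0 \<otimes> k \<otimes> inv (q x0)"
    have k': "k' \<in> K" unfolding k'_def using \<open>K \<lhd> G\<close> k q_closed[OF x0(1)] by (auto simp: normal_inv_iff)
    have "state k' x0 = \<phi> k"
      unfolding state_def K0(1)[OF k'] unfolding k'_def using kc q_closed[OF x0(1)] by (simp add: m_assoc cancel)
    then show "\<phi> k \<in> K" using K0(2)[OF k'] by simp
  qed
  ultimately have "K \<subseteq> {\<one>}" using core \<open>K \<lhd> G\<close> unfolding is_virtual_core_def by blast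
  then show ?thesis using g by (auto simp: K_def)
qed

lemma act_inj:
  assumes "g \<in> carrier G" "h \<in> carrier G" "\<And>v. v \<in> lists X \<Longrightarrow> act g v = act h v"
  shows "g = h"
proof -
  have "inv h \<otimes> g = \<one>"
    using assms by (intro trivial_kernel) (simp_all add: act_mult act_inv del: in_listsI in_lists_conv_set)
  then show ?thesis using assms by (metis inv_closed inv_equality inv_inv)
qed

lemma faithful: "faithful_self_similar_action G X act"
proof -
  have "inj_on (\<lambda>g. restrict (act g) (lists X)) (carrier G)"
  proof (rule inj_onI)
    fix g h assume gh: "g \<in> carrier G" "h \<in> carrier G" "restrict (act g) (lists X) = restrict (act h) (lists X)"
    show "g = h" using act_inj[OF gh(1,2)] fun_cong[OF gh(3)] by (metis restrict_apply')
  qed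
  moreover have "\<forall>x\<in>X. \<forall>g\<in>carrier G. \<exists>y\<in>X. \<exists>h\<in>carrier G. \<forall>v\<in>lists X. act g (x # v) = y # act h v"
    by (metis letter(1) state_closed act_Cons)
  ultimately show ?thesis
    using finite_X group_action_act
    by (simp add: faithful_self_similar_action_def self_similar_action_def faithful_action_def faithful_action_axioms_def)
qed

text \<open>Faithfulness provides the uniqueness that the definite description requires.\<close>

lemma letter_state_eq:
  assumes "g \<in> carrier G" "x \<in> X"
  shows "letter_state G X act g x = state g x"
  unfolding letter_state_def
proof (rule the_equality)
  show "state g x \<in> carrier G \<and> (\<exists>y\<in>X. \<forall>v\<in>lists X. act g (x # v) = y # act (state g x) v)"
    using assms letter(1) state_closed by auto
  fix h assume h: "h \<in> carrier G \<and> (\<exists>y\<in>X. \<forall>v\<in>lists X. act g (x # v) = y # act h v)"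
  then have "act h v = act (state g x) v" if "v \<in> lists X" for v using that by (metis act_Cons list.inject)
  then show "h = state g x" using h assms state_closed by (intro act_inj) auto
qed

lemma word_state_eq: "g \<in> carrier G \<Longrightarrow> v \<in> lists X \<Longrightarrow> word_state G X act g v = states g v"
  by (induction v arbitrary: g) (auto simp: letter_state_eq state_closed)

lemma finite_state_iff:
  "finite_state_action G X act \<longleftrightarrow> (\<forall>g\<in>carrier G. finite (states g ` lists X))"
proof -
  have "word_state G X act g ` lists X = states g ` lists X" if "g \<in> carrier G" for g
    using that by (intro image_cong refl) (rule word_state_eq)
  then show ?thesis using faithful by (simp add: finite_state_action_def)
qed

text \<open>The average of \<open>l\<close> over the states of \<open>s\<close> at the letters is \<open>c * l s\<close>. For a state \<open>s\<close> maximising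
  \<open>cmod (l s)\<close> all these values coincide, so \<open>s\<close> and all its states fix every letter.\<close>

lemma character_zero:
  fixes l :: "'g \<Rightarrow> complex"
  assumes l: "\<And>g h. g \<in> carrier G \<Longrightarrow> h \<in> carrier G \<Longrightarrow> l (g \<otimes> h) = l g + l h"
    and eig: "\<And>h. h \<in> H \<Longrightarrow> l (\<phi> h) = c * l h" and c: "cmod c \<ge> 1"
    and inj: "inj_on (\<lambda>x. l (q x)) X"
    and fin: "finite_state_action G X act" and g: "g \<in> carrier G"
  shows "l g = 0"
proof -
  have l1: "l \<one> = 0" using l[of \<one> \<one>] by simp
  have linv: "l (inv x) = - l x" if "x \<in> carrier G" for x
    using l[of x "inv x"] that l1 by (simp add: eq_neg_iff_add_eq_0 add.commute)
  have lst: "l (state s x) = c * (l s + l (q x) - l (q (letter s x)))" if "s \<in> carrier G" "x \<in> X" for s x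
    unfolding state_def using that letter q_closed by (simp add: eig l linv algebra_simps)
  define S where "S = states g ` lists X"
  have S: "finite S" "S \<subseteq> carrier G" "g \<in> S"
    using fin g finite_state_iff states_closed by (auto simp: S_def intro!: rev_image_eqI[of "[]"])
  have S_state: "state s x \<in> S" if s: "s \<in> S" and x: "x \<in> X" for s x
  proof -
    obtain v where v: "v \<in> lists X" "s = states g v" using s by (auto simp: S_def)
    then have "state s x = states g (v @ [x])" by (simp add: states_append)
    then show ?thesis unfolding S_def using v x by auto
  qed
  define m where "m = Max ((\<lambda>s. cmod (l s)) ` S)"
  have m: "cmod (l s) \<le> m" if "s \<in> S" for s unfolding m_def using S that by simp
  have "m \<in> (\<lambda>s. cmod (l s)) ` S" unfolding m_def using S by (intro Max_in) auto
  then obtain s0 where s0: "s0 \<in> S" "cmod (l s0) = m" by auto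
  have fixes_letter: "letter s x = x \<and> cmod (l (state s x)) = m" if s: "s \<in> S" "cmod (l s) = m" and x: "x \<in> X" for s x
  proof -
    have sc: "s \<in> carrier G" using s S by blast
    have "(\<Sum>x\<in>X. l (q (letter s x))) = (\<Sum>x\<in>X. l (q x))"
      using sum.reindex_bij_betw[OF letter_bij[OF sc]] .
    then have sum: "(\<Sum>x\<in>X. l (state s x)) = of_nat (card X) * (c * l s)"
      using sc by (simp add: lst sum_distrib_left[symmetric] sum.distrib sum_subtractf)
    have "m \<le> cmod (c * l s)" using c s(2) norm_ge_zero[of "l s"] mult_right_mono[of 1 "cmod c" m] by (simp add: norm_mult)
    then have eq: "l (state s x) = c * l s"
      using equal_if_sum_norm_maximal[OF finite_X m[OF S_state[OF s(1)]] sum _ x] by blast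
    then have "c * (l (q x) - l (q (letter s x))) = 0" using lst[OF sc x] by (simp add: algebra_simps)
    then have "l (q x) = l (q (letter s x))" using c by auto
    then have "letter s x = x" using inj x letter(1)[OF sc x] by (auto simp: inj_on_def)
    \<comment> \<open>The state is extremal again, which carries the argument along every
      word.\<close>
    moreover have "cmod (l (state s x)) = m"
      using eq m[OF S_state[OF s(1) x]] \<open>m \<le> cmod (c * l s)\<close> by simp
    ultimately show ?thesis by simp
  qed
  have "act s v = v" if "s \<in> S" "cmod (l s) = m" "v \<in> lists X" for s v
    using that
  proof (induction v arbitrary: s)
    case (Cons x v)
    then show ?case using fixes_letter[OF Cons(2,3), of x] S_state by auto
  qed simp
  then have "s0 = \<one>" using s0 S by (intro trivial_kernel) auto
  then have "m = 0" using s0 l1 by simp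
  then show ?thesis using m[OF S(3)] by simp
qed

end

context virtual_endo
begin

text \<open>A nonzero character has infinitely many values, so it cannot vanish on a subgroup of
  finite index, and it takes infinitely many values on every coset. Representatives are picked coset
  by coset, avoiding the finitely many values already taken.\<close>

lemma digits_separated_by_character:
  fixes l :: "'g \<Rightarrow> complex"
  assumes l: "\<And>g h. g \<in> carrier G \<Longrightarrow> h \<in> carrier G \<Longrightarrow> l (g \<otimes> h) = l g + l h"
    and g: "g \<in> carrier G" "l g \<noteq> 0"
  shows "\<exists>(X::nat set) q. digit_set G H X q \<and> inj_on (\<lambda>x. l (q x)) X"
proof -
  define Q where "Q = (\<lambda>g. g <# H) ` carrier G"
  have fQ: "finite Q" unfolding Q_def by (rule finite_lcosets)
  have l1: "l \<one> = 0" using l[of \<one> \<one>] by simp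
  have pow: "l (x [^] (k::nat)) = of_nat k * l x" if "x \<in> carrier G" for x k
    using that by (induction k) (auto simp: l l1 algebra_simps)
  have inf: "infinite (l ` A)" if "x \<in> carrier G" "l x \<noteq> 0" "\<And>k::nat. x [^] k \<in> A" for x A
  proof
    assume "finite (l ` A)"
    moreover have "range (\<lambda>k::nat. l (x [^] k)) \<subseteq> l ` A" using that by blast
    ultimately have "finite (range (\<lambda>k::nat. l (x [^] k)))" using finite_subset by blast
    moreover have "inj (\<lambda>k::nat. l (x [^] k))" using that by (auto simp: inj_on_def pow)
    ultimately show False using finite_imageD by blast
  qed
  have "\<exists>h\<in>H. l h \<noteq> 0"
  proof (rule ccontr)
    assume "\<not> ?thesis"
    then have "l x = l y" if "x \<in> a <# H" "y \<in> a <# H" "a \<in> carrier G" for x y a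
      using that H_carrier by (auto simp: lcoset_mem l)
    moreover have self: "x \<in> x <# H" if "x \<in> carrier G" for x
      using that subgroup.one_closed[OF subgroup_H] by (force simp: lcoset_mem)
    ultimately have "l x = l (SOME y. y \<in> x <# H)" if "x \<in> carrier G" for x
      using that by (metis someI)
    then have "l ` carrier G \<subseteq> (\<lambda>C. l (SOME y. y \<in> C)) ` Q" unfolding Q_def by auto
    then have "finite (l ` carrier G)" using fQ finite_surj by blast
    then show False using inf[OF g, of "carrier G"] g by simp
  qed
  then obtain h where h: "h \<in> H" "l h \<noteq> 0" by blast
  have infH: "infinite (l ` H)"
  proof (rule inf[OF H_carrier[OF h(1)] h(2)])
    show "h [^] (k::nat) \<in> H" for k
      by (induction k) (use h subgroup.one_closed[OF subgroup_H] subgroup.m_closed[OF subgroup_H] in auto)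
  qed
  have inf_coset: "infinite (l ` (a <# H))" if "a \<in> carrier G" for a
  proof
    assume "finite (l ` (a <# H))"
    moreover have "l ` H \<subseteq> (\<lambda>z. z - l a) ` (l ` (a <# H))"
    proof (rule image_subsetI)
      fix k assume k: "k \<in> H"
      then have "a \<otimes> k \<in> a <# H" by (auto simp: lcoset_mem)
      moreover have "l k = l (a \<otimes> k) - l a" using that k H_carrier by (simp add: l)
      ultimately show "l k \<in> (\<lambda>z. z - l a) ` (l ` (a <# H))" by blast
    qed
    ultimately show False using infH finite_surj by blast
  qed
  obtain e where e: "bij_betw e {..<card Q} Q"
    using ex_bij_betw_nat_finite[OF fQ] by (auto simp: atLeast0LessThan)
  have "\<exists>q. (\<forall>i<n. q i \<in> e i) \<and> inj_on (\<lambda>i. l (q i)) {..<n}" if "n \<le> card Q" for n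
    using that
  proof (induction n)
    case (Suc n)
    then obtain q where q: "\<forall>i<n. q i \<in> e i" "inj_on (\<lambda>i. l (q i)) {..<n}" by auto
    have "e n \<in> Q" using e Suc by (auto simp: bij_betw_def)
    then obtain a where "a \<in> carrier G" "e n = a <# H" by (auto simp: Q_def)
    then have "infinite (l ` e n)" using inf_coset by simp
    then have "\<not> l ` e n \<subseteq> (\<lambda>i. l (q i)) ` {..<n}" using finite_subset by blast
    then obtain x where x: "x \<in> e n" "l x \<notin> (\<lambda>i. l (q i)) ` {..<n}" by blast
    show ?case
    proof (intro exI conjI)
      show "\<forall>i<Suc n. (q(n := x)) i \<in> e i" using q x by (auto simp: less_Suc_eq)
      show "inj_on (\<lambda>i. l ((q(n := x)) i)) {..<Suc n}"
      proof -
        have "inj_on (\<lambda>i. l ((q(n := x)) i)) {..<n}"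
          using q(2) by (rule inj_on_cong[THEN iffD1, rotated]) simp
        moreover have "l x \<notin> (\<lambda>i. l ((q(n := x)) i)) ` {..<n}" using x(2) by auto
        ultimately show ?thesis unfolding lessThan_Suc inj_on_insert by auto
      qed
    qed
  qed simp
  then obtain q where q: "\<forall>i<card Q. q i \<in> e i" "inj_on (\<lambda>i. l (q i)) {..<card Q}" by blast
  have qe: "q i \<in> carrier G \<and> q i <# H = e i" if i: "i < card Q" for i
  proof -
    have "e i \<in> Q" using e i by (auto simp: bij_betw_def)
    then obtain a where a: "a \<in> carrier G" "e i = a <# H" by (auto simp: Q_def)
    then have "q i \<in> a <# H" using q(1) i by blast
    then obtain k where k: "k \<in> H" "q i = a \<otimes> k" by (auto simp: lcoset_mem)
    then have "q i \<in> carrier G" "inv a \<otimes> q i = k" using a H_carrier by (auto simp: cancel)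
    then show ?thesis using lcoset_eq[of a "q i"] a k by simp
  qed
  have "bij_betw (\<lambda>i. q i <# H) {..<card Q} Q"
    using e by (rule bij_betw_cong[THEN iffD1, rotated]) (simp add: qe)
  then have "digit_set G H {..<card Q} q" using qe by (auto simp: digit_set_def Q_def)
  then show ?thesis using q(2) by blast
qed

end

section \<open>Lie groups and the theorem\<close>

lemma Ck_on_cong:
  assumes "open S" "\<And>x. x \<in> S \<Longrightarrow> f x = g x" "Ck_on k S f"
  shows "Ck_on k S g"
  using assms(2,3)
proof (induction k arbitrary: f g)
  case 0
  then show ?case by (metis Ck_on.simps(1) continuous_on_cong)
next
  case (Suc k)
  have der: "(g has_derivative frechet_derivative f (at x)) (at x)" if "x \<in> S" for x
  proof (rule has_derivative_transform_within_open[OF _ assms(1) that])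
    show "(f has_derivative frechet_derivative f (at x)) (at x)"
      using Suc.prems(2) that by (simp add: frechet_derivative_works)
  qed (use Suc.prems(1) in auto)
  have eq: "frechet_derivative f (at x) v = frechet_derivative g (at x) v" if "x \<in> S" for x v
    using frechet_derivative_at[OF der[OF that]] by simp
  have "Ck_on k S (\<lambda>x. frechet_derivative g (at x) v)" for v
    by (rule Suc.IH[of "\<lambda>x. frechet_derivative f (at x) v"]) (use eq Suc.prems(2) in auto)
  then show ?case using der by (auto simp: differentiable_def)
qed

lemma Ck_on_translate:
  assumes "open S" "Ck_on k S f"
  shows "Ck_on k ((\<lambda>x. x + a) -` S) (\<lambda>x. f (x + a) - b)"
  using assms(2)
proof (induction k arbitrary: f b)
  case 0
  then show ?case
    by (auto intro!: continuous_intros elim: continuous_on_compose2)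
next
  case (Suc k)
  have op: "open ((\<lambda>x. x + a) -` S)" using assms(1) by (intro open_vimage continuous_intros)
  have der: "((\<lambda>x. f (x + a) - b) has_derivative frechet_derivative f (at (x + a))) (at x)" if "x + a \<in> S" for x
  proof -
    have "(f has_derivative frechet_derivative f (at (x + a))) (at (x + a))"
      using Suc.prems that by (simp add: frechet_derivative_works)
    moreover have "((\<lambda>x. x + a) has_derivative (\<lambda>v. v)) (at x)" by (auto intro!: derivative_eq_intros)
    ultimately have "((\<lambda>x. f (x + a)) has_derivative frechet_derivative f (at (x + a))) (at x)"
      using has_derivative_compose[of "\<lambda>x. x + a" "\<lambda>v. v" x UNIV f] by simp
    from has_derivative_diff[OF this has_derivative_const[of b]] show ?thesis by simp
  qed
  have "Ck_on k ((\<lambda>x. x + a) -` S) (\<lambda>x. frechet_derivative (\<lambda>x. f (x + a) - b) (at x) v)" for v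
  proof (rule Ck_on_cong[OF op])
    show "Ck_on k ((\<lambda>x. x + a) -` S) (\<lambda>x. frechet_derivative f (at (x + a)) v - 0)"
      using Suc.prems by (intro Suc.IH) simp
    show "frechet_derivative f (at (x + a)) v - 0 = frechet_derivative (\<lambda>x. f (x + a) - b) (at x) v"
      if "x \<in> (\<lambda>x. x + a) -` S" for x
      using frechet_derivative_at[OF der, of x] that by simp
  qed
  then show ?case using der by (auto simp: differentiable_def)
qed

section \<open>Charts centred at the identity\<close>

lemma (in lie_group) chart_at_one:
  assumes UC: "(U, c) \<in> A" and one: "\<one> \<in> U"
  shows "\<exists>\<beta> C R. chart_group L U (\<lambda>x. c x - c \<one>) (\<lambda>v. inv_into U c (v + c \<one>)) \<beta> C R"
proof -
  define e where "e = c \<one>"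
  define \<kappa> where "\<kappa> x = c x - e" for x
  have fd: "\<exists>B::'e set. finite B \<and> span B = UNIV" using atlas by (simp add: smooth_atlas_def)
  have chart: "open U" "open (c ` U)" "homeomorphism U (c ` U) c (inv_into U c)"
    using atlas UC by (force simp: smooth_atlas_def is_chart_def)+
  have cinj: "inj_on c U" using homeomorphism_apply1[OF chart(3)] by (metis inj_onI)
  have inv_c: "inv_into U c (c x) = x" if "x \<in> U" for x using homeomorphism_apply1[OF chart(3) that] .
  have contc: "continuous_on U c" "continuous_on (c ` U) (inv_into U c)"
    using chart(3) by (auto simp: homeomorphism_def)
  have cm: "continuous_on UNIV (\<lambda>(x, y). x \<otimes> y)" using smooth_mult by (simp add: smooth_map_def)
  have ci: "continuous_on UNIV (\<lambda>x. inv x)" using smooth_inv by (simp add: smooth_map_def)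
  define Q where "Q = (U \<times> U) \<inter> (\<lambda>(x, y). x \<otimes> y) -` U"
  define f0 where "f0 = c \<circ> (\<lambda>(x, y). x \<otimes> y) \<circ> inv_into (U \<times> U) (map_prod c c)"
  define S0 where "S0 = map_prod c c ` Q"
  have "(U \<times> U, map_prod c c) \<in> prod_atlas A A" unfolding prod_atlas_def using UC by force
  then have "smooth_on S0 f0"
    using smooth_mult UC unfolding smooth_map_def S0_def f0_def Q_def by fastforce
  then have C2: "Ck_on (Suc (Suc 0)) S0 f0" unfolding smooth_on_def by blast
  have openQ: "open Q"
    unfolding Q_def using chart(1) by (intro open_Int open_Times open_vimage[OF _ cm])
  have inj2: "inj_on (map_prod c c) (U \<times> U)" using cinj by (auto simp: inj_on_def)
  have openS0: "open S0"
  proof -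
    define J where "J p = (inv_into U c (fst p), inv_into U c (snd p))" for p
    have cJ: "continuous_on (c ` U \<times> c ` U) J"
      unfolding J_def
      by (intro continuous_on_Pair continuous_on_compose2[OF contc(2)] continuous_intros) auto
    have "S0 = J -` Q \<inter> (c ` U \<times> c ` U)"
    proof
      show "S0 \<subseteq> J -` Q \<inter> (c ` U \<times> c ` U)" unfolding S0_def J_def Q_def using inv_c by auto
      show "J -` Q \<inter> (c ` U \<times> c ` U) \<subseteq> S0"
        unfolding S0_def J_def using inv_c by (force simp: image_iff)
    qed
    moreover have "open (J -` Q \<inter> (c ` U \<times> c ` U))"
      using continuous_on_open_vimage[OF open_Times[OF chart(2,2)], of J] cJ openQ by blast
    ultimately show ?thesis by simp
  qed
  \<comment> \<open>Arguments and values are shifted by \<open>e = c \<one>\<close>, so that the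
    identity has coordinate 0, as the expansion requires.\<close>
  define S where "S = (\<lambda>p. p + (e, e)) -` S0"
  define m where "m p = f0 (p + (e, e)) - e" for p
  have openS: "open S" unfolding S_def using openS0 by (intro open_vimage continuous_intros)
  have C2m: "Ck_on (Suc (Suc 0)) S m"
    unfolding S_def m_def[abs_def] by (rule Ck_on_translate[OF openS0 C2])
  have mval: "m (\<kappa> x, \<kappa> y) = \<kappa> (x \<otimes> y)" if "x \<in> U" "y \<in> U" for x y
  proof -
    have "(\<kappa> x, \<kappa> y) + (e, e) = map_prod c c (x, y)" by (simp add: \<kappa>_def)
    moreover have "inv_into (U \<times> U) (map_prod c c) (map_prod c c (x, y)) = (x, y)"
      using that by (intro inv_into_f_f[OF inj2]) auto
    ultimately show ?thesis unfolding m_def f0_def \<kappa>_def[of "x \<otimes> y"] by simp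
  qed
  have Smem: "\<exists>x y. x \<in> U \<and> y \<in> U \<and> x \<otimes> y \<in> U \<and> u = \<kappa> x \<and> v = \<kappa> y" if "(u, v) \<in> S" for u v
  proof -
    have "(u + e, v + e) \<in> S0" using that by (simp add: S_def)
    then obtain x y where "x \<in> U" "y \<in> U" "x \<otimes> y \<in> U" "u + e = c x" "v + e = c y"
      unfolding S0_def Q_def by auto
    then show ?thesis by (intro exI[of _ x] exI[of _ y]) (simp add: \<kappa>_def eq_diff_eq)
  qed
  have \<kappa>_inj: "x = y" if "x \<in> U" "y \<in> U" "\<kappa> x = \<kappa> y" for x y
    using that cinj by (auto simp: \<kappa>_def inj_on_def)
  have \<kappa>1: "\<kappa> \<one> = 0" by (simp add: \<kappa>_def e_def)
  have S00: "(0, 0) \<in> S"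
  proof -
    have "(c \<one>, c \<one>) \<in> S0" unfolding S0_def Q_def using one by (intro image_eqI[of _ _ "(\<one>, \<one>)"]) auto
    then show ?thesis by (simp add: S_def e_def)
  qed
  have m0: "m (u, 0) = u" if uS: "(u, 0) \<in> S" for u
  proof -
    obtain x y where xy: "x \<in> U" "y \<in> U" "u = \<kappa> x" "0 = \<kappa> y" using Smem[OF uS] by blast
    then have "y = \<one>" using \<kappa>_inj[of y \<one>] \<kappa>1 one by simp
    then show ?thesis using mval[OF xy(1,2)] xy \<kappa>1 carrier_UNIV by simp
  qed
  have m0': "m (0, v) = v" if vS: "(0, v) \<in> S" for v
  proof -
    obtain x y where xy: "x \<in> U" "y \<in> U" "0 = \<kappa> x" "v = \<kappa> y" using Smem[OF vS] by blast
    then have "x = \<one>" using \<kappa>_inj[of x \<one>] \<kappa>1 one by simp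
    then show ?thesis using mval[OF xy(1,2)] xy \<kappa>1 carrier_UNIV by simp
  qed
  obtain \<beta> where \<beta>: "bounded_bilinear \<beta>" "\<And>\<epsilon>. \<epsilon> > 0 \<Longrightarrow> \<exists>\<delta>>0. \<forall>x y. norm x < \<delta> \<longrightarrow> norm y < \<delta> \<longrightarrow>
      (x, y) \<in> S \<and> norm (m (x, y) - x - y - \<beta> x y) \<le> \<epsilon> * norm x * norm y"
    using second_order_expansion[OF fd openS S00 C2m m0 m0'] by blast
  \<comment> \<open>That the product stays in \<open>U\<close> is recorded in \<open>S\<close>,
    which consists of the coordinates of pairs with product in \<open>U\<close>; injectivity of
    \<open>\<kappa>\<close> identifies the pair.\<close>
  have exp: "\<exists>\<delta>>0. \<forall>x\<in>U. \<forall>y\<in>U. norm (\<kappa> x) < \<delta> \<longrightarrow> norm (\<kappa> y) < \<delta> \<longrightarrow>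
      x \<otimes> y \<in> U \<and> norm (\<kappa> (x \<otimes> y) - \<kappa> x - \<kappa> y - \<beta> (\<kappa> x) (\<kappa> y)) \<le> \<epsilon> * norm (\<kappa> x) * norm (\<kappa> y)" if e: "\<epsilon> > 0" for \<epsilon>
  proof -
    obtain \<delta> where \<delta>: "\<delta> > 0" "\<forall>x y. norm x < \<delta> \<longrightarrow> norm y < \<delta> \<longrightarrow>
      (x, y) \<in> S \<and> norm (m (x, y) - x - y - \<beta> x y) \<le> \<epsilon> * norm x * norm y" using \<beta>(2)[OF e] by blast
    have "x \<otimes> y \<in> U \<and> norm (\<kappa> (x \<otimes> y) - \<kappa> x - \<kappa> y - \<beta> (\<kappa> x) (\<kappa> y)) \<le> \<epsilon> * norm (\<kappa> x) * norm (\<kappa> y)"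
      if xy: "x \<in> U" "y \<in> U" "norm (\<kappa> x) < \<delta>" "norm (\<kappa> y) < \<delta>" for x y
    proof
      have S: "(\<kappa> x, \<kappa> y) \<in> S" using \<delta>(2) xy by blast
      then obtain x' y' where "x' \<in> U" "y' \<in> U" "x' \<otimes> y' \<in> U" "\<kappa> x = \<kappa> x'" "\<kappa> y = \<kappa> y'" using Smem by blast
      then show "x \<otimes> y \<in> U" using \<kappa>_inj xy by metis
      show "norm (\<kappa> (x \<otimes> y) - \<kappa> x - \<kappa> y - \<beta> (\<kappa> x) (\<kappa> y)) \<le> \<epsilon> * norm (\<kappa> x) * norm (\<kappa> y)"
        using \<delta>(2) xy mval[OF xy(1,2)] by metis
    qed
    then show ?thesis using \<delta>(1) by blast
  qed
  obtain Kb where Kb: "Kb > 0" "\<And>u v. norm (\<beta> u v) \<le> norm u * norm v * Kb"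
    using bounded_bilinear.pos_bounded[OF \<beta>(1)] by blast
  obtain \<delta> where \<delta>: "\<delta> > 0" "\<forall>x\<in>U. \<forall>y\<in>U. norm (\<kappa> x) < \<delta> \<longrightarrow> norm (\<kappa> y) < \<delta> \<longrightarrow>
      x \<otimes> y \<in> U \<and> norm (\<kappa> (x \<otimes> y) - \<kappa> x - \<kappa> y - \<beta> (\<kappa> x) (\<kappa> y)) \<le> 1 * norm (\<kappa> x) * norm (\<kappa> y)"
    using exp[of 1] by auto
  have \<kappa>U: "\<kappa> ` U = (\<lambda>v. v + e) -` (c ` U)" unfolding \<kappa>_def by (force simp: image_iff algebra_simps)
  have open\<kappa>U: "open (\<kappa> ` U)" unfolding \<kappa>U using chart(2) by (intro open_vimage continuous_intros)
  moreover have "0 \<in> \<kappa> ` U" using \<kappa>1 one by (metis image_eqI)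
  ultimately obtain r where r: "r > 0" "ball 0 r \<subseteq> \<kappa> ` U" using open_contains_ball by blast
  \<comment> \<open>\<open>Kb\<close> bounds the bilinear term and 1 is the expansion error for
    \<open>\<epsilon> = 1\<close>; the bound \<open>1 / (4 * C)\<close> on \<open>R\<close> yields
    \<open>C * R \<le> 1/4\<close>.\<close>
  define C where "C = Kb + 1"
  define R where "R = min \<delta> (min r (1 / (4 * C)))"
  have C: "C > 0" unfolding C_def using Kb by simp
  have R: "R > 0" "R \<le> \<delta>" "R \<le> r" "R \<le> 1 / (4 * C)" unfolding R_def using \<delta> r C by auto
  have quasi: "x \<otimes> y \<in> U \<and> norm (\<kappa> (x \<otimes> y) - \<kappa> x - \<kappa> y) \<le> C * norm (\<kappa> x) * norm (\<kappa> y)"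
    if xy: "x \<in> U" "y \<in> U" "norm (\<kappa> x) < R" "norm (\<kappa> y) < R" for x y
  proof -
    have "x \<otimes> y \<in> U" "norm (\<kappa> (x \<otimes> y) - \<kappa> x - \<kappa> y - \<beta> (\<kappa> x) (\<kappa> y)) \<le> 1 * norm (\<kappa> x) * norm (\<kappa> y)"
      using \<delta>(2) xy R by auto
    then show ?thesis
      using norm_triangle_sub[of "\<kappa> (x \<otimes> y) - \<kappa> x - \<kappa> y" "\<beta> (\<kappa> x) (\<kappa> y)"] Kb(2)[of "\<kappa> x" "\<kappa> y"]
      by (simp add: C_def algebra_simps)
  qed
  have "chart_group L U \<kappa> (\<lambda>v. inv_into U c (v + e)) \<beta> C R"
  proof (intro chart_group.intro chart_group_axioms.intro group_axioms, goal_cases)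
    case 1 then show ?case by (rule carrier_UNIV)
  next
    case 2 then show ?case by (rule cm)
  next
    case 3 then show ?case by (rule ci)
  next
    case 4 then show ?case by (rule chart)
  next
    case 5 then show ?case by (rule one)
  next
    case 6 then show ?case by (rule \<kappa>1)
  next
    case 7 then show ?case unfolding \<kappa>_def[abs_def] by (intro continuous_intros contc)
  next
    case 8 then show ?case
      by (rule continuous_on_compose2[OF contc(2)]) (auto intro!: continuous_intros simp: \<kappa>_def)
  next
    case (9 x) then show ?case using inv_c by (simp add: \<kappa>_def)
  next
    case 10 then show ?case by (rule \<beta>)
  next
    case (11 \<epsilon>) then show ?case using exp[of \<epsilon>] by blast
  next
    case 12 then show ?case using C by simp
  next
    case 13 then show ?case by (rule R)
  next
    case 14
    have "C * R \<le> C * (1 / (4 * C))" using R C by (intro mult_left_mono) auto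
    then show ?case using C by simp
  next
    case 15
    have "ball 0 R \<subseteq> ball (0::'e) r" using R by (intro subset_ball)
    then show ?case using r by blast
  next
    case (16 x y) then show ?case using quasi by blast
  next
    case (17 x y) then show ?case using quasi by blast
  qed
  then show ?thesis unfolding \<kappa>_def[abs_def] e_def by blast
qed

lemma (in lie_group) chart_automorphism_at_one:
  assumes UC: "(U, c) \<in> A" and one: "\<one> \<in> U" and \<Phi>: "lie_automorphism L A \<Phi>"
  shows "\<exists>\<kappa> \<eta> \<beta> C R. chart_automorphism L U \<kappa> \<eta> \<beta> C R \<Phi> (lie_differential L (U, c) \<Phi>)"
proof -
  define \<kappa> where "\<kappa> x = c x - c \<one>" for x
  define \<eta> where "\<eta> v = inv_into U c (v + c \<one>)" for v
  obtain \<beta> C R where "chart_group L U \<kappa> \<eta> \<beta> C R"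
    using chart_at_one[OF UC one] unfolding \<kappa>_def[abs_def] \<eta>_def[abs_def] by blast
  then interpret cg: chart_group L U \<kappa> \<eta> \<beta> C R .
  have fd: "\<exists>B::'e set. finite B \<and> span B = UNIV" using atlas by (simp add: smooth_atlas_def)
  have mult: "\<Phi> (x \<otimes> y) = \<Phi> x \<otimes> \<Phi> y" for x y
    using \<Phi> by (auto simp: lie_automorphism_def iso_def hom_def carrier_UNIV)
  have cont: "continuous_on UNIV \<Phi>" using \<Phi> by (simp add: lie_automorphism_def smooth_map_def)
  have \<Phi>1: "\<Phi> \<one> = \<one>"
    using mult[of \<one> \<one>] l_cancel_one[of "\<Phi> \<one>" "\<Phi> \<one>"] by (simp add: carrier_UNIV)
  define F where "F = c \<circ> \<Phi> \<circ> inv_into U c"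
  define T where "T = lie_differential L (U, c) \<Phi>"
  have "smooth_on (c ` (U \<inter> \<Phi> -` U)) F"
    using \<Phi> UC unfolding lie_automorphism_def smooth_map_def F_def by fastforce
  then have "Ck_on (Suc 0) (c ` (U \<inter> \<Phi> -` U)) F" unfolding smooth_on_def by blast
  moreover have "c \<one> \<in> c ` (U \<inter> \<Phi> -` U)" using one \<Phi>1 by (intro imageI) simp
  ultimately have "F differentiable (at (c \<one>))" unfolding Ck_on.simps by blast
  \<comment> \<open>Differentiability makes \<open>frechet_derivative\<close> the actual derivative
    rather than an arbitrary choice; recentring the chart does not affect it.\<close>
  then have der: "(F has_derivative T) (at (c \<one>))"
    unfolding T_def lie_differential_def F_def by (simp add: frechet_derivative_works)
  have inv_c: "inv_into U c (c x) = x" if "x \<in> U" for x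
    using cg.\<eta>_\<kappa>[OF that] by (simp add: \<kappa>_def \<eta>_def)
  have deriv: "\<exists>\<delta>>0. \<forall>x\<in>cg.nbhd \<delta>. \<Phi> x \<in> U \<and> norm (\<kappa> (\<Phi> x) - T (\<kappa> x)) \<le> \<epsilon> * norm (\<kappa> x)" if e: "\<epsilon> > 0" for \<epsilon>
  proof -
    obtain d where d: "d > 0" "\<And>y. norm (y - c \<one>) < d \<Longrightarrow> norm (F y - F (c \<one>) - T (y - c \<one>)) \<le> \<epsilon> * norm (y - c \<one>)"
      using der e unfolding has_derivative_at_alt by blast
    have "open (\<Phi> -` U)" by (rule open_vimage[OF cg.open_U cont])
    moreover have "\<one> \<in> \<Phi> -` U" using \<Phi>1 one by simp
    ultimately obtain d' where d': "d' > 0" "cg.nbhd d' \<subseteq> \<Phi> -` U" using cg.nbhd_base by blast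
    have "\<Phi> x \<in> U \<and> norm (\<kappa> (\<Phi> x) - T (\<kappa> x)) \<le> \<epsilon> * norm (\<kappa> x)" if x: "x \<in> cg.nbhd (min d d')" for x
    proof
      show "\<Phi> x \<in> U" using d'(2) x cg.nbhd_mono[of "min d d'" d'] by auto
      have xU: "x \<in> U" "norm (c x - c \<one>) < d" using x by (auto simp: cg.nbhd_def \<kappa>_def)
      have "F (c x) = c (\<Phi> x)" "F (c \<one>) = c \<one>" using inv_c xU one \<Phi>1 by (auto simp: F_def)
      then show "norm (\<kappa> (\<Phi> x) - T (\<kappa> x)) \<le> \<epsilon> * norm (\<kappa> x)"
        using d(2)[OF xU(2)] by (simp add: \<kappa>_def)
    qed
    then show ?thesis using d d' by (intro exI[of _ "min d d'"]) auto
  qed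
  have "chart_automorphism L U \<kappa> \<eta> \<beta> C R \<Phi> T"
    by (intro chart_automorphism.intro cg.chart_group_axioms chart_automorphism_axioms.intro
        fd mult has_derivative_linear[OF der] deriv)
  then show ?thesis unfolding T_def by blast
qed

text \<open>Otherwise \<open>F\<close> factors through the compact quotient and is bounded, whereas
  its values at the powers of \<open>x0\<close> grow linearly.\<close>

lemma (in chart_group) character_nonzero_on_cocompact:
  assumes \<Gamma>: "cocompact_subgroup L \<Gamma>"
    and F: "\<And>x y. F (x \<otimes> y) = F x + F y" "continuous_on UNIV F" "F x0 \<noteq> (0::complex)"
  shows "\<exists>g\<in>\<Gamma>. F g \<noteq> 0"
proof (rule ccontr)
  assume "\<not> ?thesis"
  then have zero: "F g = 0" if "g \<in> \<Gamma>" for g using that by blast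
  obtain Y where Y: "quotient_map euclidean Y (\<lambda>x. x <#\<^bsub>L\<^esub> \<Gamma>)" "compact_space Y"
    using \<Gamma> by (auto simp: cocompact_subgroup_def)
  have sub: "subgroup \<Gamma> L" using \<Gamma> by (simp add: cocompact_subgroup_def)
  have const: "F x = F y" if eq: "x <# \<Gamma> = y <# \<Gamma>" for x y
  proof -
    have "x \<in> x <# \<Gamma>" using subgroup.one_closed[OF sub] by (force simp: l_coset_def)
    then have "x \<in> y <# \<Gamma>" using eq by simp
    then obtain g where "g \<in> \<Gamma>" "x = y \<otimes> g" by (auto simp: l_coset_def)
    then show ?thesis using zero by (simp add: F)
  qed
  have cF: "continuous_map euclidean euclidean F" using F(2) by simp
  obtain h where h: "continuous_map Y euclidean h" "h ` topspace Y = F ` topspace euclidean"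
    by (rule quotient_map_lift_exists[OF Y(1) cF]) (use const in blast)+
  have "compactin euclidean (h ` topspace Y)"
    using image_compactin[OF _ h(1)] Y(2) by (simp add: compact_space_def)
  then have "bounded (range F)" using h(2) by (simp add: compact_imp_bounded)
  then obtain B where B: "\<And>x. cmod (F x) \<le> B" by (auto simp: bounded_iff)
  have F1: "F \<one> = 0" using F(1)[of \<one> \<one>] by simp
  have pow: "F (x0 [^] (n::nat)) = of_nat n * F x0" for n
    by (induction n) (auto simp: F F1 algebra_simps)
  obtain n :: nat where n: "B / cmod (F x0) < real n" using reals_Archimedean2 by blast
  have "real n * cmod (F x0) \<le> B" using B[of "x0 [^] n"] by (simp add: pow norm_mult)
  then show False using n F(3) by (simp add: field_simps)
qed

theorem theorem3:
  fixes G :: "('g, 'm) monoid_scheme"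
    and H :: "'g set"
    and \<phi> :: "'g \<Rightarrow> 'g"
    and L :: "'l::{t2_space,second_countable_topology} monoid"
    and A :: "('l, 'e::real_normed_vector) chart set"
    and \<iota> :: "'g \<Rightarrow> 'l"
    and \<Phi> :: "'l \<Rightarrow> 'l"
    and C :: "('l, 'e) chart"
  assumes "group G" and "finitely_generated_group G"
    and "torsion_free_group G" and "nilpotent_group G"
    and "virtual_endomorphism G H \<phi>" and "\<phi> ` H = carrier G"
    and "is_virtual_core G H \<phi> {\<one>\<^bsub>G\<^esub>}"
    and "malcev_completion G L A \<iota>"
    and "lie_automorphism L A \<Phi>" and "\<forall>h\<in>H. \<Phi> (\<iota> h) = \<iota> (\<phi> h)"
    and "C \<in> A" and "\<one>\<^bsub>L\<^esub> \<in> fst C"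
  shows "(\<forall>(X::nat set) q. digit_set G H X q \<longrightarrow>
            finite_state_action G X (associated_action G H \<phi> X q)) \<longleftrightarrow>
         complex_spectral_radius (lie_differential L C \<Phi>) < 1"
proof -
  obtain U c where C: "C = (U, c)" by (cases C)
  have mc: "lie_group L A" "nilpotent_group L" "connected (UNIV :: 'l set)" "simply_connected (UNIV :: 'l set)"
    "\<iota> \<in> hom G L" "inj_on \<iota> (carrier G)" "discrete (\<iota> ` carrier G)" "cocompact_subgroup L (\<iota> ` carrier G)"
    using assms(8) by (auto simp: malcev_completion_def)
  define T where "T = lie_differential L C \<Phi>"
  obtain \<kappa> \<eta> \<beta> C' R where "chart_automorphism L U \<kappa> \<eta> \<beta> C' R \<Phi> T"
    using lie_group.chart_automorphism_at_one[OF mc(1), of U c \<Phi>] assms(9,11,12) C T_def by auto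
  then interpret chart_automorphism L U \<kappa> \<eta> \<beta> C' R \<Phi> T .
  interpret ve: virtual_endo G H \<phi>
    using assms(1,5) by (simp add: virtual_endo_def virtual_endo_axioms_def)
  have \<iota>_mult: "\<iota> (x \<otimes>\<^bsub>G\<^esub> y) = \<iota> x \<otimes>\<^bsub>L\<^esub> \<iota> y" if "x \<in> carrier G" "y \<in> carrier G" for x y
    using mc(5) that by (simp add: hom_def)
  have \<iota>_one: "\<iota> \<one>\<^bsub>G\<^esub> = \<one>\<^bsub>L\<^esub>" using hom_one[OF mc(5) assms(1)] group_axioms by simp
  have \<iota>_inv: "\<iota> (inv\<^bsub>G\<^esub> x) = inv\<^bsub>L\<^esub> (\<iota> x)" if "x \<in> carrier G" for x
  proof -
    have "\<iota> (inv\<^bsub>G\<^esub> x) \<otimes>\<^bsub>L\<^esub> \<iota> x = \<one>\<^bsub>L\<^esub>"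
      using \<iota>_mult[of "inv\<^bsub>G\<^esub> x" x] that \<iota>_one by simp
    then show ?thesis using inv_equality by simp
  qed
  have ext: "\<Phi> (\<iota> h) = \<iota> (\<phi> h)" if "h \<in> H" for h using assms(10) that by blast
  show ?thesis unfolding T_def[symmetric]
  proof
    assume all: "\<forall>(X::nat set) q. digit_set G H X q \<longrightarrow> finite_state_action G X (associated_action G H \<phi> X q)"
    show "complex_spectral_radius T < 1"
    proof (rule ccontr)
      assume "\<not> ?thesis"
      then obtain F l where F: "\<And>x y. F (x \<otimes>\<^bsub>L\<^esub> y) = F x + F y" "\<exists>x. F x \<noteq> 0" "continuous_on UNIV F"
        "\<And>x. F (\<Phi> x) = l * F x" "cmod l \<ge> 1"
        using global_character[OF mc(2) _ mc(3,4)] by blast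
      obtain g where g: "g \<in> carrier G" "F (\<iota> g) \<noteq> 0"
        using character_nonzero_on_cocompact[OF mc(8) F(1,3)] F(2) by blast
      have add: "F (\<iota> (x \<otimes>\<^bsub>G\<^esub> y)) = F (\<iota> x) + F (\<iota> y)" if "x \<in> carrier G" "y \<in> carrier G" for x y
        using that by (simp add: \<iota>_mult F(1))
      \<comment> \<open>The hypothesis covers all digit sets, so one may be chosen on which the
        character is injective.\<close>
      obtain X :: "nat set" and q where q: "digit_set G H X q" "inj_on (\<lambda>x. F (\<iota> (q x))) X"
        using ve.digits_separated_by_character[of "\<lambda>x. F (\<iota> x)", OF add g] by blast
      interpret da: digit_action G H \<phi> X q
        using q(1) assms(7) by unfold_locales
      have "F (\<iota> g) = 0"
        by (rule da.character_zero[of "\<lambda>x. F (\<iota> x)" l, OF add _ F(5) q(2) _ g(1)])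
          (use all q(1) ext F(4) in \<open>auto simp: ext[symmetric]\<close>)
      then show False using g by simp
    qed
  next
    assume sr: "complex_spectral_radius T < 1"
    show "\<forall>(X::nat set) q. digit_set G H X q \<longrightarrow> finite_state_action G X (associated_action G H \<phi> X q)"
    proof (intro allI impI)
      fix X :: "nat set" and q assume q: "digit_set G H X q"
      interpret da: digit_action G H \<phi> X q
        using q assms(7) by unfold_locales
      define D where "D = \<iota> ` q ` X"
      have D: "finite D" unfolding D_def using da.finite_X by simp
      \<comment> \<open>Induction from the first letter: with \<open>n\<close> letters remaining,
        its two digits enter through \<open>\<Phi> ^^ Suc n\<close> and stand to the left of the
        earlier factors, as in the recursion of \<open>prods\<close>.\<close>
      have st: "\<exists>a\<in>prods D (length v). \<exists>b\<in>prods D (length v).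
          \<iota> (da.states g v) = inv\<^bsub>L\<^esub> a \<otimes>\<^bsub>L\<^esub> (\<Phi> ^^ length v) (\<iota> g) \<otimes>\<^bsub>L\<^esub> b"
        if "g \<in> carrier G" "v \<in> lists X" for g v
        using that
      proof (induction v arbitrary: g)
        case Nil then show ?case by simp
      next
        case (Cons x v)
        define s y n where "s = da.state g x" and "y = da.letter g x" and "n = length v"
        have x: "x \<in> X" "v \<in> lists X" using Cons.prems by auto
        have s: "s \<in> carrier G" unfolding s_def by (rule da.state_closed[OF Cons.prems(1) x(1)])
        have y: "y \<in> X" "inv\<^bsub>G\<^esub> (q y) \<otimes>\<^bsub>G\<^esub> g \<otimes>\<^bsub>G\<^esub> q x \<in> H" unfolding y_def using da.letter[OF Cons.prems(1) x(1)] by auto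
        have "\<iota> s = \<Phi> (\<iota> (inv\<^bsub>G\<^esub> (q y) \<otimes>\<^bsub>G\<^esub> g \<otimes>\<^bsub>G\<^esub> q x))"
          unfolding s_def da.state_def y_def[symmetric] using ext[OF y(2)] by simp
        also have "\<dots> = inv\<^bsub>L\<^esub> (\<Phi> (\<iota> (q y))) \<otimes>\<^bsub>L\<^esub> \<Phi> (\<iota> g) \<otimes>\<^bsub>L\<^esub> \<Phi> (\<iota> (q x))"
          using da.q_closed x(1) y(1) Cons.prems(1) by (simp add: \<iota>_mult \<iota>_inv \<Phi>_mult \<Phi>_inv)
        finally have \<iota>s: "\<iota> s = inv\<^bsub>L\<^esub> (\<Phi> (\<iota> (q y))) \<otimes>\<^bsub>L\<^esub> \<Phi> (\<iota> g) \<otimes>\<^bsub>L\<^esub> \<Phi> (\<iota> (q x))" .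
        obtain a b where ab: "a \<in> prods D n" "b \<in> prods D n"
          "\<iota> (da.states s v) = inv\<^bsub>L\<^esub> a \<otimes>\<^bsub>L\<^esub> (\<Phi> ^^ n) (\<iota> s) \<otimes>\<^bsub>L\<^esub> b"
          using Cons.IH[OF s x(2)] unfolding n_def by blast
        define a' where "a' = (\<Phi> ^^ Suc n) (\<iota> (q y)) \<otimes>\<^bsub>L\<^esub> a"
        define b' where "b' = (\<Phi> ^^ Suc n) (\<iota> (q x)) \<otimes>\<^bsub>L\<^esub> b"
        have qD: "\<iota> (q y) \<in> D" "\<iota> (q x) \<in> D" unfolding D_def using x(1) y(1) by auto
        have "a' \<in> prods D (Suc n)"
          unfolding a'_def prods.simps by (rule image_eqI[of _ _ "(\<iota> (q y), a)"]) (use ab qD in auto)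
        moreover have "b' \<in> prods D (Suc n)"
          unfolding b'_def prods.simps by (rule image_eqI[of _ _ "(\<iota> (q x), b)"]) (use ab qD in auto)
        moreover have "\<iota> (da.states g (x # v)) = inv\<^bsub>L\<^esub> a' \<otimes>\<^bsub>L\<^esub> (\<Phi> ^^ Suc n) (\<iota> g) \<otimes>\<^bsub>L\<^esub> b'"
        proof -
          have sw: "(\<Phi> ^^ n) (\<Phi> z) = \<Phi> ((\<Phi> ^^ n) z)" for z by (simp add: funpow_swap1)
          show ?thesis
            unfolding da.states.simps s_def[symmetric] ab(3) \<iota>s a'_def b'_def
            by (simp add: \<Phi>n_mult \<Phi>n_inv sw inv_mult_group m_assoc)
        qed
        ultimately show ?case unfolding n_def by auto
      qed
      show "finite_state_action G X (associated_action G H \<phi> X q)"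
        unfolding da.finite_state_iff
      proof
        fix g assume g: "g \<in> carrier G"
        obtain K where K: "compact K" "\<forall>n. \<forall>a\<in>prods D n. \<forall>b\<in>prods D n. inv\<^bsub>L\<^esub> a \<otimes>\<^bsub>L\<^esub> (\<Phi> ^^ n) (\<iota> g) \<otimes>\<^bsub>L\<^esub> b \<in> K"
          using products_relatively_compact[OF sr mc(3) D, of "\<iota> g"] by (elim exE conjE)
        \<comment> \<open>Finiteness is found in the completion, where all states lie in
          \<open>K\<close>, and comes back to \<open>G\<close> by injectivity of
          \<open>\<iota>\<close>.\<close>
        have "finite ((\<iota> ` carrier G) \<inter> K)"
          using mc(8) by (intro discrete_subgroup_compact_finite mc(7) K(1)) (simp add: cocompact_subgroup_def)
        moreover have "\<iota> ` (da.states g ` lists X) \<subseteq> (\<iota> ` carrier G) \<inter> K"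
        proof (intro subsetI, elim imageE, hypsubst)
          fix v assume v: "v \<in> lists X"
          show "\<iota> (da.states g v) \<in> (\<iota> ` carrier G) \<inter> K"
            using st[OF g v] K(2) da.states_closed[OF g v] by auto
        qed
        ultimately have "finite (\<iota> ` (da.states g ` lists X))" by (rule finite_subset[rotated])
        moreover have "inj_on \<iota> (da.states g ` lists X)"
          using mc(6) da.states_closed[OF g] by (rule_tac inj_on_subset) auto
        ultimately show "finite (da.states g ` lists X)" by (rule finite_imageD)
      qed
    qed
  qed
qed

end
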